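(* Consider a supercritical branching random walk with $m(1)=1$, $\sigma^2:=\operatorname{Var}W_1(1)<\infty$ and $m(2)<1$. Then, as $n\to\infty$, $$\left(\frac{W_\infty(1)-W_{n+r}(1)}{(m(2))^{(n+r)/2}}\right)_{r\in\mathbb N_0}\longrightarrow\left(\sqrt{v^2W_\infty(2)}\,U_r\right)_{r\in\mathbb N_0}$$ weakly (i.e. in distribution) on $\mathbb R^\infty$, where $v^2:=\operatorname{Var}W_\infty(1)=\sigma^2(1-m(2))^{-1}$, and $(U_r)_{r\in\mathbb N_0}$ is a stationary zero-mean Gaussian sequence which is independent of $W_\infty(2)$ and has covariance function $$\operatorname{Cov}(U_r,U_s)=(m(2))^{|r-s|/2},\qquad r,s\in\mathbb N_0.$$
   Context: Branching random walk (BRW): Let $\mathcal Z=\sum_{i=1}^{J}\delta_{X_i}$ be a point process on $\mathbb R$, where $J=\mathcal Z(\mathbb R)\in\{0,1,2,\dots\}\cup\{\infty\}$ is random and may be infinite with positive probability; no assumption is made on the dependence structure of $J,X_1,X_2,\dots$. Let $\mathbb V=\bigcup_{n\ge0}\mathbb N^n$ and let $\mathcal Z(u)=\sum_{i=1}^{J(u)}\delta_{X_i(u)}$, $u\in\mathbb V$, be i.i.d. copies of $\mathcal Z$ on a probability space $(\Omega,\mathcal F,\mathbb P)$. The ancestor $\varnothing$ is at $S(\varnothing)=0$. An individual $u$ of generation $n$ at position $S(u)$ has children $ui$, $1\le i\le J(u)$ (all $i\in\mathbb N$ if $J(u)=\infty$), at positions $S(ui)=S(u)+X_i(u)$, forming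 part of generation $n+1$. $\sum_{|u|=n}$ denotes the sum over all individuals actually present in generation $n$. The BRW is supercritical: $\mathbb E J>1$. For $\theta\in\mathbb R$ let $m(\theta)=\mathbb E\big[\sum_{i=1}^J e^{-\theta X_i}\big]\in[0,\infty]$. For $\gamma$ with $m(\gamma)<\infty$, the Biggins martingale is $W_n(\gamma)=(m(\gamma))^{-n}\sum_{|u|=n}e^{-\gamma S(u)}$, $n\in\mathbb N_0$; it is a nonnegative martingale with respect to $\mathcal F_n=\sigma\{\mathcal Z(u):u\in\mathbb N^k,\ k<n\}$, and $W_\infty(\gamma)$ denotes its almost sure limit. $\mathbb R^\infty$ is the space of real sequences $(x_0,x_1,\dots)$ with the complete separable metric $\rho(x,y)=\sum_{j\ge0}2^{-j}\frac{|x_j-y_j|}{1+|x_j-y_j|}$, which metrizes pointwise convergence. *)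

theory Defs
  imports "HOL-Probability.Probability"
begin

text \<open>
  Individuals are finite words over the natural numbers (children are numbered from 0, so
  the children of \<open>u\<close> are \<open>u @ [i]\<close> with \<open>enat i < J u \<omega>\<close>).  The point process attached to \<open>u\<close> has
  \<open>J u\<close> points, located at \<open>X u i\<close> for \<open>enat i < J u\<close>.  The values \<open>X u i\<close> with
  \<open>J u \<le> enat i\<close> are meaningless; \<open>mark\<close> overwrites them by 0 so that nothing is assumed about them.
\<close>

definition mark ::
    "(nat list \<Rightarrow> 'w \<Rightarrow> enat) \<Rightarrow> (nat list \<Rightarrow> nat \<Rightarrow> 'w \<Rightarrow> real) \<Rightarrow> nat list \<Rightarrow> 'w \<Rightarrow> enat \<times> (nat \<Rightarrow> real)"
  where "mark J X u \<omega> = (J u \<omega>, \<lambda>i. if enat i < J u \<omega> then X u i \<omega> else 0)"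

text \<open>The Borel sets of \<^typ>\<open>nat \<Rightarrow> real\<close> are those of the product topology, so \<open>borel\<close> is
  the usual product sigma-algebra there.\<close>

definition mark_space :: "(enat \<times> (nat \<Rightarrow> real)) measure"
  where "mark_space = count_space UNIV \<Otimes>\<^sub>M borel"

text \<open>The generic point process is the one of the ancestor, \<open>mark J X []\<close>.\<close>

locale branching_random_walk = prob_space M
  for M :: "'w measure" +
  fixes J :: "nat list \<Rightarrow> 'w \<Rightarrow> enat"
    and X :: "nat list \<Rightarrow> nat \<Rightarrow> 'w \<Rightarrow> real"
  assumes marks_indep: "indep_vars (\<lambda>_. mark_space) (mark J X) UNIV"
    and marks_identically_distributed:
      "\<And>u. distr M mark_space (mark J X u) = distr M mark_space (mark J X [])"

definition supercritical :: "'w measure \<Rightarrow> (nat list \<Rightarrow> 'w \<Rightarrow> enat) \<Rightarrow> bool"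
  where "supercritical M J \<longleftrightarrow> (\<integral>\<^sup>+\<omega>. ennreal_of_enat (J [] \<omega>) \<partial>M) > 1"

definition generation :: "(nat list \<Rightarrow> 'w \<Rightarrow> enat) \<Rightarrow> nat \<Rightarrow> 'w \<Rightarrow> nat list set"
  where "generation J n \<omega> = {u. length u = n \<and> (\<forall>k<n. enat (u ! k) < J (take k u) \<omega>)}"

definition position :: "(nat list \<Rightarrow> nat \<Rightarrow> 'w \<Rightarrow> real) \<Rightarrow> nat list \<Rightarrow> 'w \<Rightarrow> real"
  where "position X u \<omega> = (\<Sum>k<length u. X (take k u) (u ! k) \<omega>)"

lemma generation_0: "generation J 0 \<omega> = {[]}"
  by (auto simp: generation_def)

lemma generation_Suc:
  "generation J (Suc n) \<omega> = {u @ [i] | u i. u \<in> generation J n \<omega> \<and> enat i < J u \<omega>}"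
proof (intro set_eqI iffI)
  fix w assume w: "w \<in> generation J (Suc n) \<omega>"
  then have "w \<noteq> []" by (auto simp: generation_def)
  then obtain u i where "w = u @ [i]" by (metis rev_exhaust)
  moreover from this w have "u \<in> generation J n \<omega> \<and> enat i < J u \<omega>"
    by (auto simp: generation_def less_Suc_eq nth_append split: if_splits)
  ultimately show "w \<in> {u @ [i] | u i. u \<in> generation J n \<omega> \<and> enat i < J u \<omega>}" by blast
qed (auto simp: generation_def less_Suc_eq nth_append)

lemma position_Nil: "position X [] \<omega> = 0"
  by (simp add: position_def)

lemma position_snoc: "position X (u @ [i]) \<omega> = position X u \<omega> + X u i \<omega>"
  by (simp add: position_def nth_append)

definition brw_m ::
    "'w measure \<Rightarrow> (nat list \<Rightarrow> 'w \<Rightarrow> enat) \<Rightarrow> (nat list \<Rightarrow> nat \<Rightarrow> 'w \<Rightarrow> real) \<Rightarrow> real \<Rightarrow> ennreal"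
  where "brw_m M J X \<theta> =
    (\<integral>\<^sup>+\<omega>. (\<Sum>\<^sub>\<infinity>i\<in>{i. enat i < J [] \<omega>}. ennreal (exp (- \<theta> * X [] i \<omega>))) \<partial>M)"

text \<open>The sum over a generation may be infinite, but only on a null set when \<open>brw_m M J X \<gamma> < \<infinity>\<close>;
  there \<^const>\<open>enn2real\<close> gives the value 0.\<close>

definition biggins ::
    "'w measure \<Rightarrow> (nat list \<Rightarrow> 'w \<Rightarrow> enat) \<Rightarrow> (nat list \<Rightarrow> nat \<Rightarrow> 'w \<Rightarrow> real) \<Rightarrow> real \<Rightarrow> nat \<Rightarrow> 'w \<Rightarrow> real"
  where "biggins M J X \<gamma> n \<omega> =
    enn2real (\<Sum>\<^sub>\<infinity>u\<in>generation J n \<omega>. ennreal (exp (- \<gamma> * position X u \<omega>)))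
      / enn2real (brw_m M J X \<gamma>) ^ n"

text \<open>On the null set where the martingale does not converge, \<^const>\<open>lim\<close> is a fixed unspecified real.\<close>

definition biggins_lim ::
    "'w measure \<Rightarrow> (nat list \<Rightarrow> 'w \<Rightarrow> enat) \<Rightarrow> (nat list \<Rightarrow> nat \<Rightarrow> 'w \<Rightarrow> real) \<Rightarrow> real \<Rightarrow> 'w \<Rightarrow> real"
  where "biggins_lim M J X \<gamma> \<omega> = lim (\<lambda>n. biggins M J X \<gamma> n \<omega>)"

definition covariance :: "'b measure \<Rightarrow> ('b \<Rightarrow> real) \<Rightarrow> ('b \<Rightarrow> real) \<Rightarrow> real"
  where "covariance N Y Z =
    (\<integral>x. (Y x - integral\<^sup>L N Y) * (Z x - integral\<^sup>L N Z) \<partial>N)"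

text \<open>Degenerate normal laws are allowed.\<close>

definition gaussian_variable :: "'b measure \<Rightarrow> ('b \<Rightarrow> real) \<Rightarrow> bool"
  where "gaussian_variable N Y \<longleftrightarrow> Y \<in> borel_measurable N \<and>
    ((\<exists>\<mu> \<sigma>. \<sigma> > 0 \<and> distributed N lborel Y (normal_density \<mu> \<sigma>)) \<or> (\<exists>c. AE x in N. Y x = c))"

definition gaussian_sequence :: "'b measure \<Rightarrow> (nat \<Rightarrow> 'b \<Rightarrow> real) \<Rightarrow> bool"
  where "gaussian_sequence N U \<longleftrightarrow>
    (\<forall>(a :: nat \<Rightarrow> real) k. gaussian_variable N (\<lambda>x. \<Sum>r<k. a r * U r x))"

definition stationary_sequence :: "'b measure \<Rightarrow> (nat \<Rightarrow> 'b \<Rightarrow> real) \<Rightarrow> bool"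
  where "stationary_sequence N U \<longleftrightarrow> (\<forall>r. U r \<in> borel_measurable N) \<and>
    (\<forall>h. distr N borel (\<lambda>x r. U (r + h) x) = distr N borel (\<lambda>x r. U r x))"

text \<open>\<^const>\<open>prob_space.indep_var\<close> requires both variables to have the same range type; this is the
  same notion for \<open>Y\<close> and \<open>Z\<close> with different range types.\<close>

definition independent_variables ::
    "'b measure \<Rightarrow> 'c measure \<Rightarrow> ('b \<Rightarrow> 'c) \<Rightarrow> 'd measure \<Rightarrow> ('b \<Rightarrow> 'd) \<Rightarrow> bool"
  where "independent_variables N S Y T Z \<longleftrightarrow> Y \<in> measurable N S \<and> Z \<in> measurable N T \<and>
    prob_space.indep_set N {Y -` A \<inter> space N | A. A \<in> sets S} {Z -` B \<inter> space N | B. B \<in> sets T}"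

definition weakly_converges :: "(nat \<Rightarrow> 'a :: topological_space measure) \<Rightarrow> 'a measure \<Rightarrow> bool"
  where "weakly_converges \<mu> \<nu> \<longleftrightarrow>
    (\<forall>f :: 'a \<Rightarrow> real. continuous_on UNIV f \<longrightarrow> bounded (range f) \<longrightarrow>
      (\<lambda>n. integral\<^sup>L (\<mu> n) f) \<longlonglongrightarrow> integral\<^sup>L \<nu> f)"

text \<open>For \<open>'a = nat \<Rightarrow> real\<close> the library's topology is that of pointwise convergence, i.e. the one
  metrized by \<open>\<rho>(x, y) = \<Sum>j. 2^(-j) * \<bar>x j - y j\<bar> / (1 + \<bar>x j - y j\<bar>)\<close>.\<close>

definition converges_in_distribution ::
    "'w measure \<Rightarrow> (nat \<Rightarrow> 'w \<Rightarrow> 'a :: topological_space) \<Rightarrow> 'b measure \<Rightarrow> ('b \<Rightarrow> 'a) \<Rightarrow> bool"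
  where "converges_in_distribution M Y N Z \<longleftrightarrow>
    (\<forall>n. Y n \<in> borel_measurable M) \<and> Z \<in> borel_measurable N \<and>
    weakly_converges (\<lambda>n. distr M borel (Y n)) (distr N borel Z)"

end

theory Submission
  imports Defs
begin

text \<open>
  Given the first \<open>n\<close> generations, every linear combination of the normalized differences
  \<open>W\<^sub>\<infinity>(1) - W\<^bsub>n+r\<^esub>(1)\<close> is a sum, over the individuals \<open>u\<close> of generation \<open>n\<close>, of independent copies of one
  centred square integrable variable, multiplied by \<open>c\<^sub>u = e\<^bsup>-S(u)\<^esup> / m(2)\<^bsup>n/2\<^esup>\<close>. The squares of the \<open>c\<^sub>u\<close> sum to
  \<open>W\<^sub>n(2)\<close>, so the conditional characteristic function is close to \<open>exp (- \<tau> W\<^sub>n(2) / 2)\<close> as soon as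
  the largest \<open>c\<^sub>u\<close> is small. The latter holds in probability: the individual weight of a size-biased
  pick is the exponential of a random walk whose step is not identically \<open>0\<close>, and such a walk leaves every
  compact set in probability. The step cannot vanish because \<open>m(1) = 1\<close> and \<open>m(2) < 1\<close>.
  On sequences, convergence of these characteristic functions together with bounded second moments
  yields weak convergence by the Stone--Weierstrass theorem.
\<close>

section \<open>Weak convergence of random sequences\<close>

text \<open>No conditional laws are constructed. Everything is transported to the canonical space of
  marked trees, where the branching property is one product formula: the subtree at \<open>u\<close>
  is independent of the tree with that subtree erased. Being determined by the first n generations
  becomes invariance under \<open>cut n\<close>, and conditioning becomes Fubini's theorem for this
  product. Three obstacles shape the rest. A generation may be infinite, so moment identities are
  proved in \<open>ennreal\<close>, and branching sums enter as limits of finite sums over words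
  with letters below N. Only second moments are available, so the Gaussian comparison rests on an
  error d * x^2 for small x, with the sum of squares controlled by W_n(2), whose mean is 1. Finally,
  W_n(2) may lose mass in the limit; its almost sure convergence still lets bounded convergence turn
  exp (- \<tau> W_n(2) / 2) into the characteristic function of a Gaussian mixture. The value of
  \<tau> comes from orthogonal martingale increments: E (W_inf(1) - W_r(1)) (W_inf(1) - W_s(1)) is
  v2 * m(2)^max(r,s), which the normalization turns into v2 * m(2)^(|r-s|/2).\<close>

inductive_set trig_poly :: "((nat \<Rightarrow> real) \<Rightarrow> real) set" where
  wave: "(\<lambda>x. c * cos ((\<Sum>r<k. a r * x r) + b)) \<in> trig_poly"
| add: "f \<in> trig_poly \<Longrightarrow> g \<in> trig_poly \<Longrightarrow> (\<lambda>x. f x + g x) \<in> trig_poly"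

lemma continuous_on_coordinate [continuous_intros]: "continuous_on S (\<lambda>x :: nat \<Rightarrow> real. x r)"
  by (rule continuous_on_subset[OF continuous_on_product_coordinates subset_UNIV])

lemma trig_poly_continuous: "f \<in> trig_poly \<Longrightarrow> continuous_on S f"
  by (induction rule: trig_poly.induct) (auto intro!: continuous_intros)

lemma trig_poly_bounded: "f \<in> trig_poly \<Longrightarrow> \<exists>B. \<forall>x. \<bar>f x\<bar> \<le> B"
proof (induction rule: trig_poly.induct)
  case (wave c a k b)
  have "\<bar>c * cos ((\<Sum>r<k. a r * x r) + b)\<bar> \<le> \<bar>c\<bar>" for x
    by (simp add: abs_mult mult_left_le)
  then show ?case by blast
next
  case (add f g)
  then obtain B C where "\<forall>x. \<bar>f x\<bar> \<le> B" "\<forall>x. \<bar>g x\<bar> \<le> C" by blast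
  then have "\<bar>f x + g x\<bar> \<le> B + C" for x
    using abs_triangle_ineq[of "f x" "g x"] by (meson add_mono order_trans)
  then show ?case by blast
qed

lemma linear_form_extend:
  fixes a :: "nat \<Rightarrow> real"
  assumes "k \<le> m"
  shows "(\<Sum>r<k. a r * x r) = (\<Sum>r<m. (if r < k then a r else 0) * x r)"
  using assms by (intro sum.mono_neutral_cong_left) auto

text \<open>Product-to-sum formula: a product of two cosines is half the sum of the cosines of the
  difference and of the sum of their arguments. Padding with zero coefficients lets both linear
  forms run over the same indices.\<close>

lemma trig_poly_mult_wave:
  assumes "g \<in> trig_poly"
  shows "(\<lambda>x. c * cos ((\<Sum>r<k. a r * x r) + b) * g x) \<in> trig_poly"
  using assms
proof (induction rule: trig_poly.induct)
  case (wave d e l h)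
  define m where "m = max k l"
  define A where "A = (\<lambda>r. if r < k then a r else 0)"
  define E where "E = (\<lambda>r. if r < l then e r else 0)"
  have k: "(\<Sum>r<k. a r * x r) = (\<Sum>r<m. A r * x r)" for x
    unfolding A_def by (rule linear_form_extend) (simp add: m_def)
  have l: "(\<Sum>r<l. e r * x r) = (\<Sum>r<m. E r * x r)" for x
    unfolding E_def by (rule linear_form_extend) (simp add: m_def)
  have "(\<lambda>x. c * cos ((\<Sum>r<k. a r * x r) + b) * (d * cos ((\<Sum>r<l. e r * x r) + h))) =
     (\<lambda>x. (c * d / 2) * cos ((\<Sum>r<m. (A r - E r) * x r) + (b - h)) +
          (c * d / 2) * cos ((\<Sum>r<m. (A r + E r) * x r) + (b + h)))"
  proof
    fix x
    have "(\<Sum>r<m. (A r - E r) * x r) + (b - h) = ((\<Sum>r<m. A r * x r) + b) - ((\<Sum>r<m. E r * x r) + h)"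
         "(\<Sum>r<m. (A r + E r) * x r) + (b + h) = ((\<Sum>r<m. A r * x r) + b) + ((\<Sum>r<m. E r * x r) + h)"
      by (simp_all add: algebra_simps sum.distrib sum_subtractf)
    then show "c * cos ((\<Sum>r<k. a r * x r) + b) * (d * cos ((\<Sum>r<l. e r * x r) + h)) =
          (c * d / 2) * cos ((\<Sum>r<m. (A r - E r) * x r) + (b - h)) +
          (c * d / 2) * cos ((\<Sum>r<m. (A r + E r) * x r) + (b + h))"
      unfolding k l by (simp only: cos_add cos_diff) (simp add: algebra_simps)
  qed
  then show ?case
    by (simp only: trig_poly.add[OF trig_poly.wave trig_poly.wave])
next
  case (add f g)
  show ?case
    using trig_poly.add[OF add.IH] by (simp only: distrib_left)
qed

lemma trig_poly_mult:
  assumes "f \<in> trig_poly" "g \<in> trig_poly"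
  shows "(\<lambda>x. f x * g x) \<in> trig_poly"
  using assms(1)
proof (induction rule: trig_poly.induct)
  case (wave c a k b)
  show ?case by (rule trig_poly_mult_wave[OF assms(2)])
next
  case (add f h)
  show ?case
    using trig_poly.add[OF add.IH] by (simp only: distrib_right)
qed

lemma trig_poly_const: "(\<lambda>_. c) \<in> trig_poly"
  using trig_poly.wave[of c "\<lambda>_. 0" 0 0] by simp

text \<open>The phase \<open>b\<close> in \<open>wave\<close> makes sines available, as cosines
  shifted by pi / 2.\<close>

lemma trig_poly_sin: "(\<lambda>x. sin (c * x r)) \<in> trig_poly"
proof -
  have "(\<lambda>x. 1 * cos ((\<Sum>q<Suc r. (if q = r then c else 0) * x q) + (- pi / 2))) = (\<lambda>x. sin (c * x r))"
    by (simp add: fun_eq_iff cos_diff if_distrib[of "\<lambda>z. z * _"] cong: if_cong)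
  then show ?thesis
    using trig_poly.wave[of 1 "\<lambda>q. if q = r then c else 0" "Suc r" "- pi / 2"] by simp
qed

text \<open>Tychonoff's theorem. The sequence space itself is not even locally compact, so uniform
  approximation is only asked for on such boxes.\<close>

lemma compact_box_sequences: "compact {x :: nat \<Rightarrow> real. \<forall>r. \<bar>x r\<bar> \<le> K r}"
proof -
  have "compactin (product_topology (\<lambda>_. euclidean) UNIV) (PiE UNIV (\<lambda>r. {- K r..K r}))"
    by (subst compactin_PiE) (auto simp: compactin_euclidean_iff)
  moreover have "PiE UNIV (\<lambda>r. {- K r..K r}) = {x. \<forall>r. \<bar>x r\<bar> \<le> K r}"
    by (auto simp: PiE_iff abs_le_iff minus_le_iff)
  ultimately show ?thesis
    by (simp add: euclidean_product_topology compactin_euclidean_iff)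
qed

text \<open>Polynomials in the functions \<open>sin (\<pi> x\<^sub>r / (2 K\<^sub>r))\<close> attain on the box all the values they take
  on the whole space, so a uniform approximation on the box is automatically bounded outside.\<close>

lemma trig_poly_approximation:
  fixes f :: "(nat \<Rightarrow> real) \<Rightarrow> real"
  assumes f: "continuous_on UNIV f" "\<And>x. \<bar>f x\<bar> \<le> B" and K: "\<And>r. K r > 0" and e: "e > 0"
  obtains p where "p \<in> trig_poly" "\<And>x. (\<forall>r. \<bar>x r\<bar> \<le> K r) \<Longrightarrow> \<bar>f x - p x\<bar> < e" "\<And>x. \<bar>p x\<bar> \<le> B + e"
proof -
  define s where "s = (\<lambda>r (x :: nat \<Rightarrow> real). sin (pi / (2 * K r) * x r))"
  define C where "C = {x :: nat \<Rightarrow> real. \<forall>r. \<bar>x r\<bar> \<le> K r}"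
  \<comment> \<open>The second condition says that \<open>p\<close> factors through the functions
    \<open>s r\<close>. It replaces the notion of a polynomial in the \<open>s r\<close>: it holds
    for each \<open>s r\<close>, is stable under sums and products, and is exactly what the bound
    outside the box needs.\<close>
  define R where "R = {p \<in> trig_poly. \<forall>x y. (\<forall>r. s r x = s r y) \<longrightarrow> p x = p y}"
  have RD: "p x = p y" if "p \<in> R" "\<And>r. s r x = s r y" for p x y
  proof -
    have "\<forall>x y. (\<forall>r. s r x = s r y) \<longrightarrow> p x = p y"
      using that(1) unfolding R_def mem_Collect_eq by (rule conjunct2)
    then show ?thesis using that(2) by blast
  qed
  have RI: "p \<in> R" if "p \<in> trig_poly" "\<And>x y. (\<And>r. s r x = s r y) \<Longrightarrow> p x = p y" for p
    unfolding R_def mem_Collect_eq using that by blast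
  have RT: "p \<in> trig_poly" if "p \<in> R" for p
    using that unfolding R_def mem_Collect_eq by (rule conjunct1)
  have range: "\<bar>pi / (2 * K r) * x r\<bar> \<le> pi / 2" if "x \<in> C" for x r
  proof -
    have "\<bar>pi / (2 * K r) * x r\<bar> = pi / (2 * K r) * \<bar>x r\<bar>"
      using K[of r] by (simp add: abs_mult)
    also have "\<dots> \<le> pi / (2 * K r) * K r"
      using that K[of r] by (intro mult_left_mono) (auto simp: C_def)
    also have "\<dots> = pi / 2"
      using K[of r] by simp
    finally show ?thesis .
  qed
  have "function_ring_on R C"
  proof
    show "compact C"
      unfolding C_def by (rule compact_box_sequences)
    show "continuous_on C f" if "f \<in> R" for f
      using RT[OF that] trig_poly_continuous by blast
    show "(\<lambda>x. f x + g x) \<in> R" if "f \<in> R" "g \<in> R" for f g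
      by (rule RI[OF trig_poly.add[OF RT[OF that(1)] RT[OF that(2)]]], rule arg_cong2[where f="(+)"])
        (erule RD[OF that(1)] RD[OF that(2)])+
    show "(\<lambda>x. f x * g x) \<in> R" if "f \<in> R" "g \<in> R" for f g
      by (rule RI[OF trig_poly_mult[OF RT[OF that(1)] RT[OF that(2)]]], rule arg_cong2[where f="(*)"])
        (erule RD[OF that(1)] RD[OF that(2)])+
    show "(\<lambda>_. c) \<in> R" for c
      by (intro RI trig_poly_const refl)
    show "\<exists>f\<in>R. f x \<noteq> f y" if C: "x \<in> C" "y \<in> C" and "x \<noteq> y" for x y
    proof -
      obtain r where r: "x r \<noteq> y r"
        using \<open>x \<noteq> y\<close> by auto
      have "s r x \<noteq> s r y"
      proof
        assume "s r x = s r y"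
        then have "pi / (2 * K r) * x r = pi / (2 * K r) * y r"
          unfolding s_def by - (rule sin_inj_pi, (use range[OF C(1), of r] range[OF C(2), of r] in linarith)+)
        then show False
          using r K[of r] by simp
      qed
      moreover have "s r \<in> R"
        by (rule RI) (auto simp only: s_def trig_poly_sin)
      ultimately show ?thesis by blast
    qed
  qed
  then interpret function_ring_on R C .
  obtain p where p: "p \<in> R" "\<And>x. x \<in> C \<Longrightarrow> \<bar>f x - p x\<bar> < e"
    using Stone_Weierstrass_basic[OF continuous_on_subset[OF f(1)] e] by blast
  have "\<bar>p x\<bar> \<le> B + e" for x
  proof -
    \<comment> \<open>\<open>y\<close> folds \<open>x\<close> back into the box: the arcsine takes
      values of modulus at most pi / 2, and the sine undoes it, so no \<open>s r\<close>
      distinguishes \<open>x\<close> from \<open>y\<close>.\<close>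
    define y where "y r = 2 * K r / pi * arcsin (s r x)" for r
    have "\<bar>arcsin (s r x)\<bar> \<le> pi / 2" for r
      using arcsin_bounded[OF sin_ge_minus_one sin_le_one, of "pi / (2 * K r) * x r"] unfolding s_def by linarith
    then have "\<bar>y r\<bar> \<le> 2 * K r / pi * (pi / 2)" for r
      unfolding y_def abs_mult using K[of r] by (intro mult_mono) auto
    then have y: "y \<in> C"
      using K by (simp add: C_def)
    have "s r y = s r x" for r
      using K[of r] by (simp add: s_def y_def)
    then have "p x = p y"
      by (intro RD[OF p(1)]) simp
    then show ?thesis
      using p(2)[OF y] f(2)[of y] by linarith
  qed
  with p show ?thesis
    by (intro that[of p] RT) (auto simp: C_def)
qed

section \<open>From characteristic functions to weak convergence\<close>

lemma borel_measurable_coordinate [measurable]: "(\<lambda>x :: nat \<Rightarrow> real. x r) \<in> borel_measurable borel"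
  by (intro borel_measurable_continuous_onI continuous_on_coordinate)

text \<open>By linearity only waves matter, and the integral of a wave is \<open>c\<close> times the
  real part of \<open>cis b\<close> times a characteristic function.\<close>

lemma trig_poly_integral_tendsto:
  fixes \<mu> :: "nat \<Rightarrow> (nat \<Rightarrow> real) measure"
  assumes "\<And>n. prob_space (\<mu> n)" "prob_space \<nu>" and [measurable_cong]: "\<And>n. sets (\<mu> n) = sets borel" "sets \<nu> = sets borel"
    and char: "\<And>k a. (\<lambda>n. \<integral>x. cis (\<Sum>r<k. a r * x r) \<partial>\<mu> n) \<longlonglongrightarrow> (\<integral>x. cis (\<Sum>r<k. a r * x r) \<partial>\<nu>)"
    and p: "p \<in> trig_poly"
  shows "(\<lambda>n. integral\<^sup>L (\<mu> n) p) \<longlonglongrightarrow> integral\<^sup>L \<nu> p"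
  using p
proof (induction rule: trig_poly.induct)
  case (wave c a k b)
  have *: "(\<integral>x. c * cos ((\<Sum>r<k. a r * x r) + b) \<partial>M) = c * Re (cis b * (\<integral>x. cis (\<Sum>r<k. a r * x r) \<partial>M))"
    if "prob_space M" and [measurable_cong]: "sets M = sets borel" for M
  proof -
    interpret prob_space M by fact
    have [simp]: "integrable M (\<lambda>x. cis (\<Sum>r<k. a r * x r))"
      by (rule integrable_const_bound[where B=1]) (auto simp: cis_conv_exp)
    have "cis b * (\<integral>x. cis (\<Sum>r<k. a r * x r) \<partial>M) = (\<integral>x. cis ((\<Sum>r<k. a r * x r) + b) \<partial>M)"
      by (simp add: cis_mult[symmetric] mult.commute)
    moreover have "integrable M (\<lambda>x. cis ((\<Sum>r<k. a r * x r) + b))"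
      by (simp add: cis_mult[symmetric])
    ultimately have "Re (cis b * (\<integral>x. cis (\<Sum>r<k. a r * x r) \<partial>M)) = (\<integral>x. cos ((\<Sum>r<k. a r * x r) + b) \<partial>M)"
      by (simp del: integral_mult_left integral_mult_right flip: integral_Re)
    then show ?thesis by simp
  qed
  show ?case
    unfolding *[OF assms(1,3)] *[OF assms(2,4)] by (intro tendsto_intros char)
next
  case (add f g)
  have int: "integrable M h" if "prob_space M" and [measurable_cong]: "sets M = sets borel" and h: "h \<in> trig_poly" for M h
  proof -
    interpret prob_space M by fact
    obtain B where "\<And>x. \<bar>h x\<bar> \<le> B" using trig_poly_bounded[OF h] by blast
    moreover have "h \<in> borel_measurable borel"
      using h trig_poly_continuous borel_measurable_continuous_onI by blast
    ultimately show ?thesis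
      by (intro integrable_const_bound[where B=B]) auto
  qed
  show ?case
    using tendsto_add[OF add.IH] int[OF assms(1,3) add.hyps(1)] int[OF assms(2,4) add.hyps(1)]
      int[OF assms(1,3) add.hyps(2)] int[OF assms(2,4) add.hyps(2)]
    by simp
qed

lemma integral_diff_bound_off_set:
  fixes f p :: "'a \<Rightarrow> real"
  assumes "prob_space M" and [measurable]: "f \<in> borel_measurable M" "p \<in> borel_measurable M" "A \<in> sets M"
    and "\<And>x. \<bar>f x\<bar> \<le> B" "\<And>x. \<bar>p x\<bar> \<le> C" "\<And>x. x \<in> space M \<Longrightarrow> x \<notin> A \<Longrightarrow> \<bar>f x - p x\<bar> \<le> e" "e \<ge> 0"
  shows "\<bar>integral\<^sup>L M f - integral\<^sup>L M p\<bar> \<le> e + (B + C) * measure M A"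
proof -
  interpret prob_space M by fact
  have int: "integrable M f" "integrable M p"
    using integrable_const_bound[of f B] integrable_const_bound[of p C] assms by auto
  have "\<bar>integral\<^sup>L M f - integral\<^sup>L M p\<bar> = \<bar>\<integral>x. f x - p x \<partial>M\<bar>"
    using int by simp
  also have "\<dots> \<le> (\<integral>x. \<bar>f x - p x\<bar> \<partial>M)"
    by (rule integral_abs_bound)
  also have "\<dots> \<le> (\<integral>x. e + (B + C) * indicator A x \<partial>M)"
  proof (rule integral_mono)
    show "\<bar>f x - p x\<bar> \<le> e + (B + C) * indicator A x" if "x \<in> space M" for x
      using assms(5,6)[of x] assms(7)[OF that] \<open>e \<ge> 0\<close> by (auto simp: indicator_def)
  next
    show "integrable M (\<lambda>x. e + (B + C) * indicator A x)"
      by (intro Bochner_Integration.integrable_add integrable_mult_right integrable_const integrable_real_indicator) (auto simp: emeasure_eq_measure)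
  qed (use int in auto)
  also have "\<dots> = e + (B + C) * measure M A"
    by (subst Bochner_Integration.integral_add)
      (auto simp: prob_space emeasure_eq_measure intro!: integrable_mult_right integrable_real_indicator)
  finally show ?thesis .
qed

text \<open>Tightness of each coordinate suffices: allowing the mass d / 2^(r+1) outside the r-th
  interval leaves at most d outside the whole box, for all laws at once. On the box \<open>f\<close>
  is replaced by a trigonometric sum, and off the box both functions are bounded.\<close>

theorem weakly_converges_sequencesI:
  fixes \<mu> :: "nat \<Rightarrow> (nat \<Rightarrow> real) measure"
  assumes prob: "\<And>n. prob_space (\<mu> n)" "prob_space \<nu>"
    and sets [measurable_cong]: "\<And>n. sets (\<mu> n) = sets borel" "sets \<nu> = sets borel"
    and char: "\<And>k a. (\<lambda>n. \<integral>x. cis (\<Sum>r<k. a r * x r) \<partial>\<mu> n) \<longlonglongrightarrow> (\<integral>x. cis (\<Sum>r<k. a r * x r) \<partial>\<nu>)"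
    and tight: "\<And>r e. e > 0 \<Longrightarrow>
      \<exists>K>0. (\<forall>n. measure (\<mu> n) {x. \<bar>x r\<bar> > K} \<le> e) \<and> measure \<nu> {x. \<bar>x r\<bar> > K} \<le> e"
  shows "weakly_converges \<mu> \<nu>"
  unfolding weakly_converges_def
proof (intro allI impI)
  fix f :: "(nat \<Rightarrow> real) \<Rightarrow> real"
  assume f: "continuous_on UNIV f" "bounded (range f)"
  have [measurable]: "f \<in> borel_measurable borel"
    using f(1) by (rule borel_measurable_continuous_onI)
  obtain B where B: "\<And>x. \<bar>f x\<bar> \<le> B"
    using f(2) by (auto simp: bounded_iff)
  then have B0: "0 \<le> B" using abs_ge_zero order_trans by blast
  show "(\<lambda>n. integral\<^sup>L (\<mu> n) f) \<longlonglongrightarrow> integral\<^sup>L \<nu> f"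
  proof (rule LIMSEQ_I)
    fix e :: real assume "e > 0"
    \<comment> \<open>Replacing \<open>f\<close> by \<open>p\<close> costs d on the box and (B + (B
      + d)) * d off it. This choice keeps the total at most e / 3, hence strictly below e /
      2.\<close>
    define d where "d = min 1 (e / 3 / (2 + (2 * B + 1)))"
    have d: "d > 0" "d \<le> 1" "d + (B + (B + d)) * d < e / 2"
    proof -
      show "d > 0" "d \<le> 1" using \<open>e > 0\<close> B0 by (auto simp: d_def)
      have "d + (B + (B + d)) * d = (1 + (2 * B + d)) * d" by (simp add: algebra_simps)
      also have "\<dots> \<le> (2 + (2 * B + 1)) * (e / 3 / (2 + (2 * B + 1)))"
        using \<open>d > 0\<close> \<open>d \<le> 1\<close> B0 by (intro mult_mono) (auto simp: d_def)
      also have "\<dots> < e / 2" using B0 \<open>e > 0\<close> by (simp add: field_simps add_pos_nonneg)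
      finally show "d + (B + (B + d)) * d < e / 2" .
    qed
    have "\<forall>r. \<exists>K>0. (\<forall>n. measure (\<mu> n) {x. \<bar>x r\<bar> > K} \<le> d * (1/2) ^ Suc r) \<and> measure \<nu> {x. \<bar>x r\<bar> > K} \<le> d * (1/2) ^ Suc r"
      using d by (intro allI tight) auto
    then obtain K where K: "\<And>r. K r > 0" "\<And>n r. measure (\<mu> n) {x. \<bar>x r\<bar> > K r} \<le> d * (1/2) ^ Suc r"
       "\<And>r. measure \<nu> {x. \<bar>x r\<bar> > K r} \<le> d * (1/2) ^ Suc r"
      by metis
    define A where "A = (\<Union>r. {x :: nat \<Rightarrow> real. \<bar>x r\<bar> > K r})"
    have A: "measure M A \<le> d" if "prob_space M" and s [measurable_cong]: "sets M = sets borel"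
      and m: "\<And>r. measure M {x. \<bar>x r\<bar> > K r} \<le> d * (1/2) ^ Suc r" for M
    proof -
      interpret prob_space M by fact
      have sums: "(\<lambda>r. d * (1/2) ^ Suc r) sums d"
        using sums_mult[OF power_half_series, of d] by simp
      have meas: "{x. \<bar>x r\<bar> > K r} \<in> sets M" for r
        unfolding s by measurable
      have "summable (\<lambda>r. measure M {x. \<bar>x r\<bar> > K r})"
        using m by (intro summable_comparison_test'[OF sums_summable[OF sums], of 0]) auto
      then have "measure M A \<le> (\<Sum>r. measure M {x. \<bar>x r\<bar> > K r})"
        unfolding A_def using meas by (intro finite_measure_subadditive_countably) auto
      also have "\<dots> \<le> (\<Sum>r. d * (1/2) ^ Suc r)"
        using m by (intro suminf_le \<open>summable (\<lambda>r. measure M _)\<close> sums_summable[OF sums]) auto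
      also have "\<dots> = d" using sums by (simp add: sums_iff)
      finally show ?thesis .
    qed
    have A_meas: "A \<in> sets borel"
      unfolding A_def by measurable
    obtain p where p: "p \<in> trig_poly" "\<And>x. (\<forall>r. \<bar>x r\<bar> \<le> K r) \<Longrightarrow> \<bar>f x - p x\<bar> < d" "\<And>x. \<bar>p x\<bar> \<le> B + d"
      by (rule trig_poly_approximation[where K=K, OF f(1) B K(1) d(1)]; rule that; assumption)
    have [measurable]: "p \<in> borel_measurable borel"
      using p(1) trig_poly_continuous borel_measurable_continuous_onI by blast
    have close: "\<bar>integral\<^sup>L M f - integral\<^sup>L M p\<bar> < e / 2" if "prob_space M" and s [measurable_cong]: "sets M = sets borel"
      and m: "\<And>r. measure M {x. \<bar>x r\<bar> > K r} \<le> d * (1/2) ^ Suc r" for M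
    proof -
      have "\<bar>integral\<^sup>L M f - integral\<^sup>L M p\<bar> \<le> d + (B + (B + d)) * measure M A"
        using A_meas s p d B
        by (intro integral_diff_bound_off_set[OF that(1)]) (auto simp: A_def not_less intro!: less_imp_le)
      also have "\<dots> \<le> d + (B + (B + d)) * d"
        using A[OF that] d B0 by (intro add_mono mult_left_mono) auto
      finally show ?thesis using d by linarith
    qed
    have "(\<lambda>n. integral\<^sup>L (\<mu> n) p) \<longlonglongrightarrow> integral\<^sup>L \<nu> p"
      by (rule trig_poly_integral_tendsto[OF prob sets char p(1)])
    moreover have "\<bar>integral\<^sup>L \<nu> f - integral\<^sup>L \<nu> p\<bar> < e / 2" "\<And>n. \<bar>integral\<^sup>L (\<mu> n) f - integral\<^sup>L (\<mu> n) p\<bar> < e / 2"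
      using close prob sets K by auto
    \<comment> \<open>What remains of \<open>e\<close> after the replacement error under the limit
      law and the allowance e / 2 for the n-th law.\<close>
    define g where "g = e - \<bar>integral\<^sup>L \<nu> f - integral\<^sup>L \<nu> p\<bar> - e / 2"
    have "g > 0" using \<open>\<bar>integral\<^sup>L \<nu> f - integral\<^sup>L \<nu> p\<bar> < e / 2\<close> by (simp add: g_def)
    ultimately obtain N where N: "\<And>n. n \<ge> N \<Longrightarrow> \<bar>integral\<^sup>L (\<mu> n) p - integral\<^sup>L \<nu> p\<bar> < g"
      unfolding LIMSEQ_def dist_real_def by blast
    show "\<exists>N. \<forall>n\<ge>N. norm (integral\<^sup>L (\<mu> n) f - integral\<^sup>L \<nu> f) < e"
    proof (intro exI allI impI)
      fix n assume "n \<ge> N"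
      show "norm (integral\<^sup>L (\<mu> n) f - integral\<^sup>L \<nu> f) < e"
        using N[OF \<open>n \<ge> N\<close>] \<open>\<And>n. \<bar>integral\<^sup>L (\<mu> n) f - integral\<^sup>L (\<mu> n) p\<bar> < e / 2\<close>[of n]
        unfolding g_def real_norm_def by linarith
    qed
  qed
qed

text \<open>Closed sets form an intersection-stable generator, and the indicator of a nonempty
  closed set is the pointwise limit of the cut-off distance functions \<open>g k\<close>. This is
  how weak convergence of a constant sequence of laws becomes an equality of laws.\<close>

lemma measure_eqI_bounded_continuous:
  fixes \<mu> \<nu> :: "'a :: metric_space measure"
  assumes prob: "prob_space \<mu>" "prob_space \<nu>" and sets [measurable_cong]: "sets \<mu> = sets borel" "sets \<nu> = sets borel"
    and eq: "\<And>f :: 'a \<Rightarrow> real. continuous_on UNIV f \<Longrightarrow> bounded (range f) \<Longrightarrow> integral\<^sup>L \<mu> f = integral\<^sup>L \<nu> f"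
  shows "\<mu> = \<nu>"
proof -
  interpret m: prob_space \<mu> by fact
  interpret n: prob_space \<nu> by fact
  have closed: "emeasure \<mu> F = emeasure \<nu> F" if F: "closed F" for F
  proof (cases "F = {}")
    case False
    define g where "g k x = max 0 (1 - real k * infdist x F)" for k x
    have g: "continuous_on UNIV (g k)" for k
      unfolding g_def by (intro continuous_intros)
    have gb: "0 \<le> g k x" "g k x \<le> 1" for k x
      by (auto simp: g_def infdist_nonneg)
    then have bdd: "bounded (range (g k))" for k
      by (auto simp: bounded_iff intro!: exI[of _ 1])
    have [measurable]: "g k \<in> borel_measurable borel" for k
      using g by (rule borel_measurable_continuous_onI)
    have lim: "(\<lambda>k. g k x) \<longlonglongrightarrow> indicator F x" for x
    proof (cases "x \<in> F")
      case True then show ?thesis by (simp add: g_def)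
    next
      case nF: False
      then have pos: "infdist x F > 0"
        using False F by (metis in_closed_iff_infdist_zero infdist_nonneg less_eq_real_def)
      obtain N :: nat where N: "1 / infdist x F < real N" using reals_Archimedean2 by blast
      have "g k x = 0" if "k \<ge> N" for k
      proof -
        have "1 < real N * infdist x F" using N pos by (simp add: divide_less_eq mult.commute)
        also have "\<dots> \<le> real k * infdist x F" using that pos by (intro mult_right_mono) auto
        finally show ?thesis by (simp add: g_def)
      qed
      then have "(\<lambda>k. g k x) \<longlonglongrightarrow> 0"
        by (intro tendsto_eventually) (auto simp: eventually_sequentially)
      then show ?thesis using nF by simp
    qed
    have F': "F \<in> sets borel" using F by simp
    have "(\<lambda>k. integral\<^sup>L M (g k)) \<longlonglongrightarrow> measure M F" if "prob_space M" and s [measurable_cong]: "sets M = sets borel" for M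
    proof -
      interpret prob_space M by fact
      have sp: "space M = UNIV" using sets_eq_imp_space_eq[OF s] by simp
      have "(\<lambda>k. integral\<^sup>L M (g k)) \<longlonglongrightarrow> (\<integral>x. indicator F x \<partial>M)"
        by (rule integral_dominated_convergence[where w="\<lambda>_. 1"]) (use lim gb F' in auto)
      then show ?thesis using sp by simp
    qed
    from this[OF prob(1) sets(1)] this[OF prob(2) sets(2)] have "measure \<mu> F = measure \<nu> F"
      using eq[OF g bdd] LIMSEQ_unique by auto
    then show ?thesis by (simp add: m.emeasure_eq_measure n.emeasure_eq_measure)
  qed simp
  show ?thesis
  proof (rule measure_eqI_generator_eq[where E="Collect closed" and A="\<lambda>_. UNIV" and \<Omega>=UNIV])
    show "sets \<mu> = sigma_sets UNIV (Collect closed)" "sets \<nu> = sigma_sets UNIV (Collect closed)"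
      by (simp_all add: sets borel_eq_closed)
  qed (auto simp: Int_stable_def closed)
qed

lemma (in prob_space) measure_abs_gt_le_second_moment:
  fixes f :: "'a \<Rightarrow> real"
  assumes "integrable M (\<lambda>x. (f x)\<^sup>2)" and [measurable]: "f \<in> borel_measurable M" and "(\<integral>x. (f x)\<^sup>2 \<partial>M) \<le> C" "K > 0"
  shows "prob {x \<in> space M. \<bar>f x\<bar> > K} \<le> C / K\<^sup>2"
proof -
  have "prob {x \<in> space M. \<bar>f x\<bar> > K} \<le> prob {x \<in> space M. (f x)\<^sup>2 \<ge> K\<^sup>2}"
    using \<open>K > 0\<close> by (intro finite_measure_mono) (auto intro: abs_le_square_iff[THEN iffD1])
  also have "\<dots> \<le> (\<integral>x. (f x)\<^sup>2 \<partial>M) / K\<^sup>2"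
    using assms by (intro integral_Markov_inequality_measure[where A="{}"]) auto
  also have "\<dots> \<le> C / K\<^sup>2"
    using assms by (intro divide_right_mono) auto
  finally show ?thesis .
qed

corollary weakly_converges_sequences_second_momentI:
  fixes \<mu> :: "nat \<Rightarrow> (nat \<Rightarrow> real) measure"
  assumes prob: "\<And>n. prob_space (\<mu> n)" "prob_space \<nu>"
    and sets [measurable_cong]: "\<And>n. sets (\<mu> n) = sets borel" "sets \<nu> = sets borel"
    and char: "\<And>k a. (\<lambda>n. \<integral>x. cis (\<Sum>r<k. a r * x r) \<partial>\<mu> n) \<longlonglongrightarrow> (\<integral>x. cis (\<Sum>r<k. a r * x r) \<partial>\<nu>)"
    and "\<And>n r. integrable (\<mu> n) (\<lambda>x. (x r)\<^sup>2)" "\<And>n r. (\<integral>x. (x r)\<^sup>2 \<partial>\<mu> n) \<le> C"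
    and "\<And>r. integrable \<nu> (\<lambda>x. (x r)\<^sup>2)" "\<And>r. (\<integral>x. (x r)\<^sup>2 \<partial>\<nu>) \<le> C"
  shows "weakly_converges \<mu> \<nu>"
proof (rule weakly_converges_sequencesI[OF prob sets char])
  fix r and e :: real assume "e > 0"
  \<comment> \<open>Nothing prevents \<open>C\<close> from being 0, while a positive constant is
    needed for K > 0. With this K, Chebyshev's bound D / K^2 equals e.\<close>
  define D where "D = \<bar>C\<bar> + 1"
  define K where "K = sqrt (D / e)"
  have "D > 0" "C \<le> D" by (auto simp: D_def)
  then have K: "K > 0" "D / K\<^sup>2 = e" using \<open>e > 0\<close> by (auto simp: K_def)
  have "measure M {x. \<bar>x r\<bar> > K} \<le> e" if "prob_space M" and s [measurable_cong]: "sets M = sets borel"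
    and m: "integrable M (\<lambda>x. (x r)\<^sup>2)" "(\<integral>x. (x r)\<^sup>2 \<partial>M) \<le> C" for M :: "(nat \<Rightarrow> real) measure"
  proof -
    interpret prob_space M by fact
    have "space M = UNIV" using sets_eq_imp_space_eq[OF s] by simp
    then show ?thesis
      using measure_abs_gt_le_second_moment[OF m(1) _ order_trans[OF m(2) \<open>C \<le> D\<close>] K(1)] K(2) by simp
  qed
  then show "\<exists>K>0. (\<forall>n. measure (\<mu> n) {x. \<bar>x r\<bar> > K} \<le> e) \<and> measure \<nu> {x. \<bar>x r\<bar> > K} \<le> e"
    using K(1) assms by blast
qed

section \<open>Almost sure convergence of nonnegative martingales\<close>

text \<open>The multipliers \<open>h\<close> replace conditioning on \<open>F n\<close>.\<close>

locale bounded_submartingale = prob_space M for M :: "'a measure" +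
  fixes F :: "nat \<Rightarrow> 'a measure" and Y :: "nat \<Rightarrow> 'a \<Rightarrow> real"
  assumes subalg: "\<And>n. subalgebra M (F n)" and mono: "\<And>m n. m \<le> n \<Longrightarrow> sets (F m) \<subseteq> sets (F n)"
    and adapted: "\<And>n. Y n \<in> borel_measurable (F n)" and Y_bounds: "\<And>n x. 0 \<le> Y n x" "\<And>n x. Y n x \<le> 1"
    and submart: "\<And>n h. h \<in> borel_measurable (F n) \<Longrightarrow> (\<And>x. 0 \<le> h x) \<Longrightarrow> (\<And>x. h x \<le> 1) \<Longrightarrow>
       (\<integral>x. h x * Y n x \<partial>M) \<le> (\<integral>x. h x * Y (Suc n) x \<partial>M)"
begin

lemma space_F [simp]: "space (F n) = space M"
  using subalg[of n] by (simp add: subalgebra_def)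

lemma F_le: "m \<le> n \<Longrightarrow> f \<in> borel_measurable (F m) \<Longrightarrow> f \<in> borel_measurable (F n)"
  by (rule measurable_from_subalg[of "F n" "F m"]) (simp_all add: subalgebra_def mono)

lemma F_M: "f \<in> borel_measurable (F n) \<Longrightarrow> f \<in> borel_measurable M"
  by (rule measurable_from_subalg[OF subalg])

lemma Y_measurable [measurable]: "Y n \<in> borel_measurable M"
  by (rule F_M[OF adapted])

lemma integrable_bounded: "f \<in> borel_measurable M \<Longrightarrow> (\<And>x. \<bar>f x\<bar> \<le> B) \<Longrightarrow> integrable M f" for f :: "'a \<Rightarrow> real"
  by (rule integrable_const_bound[where B=B]) auto

lemma submart_le:
  assumes "n \<le> k" "h \<in> borel_measurable (F n)" "\<And>x. 0 \<le> h x" "\<And>x. h x \<le> 1"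
  shows "(\<integral>x. h x * Y n x \<partial>M) \<le> (\<integral>x. h x * Y k x \<partial>M)"
  using assms(1)
proof (induction k rule: dec_induct)
  case (step k)
  then show ?case using submart[OF F_le[OF _ assms(2)], of k] assms(3,4) by force
qed simp

lemma abs_mult_le_1: "\<bar>a\<bar> \<le> 1 \<Longrightarrow> \<bar>b\<bar> \<le> 1 \<Longrightarrow> \<bar>a * b\<bar> \<le> 1" for a b :: real
  by (simp add: abs_mult mult_le_one)

lemma Y_diff_bound: "\<bar>Y k x - Y m x\<bar> \<le> 1"
  using Y_bounds[of k x] Y_bounds[of m x] by linarith

lemma integrable_ind_diff: "A \<in> sets M \<Longrightarrow> integrable M (\<lambda>x. indicator A x * (Y k x - Y m x))"
  by (rule integrable_bounded[where B=1]) (auto intro!: abs_mult_le_1 Y_diff_bound simp: indicator_def)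

lemma integrable_Y_sq: "integrable M (\<lambda>x. (Y j x)\<^sup>2)"
  using Y_bounds by (intro integrable_bounded[where B=1]) (auto simp: power_le_one)

lemma increment_ind:
  assumes "m \<le> k" "A \<in> sets (F k)"
  shows "(\<integral>x. indicator A x * (Y k x - Y m x) \<partial>M) \<le> (\<integral>x. indicator A x * (Y (Suc k) x - Y m x) \<partial>M)"
proof -
  have A: "A \<in> sets M" using assms(2) subalg by (auto simp: subalgebra_def)
  have "integrable M (\<lambda>x. indicator A x * Y j x)" for j
    using A Y_bounds by (intro integrable_bounded[where B=1]) (auto simp: indicator_def)
  then show ?thesis
    using submart[of "indicator A" k] assms(2) by (simp add: right_diff_distrib indicator_def)
qed

section \<open>Maximal inequalities for bounded submartingales\<close>

definition hit :: "(real \<Rightarrow> bool) \<Rightarrow> nat \<Rightarrow> nat \<Rightarrow> 'a set"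
  where "hit Q m k = {x \<in> space M. \<exists>j\<in>{m..k}. Q (Y j x - Y m x)}"

lemma hit_measurable:
  assumes "m \<le> k" "Measurable.pred borel Q"
  shows "hit Q m k \<in> sets (F k)"
proof -
  have "{x \<in> space M. Q (Y j x - Y m x)} \<in> sets (F k)" if "j \<in> {m..k}" for j
  proof -
    have [measurable]: "Y j \<in> borel_measurable (F k)" "Y m \<in> borel_measurable (F k)"
      using F_le[OF _ adapted] that assms(1) by auto
    note assms(2)[measurable]
    have "{x \<in> space (F k). Q (Y j x - Y m x)} \<in> sets (F k)" by measurable
    then show ?thesis by simp
  qed
  moreover have "hit Q m k = (\<Union>j\<in>{m..k}. {x \<in> space M. Q (Y j x - Y m x)})"
    by (auto simp: hit_def)
  ultimately show ?thesis by auto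
qed

lemma hit_measurable_M: "m \<le> k \<Longrightarrow> Measurable.pred borel Q \<Longrightarrow> hit Q m k \<in> sets M"
  using hit_measurable[of m k Q] subalg[of k] by (auto simp: subalgebra_def)

text \<open>Doob's inequality by induction on the horizon instead of a stopping time: on the event
  already hit the submartingale property can only raise the integral, and on the newly hit event the
  last increment is at least \<open>l\<close>.\<close>

lemma upper_maximal:
  assumes "m \<le> k" "l > 0"
  shows "l * prob (hit (\<lambda>y. y \<ge> l) m k) \<le> (\<integral>x. indicator (hit (\<lambda>y. y \<ge> l) m k) x * (Y k x - Y m x) \<partial>M)"
  using assms(1)
proof (induction k rule: dec_induct)
  case base
  have "hit (\<lambda>y. y \<ge> l) m m = {}" using assms(2) by (auto simp: hit_def)
  then show ?case by simp
next
  case (step k)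
  let ?H = "hit (\<lambda>y. y \<ge> l) m"
  let ?C = "?H (Suc k) - ?H k"
  have [measurable]: "?H k \<in> sets M" "?H (Suc k) \<in> sets M" using step by (auto intro!: hit_measurable_M)
  have sub: "?H k \<subseteq> ?H (Suc k)" by (auto simp: hit_def)
  have C: "Y (Suc k) x - Y m x \<ge> l" if "x \<in> ?C" for x
  proof -
    from that obtain j where j: "j \<in> {m..Suc k}" "Y j x - Y m x \<ge> l" "x \<in> space M" by (auto simp: hit_def)
    moreover have "j \<notin> {m..k}" using that j by (auto simp: hit_def)
    ultimately have "j = Suc k" by auto
    then show ?thesis using j by simp
  qed
  have "l * prob (?H (Suc k)) = l * prob (?H k) + (\<integral>x. l * indicator ?C x \<partial>M)"
    using sub by (simp add: finite_measure_Diff algebra_simps)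
  also have "\<dots> \<le> (\<integral>x. indicator (?H k) x * (Y (Suc k) x - Y m x) \<partial>M) + (\<integral>x. indicator ?C x * (Y (Suc k) x - Y m x) \<partial>M)"
  proof (rule add_mono)
    show "l * prob (?H k) \<le> (\<integral>x. indicator (?H k) x * (Y (Suc k) x - Y m x) \<partial>M)"
      by (rule order_trans[OF step.IH increment_ind[OF step.hyps(1) hit_measurable[OF step.hyps(1)]]]) simp
    show "(\<integral>x. l * indicator ?C x \<partial>M) \<le> (\<integral>x. indicator ?C x * (Y (Suc k) x - Y m x) \<partial>M)"
    proof (intro integral_mono integrable_ind_diff)
      show "l * indicator ?C x \<le> indicator ?C x * (Y (Suc k) x - Y m x)" for x
        using C[of x] by (auto simp: indicator_def)
      show "integrable M (\<lambda>x. l * indicator ?C x)"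
        by (intro integrable_mult_right integrable_real_indicator) (auto simp: emeasure_eq_measure)
    qed auto
  qed
  also have "\<dots> = (\<integral>x. indicator (?H k) x * (Y (Suc k) x - Y m x) + indicator ?C x * (Y (Suc k) x - Y m x) \<partial>M)"
    by (intro Bochner_Integration.integral_add[symmetric] integrable_ind_diff) auto
  also have "\<dots> = (\<integral>x. indicator (?H (Suc k)) x * (Y (Suc k) x - Y m x) \<partial>M)"
    using sub by (intro Bochner_Integration.integral_cong) (auto simp: indicator_def)
  finally show ?case .
qed

text \<open>Here the integral runs over the event not yet hit. Extending the horizon first raises
  the integral; then the newly hit event leaves the domain and takes with it an integral of at most
  - l times its probability.\<close>

lemma lower_maximal:
  assumes "m \<le> k" "l > 0"
  shows "l * prob (hit (\<lambda>y. y \<le> - l) m k) \<le> (\<integral>x. indicator (space M - hit (\<lambda>y. y \<le> - l) m k) x * (Y k x - Y m x) \<partial>M)"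
  using assms(1)
proof (induction k rule: dec_induct)
  case base
  have "hit (\<lambda>y. y \<le> - l) m m = {}" using assms(2) by (auto simp: hit_def)
  then show ?case by simp
next
  case (step k)
  let ?H = "hit (\<lambda>y. y \<le> - l) m"
  let ?C = "?H (Suc k) - ?H k"
  have HF: "?H k \<in> sets (F k)" using step by (auto intro!: hit_measurable)
  have [measurable]: "?H k \<in> sets M" "?H (Suc k) \<in> sets M" using step by (auto intro!: hit_measurable_M)
  have sub: "?H k \<subseteq> ?H (Suc k)" "?H (Suc k) \<subseteq> space M" by (auto simp: hit_def)
  have C: "Y (Suc k) x - Y m x \<le> - l" if "x \<in> ?C" for x
  proof -
    from that obtain j where j: "j \<in> {m..Suc k}" "Y j x - Y m x \<le> - l" "x \<in> space M" by (auto simp: hit_def)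
    moreover have "j \<notin> {m..k}" using that j by (auto simp: hit_def)
    ultimately have "j = Suc k" by auto
    then show ?thesis using j by simp
  qed
  have "space (F k) - ?H k \<in> sets (F k)" using HF by (rule sets.compl_sets)
  then have RF: "space M - ?H k \<in> sets (F k)" by simp
  have "l * prob (?H k) \<le> (\<integral>x. indicator (space M - ?H k) x * (Y (Suc k) x - Y m x) \<partial>M)"
    by (rule order_trans[OF step.IH increment_ind[OF step.hyps(1) RF]])
  also have "\<dots> = (\<integral>x. indicator (space M - ?H (Suc k)) x * (Y (Suc k) x - Y m x) + indicator ?C x * (Y (Suc k) x - Y m x) \<partial>M)"
    using sub by (intro Bochner_Integration.integral_cong) (auto simp: indicator_def)
  also have "\<dots> = (\<integral>x. indicator (space M - ?H (Suc k)) x * (Y (Suc k) x - Y m x) \<partial>M) + (\<integral>x. indicator ?C x * (Y (Suc k) x - Y m x) \<partial>M)"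
    by (intro Bochner_Integration.integral_add integrable_ind_diff) auto
  also have "(\<integral>x. indicator ?C x * (Y (Suc k) x - Y m x) \<partial>M) \<le> (\<integral>x. - l * indicator ?C x \<partial>M)"
  proof (intro integral_mono integrable_ind_diff)
    show "indicator ?C x * (Y (Suc k) x - Y m x) \<le> - l * indicator ?C x" if "x \<in> space M" for x
      using C[of x] by (auto simp: indicator_def)
    show "integrable M (\<lambda>x. - l * indicator ?C x)"
      by (intro integrable_mult_right integrable_real_indicator) (auto simp: emeasure_eq_measure)
  qed auto
  also have "\<dots> = - l * prob ?C"
    by simp
  also have "prob ?C = prob (?H (Suc k)) - prob (?H k)"
    using sub by (intro finite_measure_Diff) auto
  finally show ?case by (simp add: algebra_simps)
qed

text \<open>Both one-sided bounds are at most E |Y_k - Y_m|, hence at most the L2 norm. Since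
  \<open>Y m\<close> takes values in [0,1], it is itself an admissible multiplier; this gives E Y_m
  Y_k \<ge> E Y_m^2, which leaves the difference of the second moments.\<close>

lemma maximal_inequality:
  assumes "m \<le> k" "l > 0"
  shows "l * prob (hit (\<lambda>y. \<bar>y\<bar> \<ge> l) m k) \<le> 2 * sqrt ((\<integral>x. (Y k x)\<^sup>2 \<partial>M) - (\<integral>x. (Y m x)\<^sup>2 \<partial>M))"
proof -
  let ?U = "hit (\<lambda>y. y \<ge> l) m k" and ?L = "hit (\<lambda>y. y \<le> - l) m k"
  have [measurable]: "?U \<in> sets M" "?L \<in> sets M" using assms by (auto intro!: hit_measurable_M)
  have "hit (\<lambda>y. \<bar>y\<bar> \<ge> l) m k \<subseteq> ?U \<union> ?L" by (force simp: hit_def abs_real_def split: if_splits)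
  then have "prob (hit (\<lambda>y. \<bar>y\<bar> \<ge> l) m k) \<le> prob ?U + prob ?L"
    by (intro order_trans[OF finite_measure_mono measure_Un_le]) auto
  then have 1: "l * prob (hit (\<lambda>y. \<bar>y\<bar> \<ge> l) m k) \<le> l * prob ?U + l * prob ?L"
    using assms(2) by (simp flip: distrib_left)
  have int: "integrable M (\<lambda>x. \<bar>Y k x - Y m x\<bar>)"
    using Y_diff_bound by (intro integrable_bounded[where B=1]) auto
  have le: "(\<integral>x. indicator A x * (Y k x - Y m x) \<partial>M) \<le> (\<integral>x. \<bar>Y k x - Y m x\<bar> \<partial>M)" if "A \<in> sets M" for A
    using that by (intro integral_mono integrable_ind_diff int) (auto simp: indicator_def)
  have 2: "l * prob (hit (\<lambda>y. \<bar>y\<bar> \<ge> l) m k) \<le> 2 * (\<integral>x. \<bar>Y k x - Y m x\<bar> \<partial>M)"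
    using 1 upper_maximal[OF assms] lower_maximal[OF assms] le[of ?U] le[of "space M - ?L"] by simp
  have imul: "integrable M (\<lambda>x. Y m x * Y k x)"
    using Y_bounds by (intro integrable_bounded[where B=1] abs_mult_le_1) auto
  have idsq: "integrable M (\<lambda>x. (Y k x - Y m x)\<^sup>2)"
    using Y_diff_bound by (intro integrable_bounded[where B=1]) (auto simp: abs_square_le_1)
  have "(\<integral>x. \<bar>Y k x - Y m x\<bar> \<partial>M)\<^sup>2 \<le> (\<integral>x. \<bar>Y k x - Y m x\<bar>\<^sup>2 \<partial>M)"
    using variance_positive[of "\<lambda>x. \<bar>Y k x - Y m x\<bar>"] int idsq by (subst (asm) variance_eq) auto
  also have "\<dots> = (\<integral>x. (Y k x)\<^sup>2 + (Y m x)\<^sup>2 - 2 * (Y m x * Y k x) \<partial>M)"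
    by (simp add: power2_diff mult_ac)
  also have "\<dots> = (\<integral>x. (Y k x)\<^sup>2 \<partial>M) + (\<integral>x. (Y m x)\<^sup>2 \<partial>M) - 2 * (\<integral>x. Y m x * Y k x \<partial>M)"
    using integrable_Y_sq imul by simp
  also have "\<dots> \<le> (\<integral>x. (Y k x)\<^sup>2 \<partial>M) - (\<integral>x. (Y m x)\<^sup>2 \<partial>M)"
    using submart_le[OF assms(1) adapted[of m] Y_bounds(1) Y_bounds(2)] by (simp add: power2_eq_square)
  finally have "(\<integral>x. \<bar>Y k x - Y m x\<bar> \<partial>M) \<le> sqrt ((\<integral>x. (Y k x)\<^sup>2 \<partial>M) - (\<integral>x. (Y m x)\<^sup>2 \<partial>M))"
    by (rule real_le_rsqrt)
  with 2 show ?thesis by simp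
qed

lemma second_moment_mono: "m \<le> k \<Longrightarrow> (\<integral>x. (Y m x)\<^sup>2 \<partial>M) \<le> (\<integral>x. (Y k x)\<^sup>2 \<partial>M)"
  using order_trans[OF measure_nonneg maximal_inequality[of m k 1, simplified]] by simp

text \<open>No upcrossings are needed. The second moments increase and are bounded by 1, so the
  right-hand side of the maximal inequality tends to 0 uniformly in the horizon; almost surely the
  path then oscillates arbitrarily little from some time on.\<close>

theorem AE_convergent: "AE x in M. convergent (\<lambda>n. Y n x)"
proof -
  define a where "a m = (\<integral>x. (Y m x)\<^sup>2 \<partial>M)" for m
  have "a m \<le> 1" for m
    unfolding a_def by (rule integral_le_const[OF integrable_Y_sq]) (simp add: power_le_one Y_bounds)
  then obtain L where L: "a \<longlonglongrightarrow> L" "\<And>m. a m \<le> L"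
    using incseq_convergent[of a 1] second_moment_mono by (auto simp: incseq_def a_def)
  define B where "B l m = {x \<in> space M. \<exists>j\<ge>m. \<bar>Y j x - Y m x\<bar> \<ge> l}" for l m
  have [measurable]: "B l m \<in> sets M" for l m unfolding B_def by measurable
  have B: "l * prob (B l m) \<le> 2 * sqrt (L - a m)" if "l > 0" for l m
  proof -
    have "(\<lambda>k. prob (hit (\<lambda>y. \<bar>y\<bar> \<ge> l) m (m + k))) \<longlonglongrightarrow> prob (\<Union>k. hit (\<lambda>y. \<bar>y\<bar> \<ge> l) m (m + k))"
      by (intro finite_Lim_measure_incseq image_subsetI hit_measurable_M) (auto simp: incseq_def hit_def)
    moreover have "(\<Union>k. hit (\<lambda>y. \<bar>y\<bar> \<ge> l) m (m + k)) = B l m"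
    proof (intro set_eqI iffI)
      fix x assume "x \<in> B l m"
      then obtain j where j: "x \<in> space M" "j \<ge> m" "\<bar>Y j x - Y m x\<bar> \<ge> l" by (auto simp: B_def)
      then have "x \<in> hit (\<lambda>y. \<bar>y\<bar> \<ge> l) m (m + (j - m))" by (auto simp: hit_def)
      then show "x \<in> (\<Union>k. hit (\<lambda>y. \<bar>y\<bar> \<ge> l) m (m + k))" by blast
    qed (auto simp: hit_def B_def)
    ultimately have lim: "(\<lambda>k. l * prob (hit (\<lambda>y. \<bar>y\<bar> \<ge> l) m (m + k))) \<longlonglongrightarrow> l * prob (B l m)"
      by (intro tendsto_intros) simp
    have "l * prob (hit (\<lambda>y. \<bar>y\<bar> \<ge> l) m (m + k)) \<le> 2 * sqrt (L - a m)" for k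
    proof -
      have "l * prob (hit (\<lambda>y. \<bar>y\<bar> \<ge> l) m (m + k)) \<le> 2 * sqrt (a (m + k) - a m)"
        unfolding a_def using that by (intro maximal_inequality) auto
      also have "\<dots> \<le> 2 * sqrt (L - a m)"
        using L(2)[of "m + k"] by simp
      finally show ?thesis .
    qed
    then show ?thesis using lim by (intro LIMSEQ_le_const2[OF lim]) auto
  qed
  have "AE x in M. \<exists>m. x \<notin> B l m" if "l > 0" for l
  proof -
    have "(\<lambda>m. 2 * sqrt (L - a m) / l) \<longlonglongrightarrow> 2 * sqrt (L - L) / l"
      by (intro tendsto_intros L) (use that in auto)
    then have lim0: "(\<lambda>m. 2 * sqrt (L - a m) / l) \<longlonglongrightarrow> 0" by simp
    have "prob (\<Inter>m. B l m) \<le> 2 * sqrt (L - a m) / l" for m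
    proof -
      have "prob (\<Inter>m. B l m) \<le> prob (B l m)" by (intro finite_measure_mono) auto
      also have "\<dots> \<le> 2 * sqrt (L - a m) / l" using B[OF that, of m] that by (simp add: field_simps)
      finally show ?thesis .
    qed
    then have "prob (\<Inter>m. B l m) \<le> 0" by (intro LIMSEQ_le_const[OF lim0]) auto
    then have "(\<Inter>m. B l m) \<in> null_sets M"
      by (intro null_setsI) (auto simp: emeasure_eq_measure measure_le_0_iff)
    then show ?thesis by (auto intro!: AE_I'[of "\<Inter>m. B l m"])
  qed
  then have "AE x in M. \<forall>i. \<exists>m. x \<notin> B (1 / real (Suc i)) m"
    by (subst AE_all_countable) auto
  with AE_space show ?thesis
  proof eventually_elim
    case (elim x)
    have "Cauchy (\<lambda>n. Y n x)"
    proof (rule metric_CauchyI)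
      fix e :: real assume "e > 0"
      then obtain i where i: "1 / real (Suc i) < e / 2"
        using nat_approx_posE[of "e / 2"] by auto
      obtain m where "x \<notin> B (1 / real (Suc i)) m" using elim by blast
      then have "\<bar>Y j x - Y m x\<bar> < e / 2" if "j \<ge> m" for j
        using that i elim by (force simp: B_def)
      then have "\<bar>Y j x - Y k x\<bar> < e" if "j \<ge> m" "k \<ge> m" for j k
        using that by (smt (verit, best) field_sum_of_halves)
      then show "\<exists>m. \<forall>j\<ge>m. \<forall>k\<ge>m. dist (Y j x) (Y k x) < e"
        by (auto simp: dist_real_def)
    qed
    then show ?case by (rule Cauchy_convergent)
  qed
qed

end

text \<open>By Jensen's inequality \<open>exp (- W n)\<close> is a bounded submartingale, and by Fatou's lemma its limit
  vanishes only on a null set.\<close>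

theorem nonneg_martingale_AE_convergent:
  fixes W :: "nat \<Rightarrow> 'a \<Rightarrow> real"
  assumes "prob_space M" and subalg: "\<And>n. subalgebra M (F n)" and mono: "\<And>m n. m \<le> n \<Longrightarrow> sets (F m) \<subseteq> sets (F n)"
    and adapted: "\<And>n. W n \<in> borel_measurable (F n)" and nonneg: "\<And>n x. 0 \<le> W n x"
    and int: "\<And>n. integrable M (W n)"
    and mart: "\<And>n h. h \<in> borel_measurable (F n) \<Longrightarrow> (\<And>x. 0 \<le> h x) \<Longrightarrow> (\<And>x. h x \<le> 1) \<Longrightarrow>
       (\<integral>x. h x * W (Suc n) x \<partial>M) = (\<integral>x. h x * W n x \<partial>M)"
  shows "AE x in M. convergent (\<lambda>n. W n x)"
proof -
  interpret prob_space M by fact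
  have WM [measurable]: "W n \<in> borel_measurable M" for n using int by auto
  have hint: "integrable M (\<lambda>x. h x * W n x)" if "h \<in> borel_measurable M" "\<And>x. 0 \<le> h x" "\<And>x. h x \<le> 1" for h n
    using that nonneg by (intro Bochner_Integration.integrable_bound[OF int[of n]]) (auto simp: abs_mult mult_left_le_one_le)
  have bint: "integrable M f" if "f \<in> borel_measurable M" "\<And>x. 0 \<le> f x" "\<And>x. f x \<le> 1" for f :: "'a \<Rightarrow> real"
    using that by (intro integrable_const_bound[where B=1]) auto
  have "bounded_submartingale M F (\<lambda>n x. exp (- W n x))"
  proof
    show "subalgebra M (F n)" "(\<lambda>x. exp (- W n x)) \<in> borel_measurable (F n)" for n
      using subalg adapted[of n] by auto
    show "sets (F m) \<subseteq> sets (F n)" if "m \<le> n" for m n by (rule mono[OF that])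
    show "0 \<le> exp (- W n x)" "exp (- W n x) \<le> 1" for n x using nonneg by auto
    fix n h assume h: "h \<in> borel_measurable (F n)" "\<And>x. 0 \<le> h x" "\<And>x. h x \<le> (1::real)"
    have hM [measurable]: "h \<in> borel_measurable M" by (rule measurable_from_subalg[OF subalg h(1)])
    \<comment> \<open>Jensen's inequality without conditioning: the tangent to exp at - W n,
      multiplied by \<open>h\<close>, has \<open>g\<close> as its slope. Since \<open>g\<close> is
      measurable for \<open>F n\<close> and lies in [0,1], the martingale property applies to it and
      removes the linear term.\<close>
    define g where "g x = h x * exp (- W n x)" for x
    have gF: "g \<in> borel_measurable (F n)" unfolding g_def using h(1) adapted[of n] by measurable
    have g: "0 \<le> g x" "g x \<le> 1" for x unfolding g_def using h(2,3)[of x] nonneg[of n x] by (auto intro!: mult_le_one)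
    have gM [measurable]: "g \<in> borel_measurable M" by (rule measurable_from_subalg[OF subalg gF])
    have "(\<integral>x. h x * exp (- W n x) \<partial>M) = (\<integral>x. g x \<partial>M) - ((\<integral>x. g x * W (Suc n) x \<partial>M) - (\<integral>x. g x * W n x \<partial>M))"
      using mart[OF gF g] by (simp add: g_def)
    also have "\<dots> = (\<integral>x. g x - (g x * W (Suc n) x - g x * W n x) \<partial>M)"
      using hint[OF gM g] bint[OF gM g] by simp
    also have "\<dots> \<le> (\<integral>x. h x * exp (- W (Suc n) x) \<partial>M)"
    proof (intro integral_mono)
      fix x
      have "exp (- W n x) * (1 + (W n x - W (Suc n) x)) \<le> exp (- W n x) * exp (W n x - W (Suc n) x)"
        using exp_ge_add_one_self by (intro mult_left_mono) auto
      also have "\<dots> = exp (- W (Suc n) x)" by (simp add: exp_add[symmetric])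
      finally have "h x * (exp (- W n x) * (1 + (W n x - W (Suc n) x))) \<le> h x * exp (- W (Suc n) x)"
        using h(2) by (intro mult_left_mono) auto
      then show "g x - (g x * W (Suc n) x - g x * W n x) \<le> h x * exp (- W (Suc n) x)"
        by (simp add: g_def algebra_simps)
    next
      show "integrable M (\<lambda>x. g x - (g x * W (Suc n) x - g x * W n x))"
        using hint[OF gM g] bint[OF gM g] by simp
      show "integrable M (\<lambda>x. h x * exp (- W (Suc n) x))"
        using h(2,3) nonneg by (intro bint) (auto intro!: mult_le_one)
    qed
    finally show "(\<integral>x. h x * exp (- W n x) \<partial>M) \<le> (\<integral>x. h x * exp (- W (Suc n) x) \<partial>M)" .
  qed
  then interpret bounded_submartingale M F "\<lambda>n x. exp (- W n x)" .
  have "(\<integral>x. W n x \<partial>M) = (\<integral>x. W 0 x \<partial>M)" for n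
  proof (induction n)
    case (Suc n)
    then show ?case using mart[of "\<lambda>_. 1" n] by simp
  qed simp
  then have nn: "(\<integral>\<^sup>+x. ennreal (W n x) \<partial>M) = ennreal (\<integral>x. W 0 x \<partial>M)" for n
    using nn_integral_eq_integral[OF int] nonneg by simp
  have "(\<integral>\<^sup>+x. liminf (\<lambda>n. ennreal (W n x)) \<partial>M) \<le> liminf (\<lambda>n. \<integral>\<^sup>+x. ennreal (W n x) \<partial>M)"
    by (rule nn_integral_liminf) auto
  also have "\<dots> = ennreal (\<integral>x. W 0 x \<partial>M)" by (simp add: nn Liminf_const)
  finally have "(\<integral>\<^sup>+x. liminf (\<lambda>n. ennreal (W n x)) \<partial>M) \<noteq> \<infinity>" by (auto simp: top_unique)
  then have "AE x in M. liminf (\<lambda>n. ennreal (W n x)) \<noteq> \<infinity>"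
    by (intro nn_integral_PInf_AE) auto
  with AE_convergent show ?thesis
  proof eventually_elim
    case (elim x)
    then obtain y where y: "(\<lambda>n. exp (- W n x)) \<longlonglongrightarrow> y" by (auto simp: convergent_def)
    then have "y \<ge> 0" by (rule LIMSEQ_le_const) auto
    have "y \<noteq> 0"
    proof
      assume "y = 0"
      have "(\<lambda>n. ennreal (W n x)) \<longlonglongrightarrow> \<top>"
        unfolding tendsto_top_iff_ennreal
      proof (intro allI impI)
        fix l :: real assume "0 \<le> l"
        have "eventually (\<lambda>n. exp (- W n x) < exp (- l)) sequentially"
          using y \<open>y = 0\<close> by (intro order_tendstoD) auto
        then show "eventually (\<lambda>n. ennreal l < ennreal (W n x)) sequentially"
          by eventually_elim (use \<open>0 \<le> l\<close> in \<open>auto simp: ennreal_less_iff\<close>)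
      qed
      then have "liminf (\<lambda>n. ennreal (W n x)) = \<top>"
        by (intro lim_imp_Liminf) auto
      then show False using elim by simp
    qed
    with \<open>y \<ge> 0\<close> have "y > 0" by simp
    then have "(\<lambda>n. - ln (exp (- W n x))) \<longlonglongrightarrow> - ln y"
      by (intro tendsto_intros y) auto
    then show ?case by (auto simp: convergent_def)
  qed
qed

section \<open>Convolution powers leave compact sets\<close>

lemma char_convolution:
  assumes "real_distribution \<mu>" "real_distribution \<nu>"
  shows "char (\<mu> \<star> \<nu>) t = char \<mu> t * char \<nu> t"
proof -
  interpret m: real_distribution \<mu> by fact
  interpret n: real_distribution \<nu> by fact
  interpret pair_prob_space \<mu> \<nu> ..
  have [measurable_cong]: "sets \<mu> = sets borel" "sets \<nu> = sets borel" by simp_all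
  have "char (\<mu> \<star> \<nu>) t = (\<integral>z. iexp (t * (fst z + snd z)) \<partial>(\<mu> \<Otimes>\<^sub>M \<nu>))"
    unfolding char_def convolution_def by (subst integral_distr) (auto simp: case_prod_beta)
  also have "\<dots> = (\<integral>x. \<integral>y. iexp (t * (x + y)) \<partial>\<nu> \<partial>\<mu>)"
    by (subst integral_fst'[symmetric]) (auto intro!: P.integrable_const_bound[where B=1] simp: case_prod_beta)
  also have "\<dots> = (\<integral>x. iexp (t * x) * char \<nu> t \<partial>\<mu>)"
    by (simp add: char_def distrib_left exp_add)
  finally show ?thesis by (simp add: char_def)
qed

lemma real_distribution_convolution:
  assumes "real_distribution \<mu>" "real_distribution \<nu>"
  shows "real_distribution (\<mu> \<star> \<nu>)"
proof -
  interpret m: real_distribution \<mu> by fact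
  interpret n: real_distribution \<nu> by fact
  interpret pair_prob_space \<mu> \<nu> ..
  have [measurable_cong]: "sets \<mu> = sets borel" "sets \<nu> = sets borel" by simp_all
  show ?thesis
    unfolding convolution_def by (intro P.real_distribution_distr) simp
qed

primrec conv_power :: "real measure \<Rightarrow> nat \<Rightarrow> real measure" where
  "conv_power \<nu> 0 = return borel 0"
| "conv_power \<nu> (Suc n) = (\<nu> \<star> conv_power \<nu> n)"

lemma real_distribution_conv_power:
  assumes "real_distribution \<nu>"
  shows "real_distribution (conv_power \<nu> n)"
proof (induction n)
  case 0
  show ?case by (auto intro!: real_distribution.intro real_distribution_axioms.intro prob_space_return)
qed (simp add: real_distribution_convolution assms)

lemma char_conv_power:
  assumes "real_distribution \<nu>"
  shows "char (conv_power \<nu> n) t = char \<nu> t ^ n"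
  by (induction n)
     (simp_all add: char_def[of "return borel 0"] integral_return char_convolution assms real_distribution_conv_power)

text \<open>Equality case of the triangle inequality: with c = \<open>char \<nu> t\<close>, the
  nonnegative variable 1 - Re (cnj c * iexp (t * x)) has integral 0, and a number of modulus 1 with
  real part 1 is 1.\<close>

lemma AE_iexp_eq_char:
  assumes "real_distribution \<nu>" "norm (char \<nu> t) = 1"
  shows "AE x in \<nu>. iexp (t * x) = char \<nu> t"
proof -
  interpret real_distribution \<nu> by fact
  define c where "c = char \<nu> t"
  have cc: "c * cnj c = 1" using assms(2) by (simp add: c_def complex_norm_square[symmetric])
  have int: "integrable \<nu> (\<lambda>x. iexp (t * x))"
    by (rule integrable_const_bound[where B=1]) auto
  have int2: "integrable \<nu> (\<lambda>x. 1 - Re (cnj c * iexp (t * x)))"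
    using int by (intro Bochner_Integration.integrable_diff integrable_Re integrable_mult_right) auto
  have le: "Re (cnj c * iexp (t * x)) \<le> 1" for x
    using complex_Re_le_cmod[of "cnj c * iexp (t * x)"] assms(2) by (simp add: norm_mult c_def)
  have "(\<integral>x. 1 - Re (cnj c * iexp (t * x)) \<partial>\<nu>) = 1 - Re (cnj c * (\<integral>x. iexp (t * x) \<partial>\<nu>))"
  proof -
    have "integrable \<nu> (\<lambda>x. cnj c * iexp (t * x))" using int by (rule integrable_mult_right)
    note Re_eq = integral_Re[OF this] and Re_int = integrable_Re[OF this]
    have "(\<integral>x. (1::real) \<partial>\<nu>) = 1" using prob_space by simp
    then have "(\<integral>x. 1 - Re (cnj c * iexp (t * x)) \<partial>\<nu>) = 1 - Re (\<integral>x. cnj c * iexp (t * x) \<partial>\<nu>)"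
      using Bochner_Integration.integral_diff[OF integrable_const[of 1] Re_int] unfolding Re_eq by argo
    then show ?thesis unfolding integral_mult_right_zero .
  qed
  also have "(\<integral>x. iexp (t * x) \<partial>\<nu>) = c" by (simp only: c_def char_def)
  also have "1 - Re (cnj c * c) = 0" using cc by (simp only: mult.commute[of "cnj c"]) simp
  finally have "AE x in \<nu>. 1 - Re (cnj c * iexp (t * x)) = 0"
    using integral_nonneg_eq_0_iff_AE[OF int2] le by simp
  then show ?thesis
  proof eventually_elim
    case (elim x)
    let ?z = "cnj c * iexp (t * x)"
    have "norm ?z = 1" using assms(2) by (simp add: norm_mult c_def)
    then have "(Re ?z)\<^sup>2 + (Im ?z)\<^sup>2 = 1" by (metis cmod_power2 one_power2)
    then have "?z = 1" using elim by (simp add: complex_eq_iff)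
    then have "c * ?z = c" by simp
    then have "(c * cnj c) * iexp (t * x) = c" by (simp only: mult.assoc)
    then show ?case unfolding cc by (simp only: mult_1 c_def)
  qed
qed

lemma std_normal_null_countable: "countable A \<Longrightarrow> AE t in std_normal_distribution. t \<notin> A"
proof -
  assume A: "countable A"
  then have "AE t in lborel. t \<notin> A"
    by (intro AE_not_in) (auto simp: null_sets_def emeasure_lborel_countable intro: sets.countable)
  then show ?thesis
    by (subst AE_density) auto
qed

lemma countable_iexp_eq_1:
  assumes "d \<noteq> 0"
  shows "countable {t. iexp (t * d) = 1}"
proof -
  have "{t. iexp (t * d) = 1} \<subseteq> range (\<lambda>k :: int. 2 * of_int k * pi / d)"
    using assms by (auto simp: exp_eq_1 field_simps image_iff)
  then show ?thesis by (rule countable_subset) auto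
qed

text \<open>If \<open>norm (char \<nu> t) = 1\<close>, then \<open>t * (x - y)\<close> is a multiple of \<open>2 * pi\<close> for almost all pairs \<open>(x, y)\<close>;
  for fixed \<open>x \<noteq> y\<close> this holds for countably many \<open>t\<close> only.\<close>

lemma AE_norm_char_less_1:
  assumes "real_distribution \<nu>" and nd: "\<And>a. \<not> (AE x in \<nu>. x = a)"
  shows "AE t in std_normal_distribution. norm (char \<nu> t) < 1"
proof (rule ccontr)
  assume contra: "\<not> ?thesis"
  interpret real_distribution \<nu> by fact
  let ?N = "std_normal_distribution"
  interpret N: real_distribution ?N by (rule real_dist_normal_dist)
  interpret p: pair_prob_space \<nu> \<nu> ..
  interpret q: pair_sigma_finite ?N "\<nu> \<Otimes>\<^sub>M \<nu>" ..
  have [measurable_cong]: "sets \<nu> = sets borel" by simp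
  have [measurable]: "char \<nu> \<in> borel_measurable borel" by (rule char_measurable)
  have "AE p in \<nu> \<Otimes>\<^sub>M \<nu>. norm (char \<nu> t) = 1 \<longrightarrow> iexp (t * (fst p - snd p)) = 1" for t
  proof (cases "norm (char \<nu> t) = 1")
    case True
    have ae: "AE x in \<nu>. iexp (t * x) = char \<nu> t" by (rule AE_iexp_eq_char[OF assms(1) True])
    have ne: "char \<nu> t \<noteq> 0" using True by auto
    have "AE x in \<nu>. AE y in \<nu>. iexp (t * (x - y)) = 1"
      using ae
    proof eventually_elim
      case (elim x)
      show ?case using ae
      proof eventually_elim
        case (elim y)
        have "iexp (t * (x - y)) = iexp (t * x) / iexp (t * y)"
          by (simp add: exp_diff[symmetric] right_diff_distrib)
        then show ?case using elim \<open>iexp (t * x) = char \<nu> t\<close> ne by simp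
      qed
    qed
    then have "AE p in \<nu> \<Otimes>\<^sub>M \<nu>. iexp (t * (fst p - snd p)) = 1"
      by (intro p.AE_pair_measure; (measurable | simp only: fst_conv snd_conv))
    then show ?thesis by auto
  qed auto
  then have "AE t in ?N. AE p in \<nu> \<Otimes>\<^sub>M \<nu>. norm (char \<nu> t) = 1 \<longrightarrow> iexp (t * (fst p - snd p)) = 1"
    by simp
  then have "AE p in \<nu> \<Otimes>\<^sub>M \<nu>. AE t in ?N. norm (char \<nu> t) = 1 \<longrightarrow> iexp (t * (fst p - snd p)) = 1"
    by (subst (asm) q.AE_commute; (measurable | assumption))
  \<comment> \<open>A pair with distinct entries would make \<open>norm (char \<nu> t) < 1\<close>
    for almost every \<open>t\<close>, which \<open>contra\<close> denies. So almost every pair lies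
    on the diagonal, which makes \<nu> a point mass.\<close>
  then have "AE p in \<nu> \<Otimes>\<^sub>M \<nu>. fst p = snd p"
  proof eventually_elim
    case (elim p)
    show ?case
    proof (rule ccontr)
      assume "fst p \<noteq> snd p"
      then have "AE t in ?N. t \<notin> {t. iexp (t * (fst p - snd p)) = 1}"
        by (intro std_normal_null_countable countable_iexp_eq_1) auto
      with elim have "AE t in ?N. norm (char \<nu> t) < 1"
      proof eventually_elim
        case (elim t)
        then show ?case using cmod_char_le_1[of t] by auto
      qed
      with contra show False by simp
    qed
  qed
  then have "AE x in \<nu>. AE y in \<nu>. x = y"
    using p.AE_pair[of "\<lambda>p. fst p = snd p"] by simp
  then obtain x where "AE y in \<nu>. x = y"
    using eventually_happens'[OF ae_filter_bot] by blast
  then have "AE y in \<nu>. y = x" by auto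
  with nd show False by blast
qed

lemma AE_conv_power_point_mass:
  assumes "real_distribution \<nu>" "AE x in \<nu>. x = a"
  shows "AE x in conv_power \<nu> n. x = real n * a"
proof (induction n)
  case 0
  show ?case unfolding conv_power.simps by (subst AE_return) auto
next
  case (Suc n)
  interpret real_distribution \<nu> by fact
  interpret m: real_distribution "conv_power \<nu> n" using assms(1) by (rule real_distribution_conv_power)
  interpret pair_prob_space \<nu> "conv_power \<nu> n" ..
  have [measurable_cong]: "sets \<nu> = sets borel" "sets (conv_power \<nu> n) = sets borel" by simp_all
  have "AE x in \<nu>. AE y in conv_power \<nu> n. x + y = real (Suc n) * a"
    using assms(2)
  proof eventually_elim
    case (elim x)
    show ?case using Suc by eventually_elim (simp add: elim algebra_simps)
  qed
  then have "AE p in \<nu> \<Otimes>\<^sub>M conv_power \<nu> n. fst p + snd p = real (Suc n) * a"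
    by (intro AE_pair_measure; (measurable | simp only: fst_conv snd_conv))
  then show ?case
    unfolding conv_power.simps convolution_def by (subst AE_distr_iff) (auto simp: case_prod_beta)
qed

text \<open>Testing against a Gaussian turns the mass of a compact set into an average of \<open>char \<nu> ^ n\<close>.\<close>

theorem conv_power_compact_tendsto_0:
  assumes "real_distribution \<nu>" and nz: "\<not> (AE x in \<nu>. x = 0)"
  shows "(\<lambda>n. measure (conv_power \<nu> n) {- K..K}) \<longlonglongrightarrow> 0"
proof (cases "\<exists>a. AE x in \<nu>. x = a")
  case True
  \<comment> \<open>For a point mass the characteristic function has modulus 1 everywhere, so its
    powers do not decay; the walk is then deterministic and leaves the interval because a \<noteq>
    0.\<close>
  then obtain a where a: "AE x in \<nu>. x = a" by blast
  with nz have "a \<noteq> 0" by auto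
  obtain N :: nat where N: "\<bar>K\<bar> / \<bar>a\<bar> < real N" using reals_Archimedean2 by blast
  have "measure (conv_power \<nu> n) {- K..K} = 0" if "n \<ge> N" for n
  proof -
    interpret m: real_distribution "conv_power \<nu> n" using assms(1) by (rule real_distribution_conv_power)
    have "\<bar>K\<bar> < real N * \<bar>a\<bar>" using N \<open>a \<noteq> 0\<close> by (simp add: field_simps)
    also have "\<dots> \<le> \<bar>real n * a\<bar>" using that by (simp add: abs_mult mult_right_mono)
    finally have "real n * a \<notin> {- K..K}" by auto
    then have "AE x in conv_power \<nu> n. x \<notin> {- K..K}"
      using AE_conv_power_point_mass[OF assms(1) a, of n] by auto
    then show ?thesis
      by (subst m.prob_eq_0) auto
  qed
  then show ?thesis by (intro tendsto_eventually) (auto simp: eventually_sequentially)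
next
  case False
  interpret real_distribution \<nu> by fact
  let ?N = "std_normal_distribution"
  interpret N: real_distribution ?N by (rule real_dist_normal_dist)
  define I where "I n = (\<integral>t. char \<nu> t ^ n \<partial>?N)" for n
  have [measurable]: "char \<nu> \<in> borel_measurable borel" by (rule char_measurable)
  have "I \<longlonglongrightarrow> (\<integral>t. 0 \<partial>?N)"
    unfolding I_def
  proof (rule integral_dominated_convergence[where w="\<lambda>_. 1"])
    show "AE t in ?N. (\<lambda>n. char \<nu> t ^ n) \<longlonglongrightarrow> 0"
      using AE_norm_char_less_1[OF assms(1)] False by (auto elim!: eventually_mono intro: LIMSEQ_power_zero)
    show "AE t in ?N. norm (char \<nu> t ^ n) \<le> 1" for n
      using cmod_char_le_1 by (auto simp: norm_power intro!: power_le_one)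
  qed auto
  then have I: "(\<lambda>n. exp (K\<^sup>2 / 2) * norm (I n)) \<longlonglongrightarrow> 0"
    by (auto intro!: tendsto_mult_right_zero tendsto_norm_zero)
  have "measure (conv_power \<nu> n) {- K..K} \<le> exp (K\<^sup>2 / 2) * norm (I n)" for n
  proof -
    interpret m: real_distribution "conv_power \<nu> n" using assms(1) by (rule real_distribution_conv_power)
    interpret pair_prob_space "conv_power \<nu> n" ?N ..
    have [measurable_cong]: "sets (conv_power \<nu> n) = sets borel" by simp
    have int: "integrable (conv_power \<nu> n) (\<lambda>x. exp (- (x\<^sup>2) / 2))"
      by (rule m.integrable_const_bound[where B=1]) auto
    \<comment> \<open>The Gaussian function is the characteristic function of the standard normal
      law, so Fubini's theorem turns its integral against the n-th power into an integral of
      \<open>char \<nu> t ^ n\<close>.\<close>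
    have "complex_of_real (\<integral>x. exp (- (x\<^sup>2) / 2) \<partial>conv_power \<nu> n) = (\<integral>x. char ?N x \<partial>conv_power \<nu> n)"
      by (simp add: char_std_normal_distribution)
    also have "\<dots> = (\<integral>x. \<integral>t. iexp (x * t) \<partial>?N \<partial>conv_power \<nu> n)"
      by (simp add: char_def)
    also have "\<dots> = (\<integral>t. \<integral>x. iexp (x * t) \<partial>conv_power \<nu> n \<partial>?N)"
      by (rule Fubini_integral[symmetric]) (auto intro!: P.integrable_const_bound[where B=1] simp: case_prod_beta)
    also have "\<dots> = I n"
      unfolding I_def char_conv_power[OF assms(1), symmetric] by (simp add: char_def mult.commute)
    finally have *: "(\<integral>x. exp (- (x\<^sup>2) / 2) \<partial>conv_power \<nu> n) \<le> norm (I n)"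
      by (metis abs_ge_self norm_of_real)
    have "measure (conv_power \<nu> n) {- K..K} = (\<integral>x. indicator {- K..K} x \<partial>conv_power \<nu> n)"
      by simp
    also have "\<dots> \<le> (\<integral>x. exp (K\<^sup>2 / 2) * exp (- (x\<^sup>2) / 2) \<partial>conv_power \<nu> n)"
    proof (intro integral_mono integrable_mult_right int)
      \<comment> \<open>On [-K, K] the Gaussian function is at least exp (- K^2 / 2), which is the
        origin of the factor exp (K^2 / 2).\<close>
      fix x show "indicator {- K..K} x \<le> exp (K\<^sup>2 / 2) * exp (- (x\<^sup>2) / 2)"
      proof (cases "x \<in> {- K..K}")
        case True
        then have "x\<^sup>2 \<le> K\<^sup>2" by (intro abs_le_square_iff[THEN iffD1]) auto
        then show ?thesis using True by (simp add: exp_add[symmetric])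
      qed auto
    qed (auto intro!: integrable_real_indicator simp: m.emeasure_eq_measure)
    also have "\<dots> \<le> exp (K\<^sup>2 / 2) * norm (I n)"
      using * by simp
    finally show ?thesis .
  qed
  then show ?thesis
    by (intro tendsto_sandwich[OF _ _ tendsto_const I]) auto
qed

section \<open>Random trees with independent marks\<close>

lemma borel_measurable_nn_integral_count_space:
  assumes "countable A" and f: "\<And>u. u \<in> A \<Longrightarrow> f u \<in> borel_measurable M"
  shows "(\<lambda>t. \<integral>\<^sup>+u. f u t \<partial>count_space A) \<in> borel_measurable M"
proof -
  interpret sigma_finite_measure "count_space A" by (rule sigma_finite_measure_count_space_countable[OF assms(1)])
  have "(\<lambda>(u, t). f u t) \<in> borel_measurable (count_space A \<Otimes>\<^sub>M M)"
    by (rule measurable_pair_measure_countable1[OF assms(1)]) (use f in auto)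
  then have "(\<lambda>(t, u). f u t) \<in> borel_measurable (M \<Otimes>\<^sub>M count_space A)"
    by (subst measurable_pair_swap_iff) (simp add: case_prod_beta)
  then show ?thesis by (rule borel_measurable_nn_integral)
qed

lemma nn_integral_count_space_swap:
  assumes "countable A" "\<And>u. u \<in> A \<Longrightarrow> f u \<in> borel_measurable M"
  shows "(\<integral>\<^sup>+t. \<integral>\<^sup>+u. f u t \<partial>count_space A \<partial>M) = (\<integral>\<^sup>+u. \<integral>\<^sup>+t. f u t \<partial>M \<partial>count_space A)"
  using nn_integral_count_space_nn_integral[OF assms] by simp

abbreviation words :: "nat \<Rightarrow> nat list set" where
  "words n \<equiv> {u. length u = n}"

text \<open>A finite exhaustion of the words of length n. Individuals may have infinitely many
  children, so sums over a generation are reached as limits over N.\<close>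

definition words_below :: "nat \<Rightarrow> nat \<Rightarrow> nat list set" where
  "words_below N n = {u. set u \<subseteq> {..<N} \<and> length u = n}"

lemma finite_words_below [simp]: "finite (words_below N n)"
  unfolding words_below_def by (rule finite_lists_length_eq) simp

lemma words_below_subset: "words_below N n \<subseteq> words n"
  by (auto simp: words_below_def)

lemma words_below_mono: "N \<le> N' \<Longrightarrow> words_below N n \<subseteq> words_below N' n"
  by (auto simp: words_below_def)

lemma UN_words_below: "(\<Union>N. words_below N n) = words n"
proof -
  have "\<exists>N. set u \<subseteq> {..<N}" for u :: "nat list"
    using finite_nat_set_iff_bounded by (metis List.finite_set lessThan_iff subsetI)
  then show ?thesis by (auto simp: words_below_def)
qed

lemma sum_words_below_tendsto:
  fixes f :: "nat list \<Rightarrow> ennreal"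
  shows "(\<lambda>N. \<Sum>u\<in>words_below N n. f u) \<longlonglongrightarrow> (\<integral>\<^sup>+u. f u \<partial>count_space (words n))"
proof -
  have eq: "(\<Sum>u\<in>words_below N n. f u) = (\<integral>\<^sup>+u. f u * indicator (words_below N n) u \<partial>count_space (words n))" for N
    by (subst nn_integral_count_space'[of "words_below N n"]) (auto simp: words_below_def[of N n] intro!: finite_lists_length_eq)
  have mono: "incseq (\<lambda>N u. f u * indicator (words_below N n) u)"
    using words_below_mono by (auto simp: incseq_def le_fun_def indicator_def)
  have "(SUP N. f u * indicator (words_below N n) u) = f u" if u: "u \<in> words n" for u
  proof (rule antisym)
    show "(SUP N. f u * indicator (words_below N n) u) \<le> f u"
      by (intro SUP_least) (auto simp: indicator_def)
    obtain N where "u \<in> words_below N n" using u UN_words_below[of n] by blast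
    then show "f u \<le> (SUP N. f u * indicator (words_below N n) u)"
      by (intro SUP_upper2[of N]) auto
  qed
  then have "(\<integral>\<^sup>+u. f u \<partial>count_space (words n)) = (\<integral>\<^sup>+u. (SUP N. f u * indicator (words_below N n) u) \<partial>count_space (words n))"
    by (intro nn_integral_cong) auto
  also have "\<dots> = (SUP N. (\<Sum>u\<in>words_below N n. f u))"
    unfolding eq by (rule nn_integral_monotone_convergence_SUP[OF mono]) simp
  finally show ?thesis
    using LIMSEQ_SUP[of "\<lambda>N. \<Sum>u\<in>words_below N n. f u"] words_below_mono
    by (simp add: incseq_def sum_mono2)
qed

lemma nn_integral_words_append:
  fixes f :: "nat list \<Rightarrow> nat list \<Rightarrow> ennreal"
  shows "(\<integral>\<^sup>+w. f (take n w) (drop n w) \<partial>count_space (words (n + r))) =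
    (\<integral>\<^sup>+u. \<integral>\<^sup>+v. f u v \<partial>count_space (words r) \<partial>count_space (words n))"
proof -
  interpret sigma_finite_measure "count_space (words r)"
    by (rule sigma_finite_measure_count_space_countable) auto
  have b: "bij_betw (\<lambda>(u, v). u @ v) (words n \<times> words r) (words (n + r))"
    by (rule bij_betw_byWitness[where f'="\<lambda>w. (take n w, drop n w)"]) auto
  have "(\<integral>\<^sup>+w. f (take n w) (drop n w) \<partial>count_space (words (n + r))) =
     (\<integral>\<^sup>+p. f (take n (fst p @ snd p)) (drop n (fst p @ snd p)) \<partial>count_space (words n \<times> words r))"
    using nn_integral_bij_count_space[OF b, of "\<lambda>w. f (take n w) (drop n w)"] by (simp add: case_prod_beta)
  also have "\<dots> = (\<integral>\<^sup>+p. f (fst p) (snd p) \<partial>count_space (words n \<times> words r))"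
    by (intro nn_integral_cong) auto
  also have "count_space (words n \<times> words r) = count_space (words n) \<Otimes>\<^sub>M count_space (words r)"
    by (rule pair_measure_countable[symmetric]) auto
  also have "(\<integral>\<^sup>+p. f (fst p) (snd p) \<partial>(count_space (words n) \<Otimes>\<^sub>M count_space (words r))) =
     (\<integral>\<^sup>+u. \<integral>\<^sup>+v. f u v \<partial>count_space (words r) \<partial>count_space (words n))"
    by (subst nn_integral_fst[symmetric]) (auto simp: pair_measure_countable)
  finally show ?thesis .
qed

section \<open>Marked trees, weights and the branching property\<close>

type_synonym tree = "nat list \<Rightarrow> enat \<times> (nat \<Rightarrow> real)"

abbreviation tree_space :: "tree measure" where
  "tree_space \<equiv> (\<Pi>\<^sub>M u\<in>UNIV. mark_space)"

lemma space_mark_space [simp]: "space mark_space = UNIV"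
  by (simp add: mark_space_def space_pair_measure)

lemma space_tree_space [simp]: "space tree_space = UNIV"
  by (simp add: space_PiM)

text \<open>The value 0 for an absent child makes the weight of every word outside the tree vanish,
  so sums over a generation can run over all words of that length.\<close>

definition factor :: "enat \<times> (nat \<Rightarrow> real) \<Rightarrow> nat \<Rightarrow> real" where
  "factor m i = (if enat i < fst m then exp (- snd m i) else 0)"

definition weight :: "nat list \<Rightarrow> tree \<Rightarrow> real" where
  "weight u t = (\<Prod>k<length u. factor (t (take k u)) (u ! k))"

definition subtree :: "nat list \<Rightarrow> tree \<Rightarrow> tree" where
  "subtree u t = (\<lambda>v. t (u @ v))"

text \<open>The marks in the subtree at \<open>u\<close> are overwritten by a dummy, so a function of the tree does not
  depend on that subtree if and only if it is invariant under \<open>prune u\<close>.\<close>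

definition prune :: "nat list \<Rightarrow> tree \<Rightarrow> tree" where
  "prune u t = (\<lambda>v. if take (length u) v = u then (0, \<lambda>_. 0) else t v)"

text \<open>The marks of words shorter than n are those that decide generations 0 to n. Invariance
  under \<open>cut n\<close> plays the part of measurability with respect to the n-th
  \<sigma>-algebra of the filtration.\<close>

definition cut :: "nat \<Rightarrow> tree \<Rightarrow> tree" where
  "cut n t = (\<lambda>v. if length v < n then t v else (0, \<lambda>_. 0))"

text \<open>The unnormalized Biggins sum at parameter \<open>p\<close>; only the parameters 1 and 2
  are needed, hence a natural exponent. The value is extended because the sum may be infinite on a
  null set.\<close>

definition mass :: "nat \<Rightarrow> nat \<Rightarrow> tree \<Rightarrow> ennreal" where
  "mass p n t = (\<integral>\<^sup>+u. ennreal (weight u t ^ p) \<partial>count_space (words n))"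

lemma factor_nonneg: "0 \<le> factor m i"
  by (simp add: factor_def)

lemma weight_nonneg [simp]: "0 \<le> weight u t"
  by (simp add: weight_def prod_nonneg factor_nonneg)

lemma weight_Nil [simp]: "weight [] t = 1"
  by (simp add: weight_def)

lemma weight_append: "weight (u @ v) t = weight u t * weight v (subtree u t)"
proof -
  have "weight (u @ v) t = (\<Prod>k\<in>{0..<length u}. factor (t (take k (u @ v))) ((u @ v) ! k)) *
      (\<Prod>k\<in>{length u..<length u + length v}. factor (t (take k (u @ v))) ((u @ v) ! k))"
    unfolding weight_def by (subst prod.atLeastLessThan_concat) (auto simp: lessThan_atLeast0)
  also have "(\<Prod>k\<in>{0..<length u}. factor (t (take k (u @ v))) ((u @ v) ! k)) = weight u t"
    unfolding weight_def by (intro prod.cong) (auto simp: nth_append)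
  also have "(\<Prod>k\<in>{length u..<length u + length v}. factor (t (take k (u @ v))) ((u @ v) ! k)) =
      weight v (subtree u t)"
    unfolding weight_def subtree_def
    using prod.shift_bounds_nat_ivl[of "\<lambda>k. factor (t (take k (u @ v))) ((u @ v) ! k)" 0 "length u" "length v"]
    by (simp add: add.commute lessThan_atLeast0 nth_append)
  finally show ?thesis .
qed

lemma weight_cong: "(\<And>v. length v < length u \<Longrightarrow> take (length v) u = v \<Longrightarrow> t v = t' v) \<Longrightarrow> weight u t = weight u t'"
  unfolding weight_def by (intro prod.cong refl arg_cong2[where f=factor]) (auto simp: min_def)

lemma weight_cut: "length u \<le> n \<Longrightarrow> weight u (cut n t) = weight u t"
  by (rule weight_cong) (simp add: cut_def)

lemma weight_prune: "length u \<le> length v \<Longrightarrow> weight u (prune v t) = weight u t"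
  by (rule weight_cong) (auto simp: prune_def)

lemma cut_prune: "cut (length u) (prune u t) = cut (length u) t"
  by (auto simp: cut_def prune_def fun_eq_iff)

lemma subtree_prune: "length u = length v \<Longrightarrow> u \<noteq> v \<Longrightarrow> subtree u (prune v t) = subtree u t"
  by (auto simp: subtree_def prune_def fun_eq_iff)

lemma measurable_tree_coordinate [measurable]: "(\<lambda>t. t v) \<in> measurable tree_space mark_space"
  by (rule measurable_component_singleton) simp

lemma measurable_factor [measurable]: "(\<lambda>m. factor m i) \<in> borel_measurable mark_space"
  unfolding factor_def mark_space_def by measurable

lemma measurable_weight [measurable]: "weight u \<in> borel_measurable tree_space"
  unfolding weight_def by measurable

lemma measurable_subtree [measurable]: "subtree u \<in> measurable tree_space tree_space"
  by (rule measurable_PiM_single') (auto simp: subtree_def)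

lemma measurable_prune [measurable]: "prune u \<in> measurable tree_space tree_space"
  by (rule measurable_PiM_single') (auto simp: prune_def)

lemma measurable_cut [measurable]: "cut n \<in> measurable tree_space tree_space"
  by (rule measurable_PiM_single') (auto simp: cut_def)

lemma measurable_mass [measurable]: "mass p n \<in> borel_measurable tree_space"
  unfolding mass_def by (rule borel_measurable_nn_integral_count_space) auto

lemma mass_0 [simp]: "mass p 0 t = 1"
proof -
  have "words 0 = {[]}" by auto
  then show ?thesis by (simp add: mass_def nn_integral_count_space_finite)
qed

lemma mass_add: "mass p (n + r) t = (\<integral>\<^sup>+u. ennreal (weight u t ^ p) * mass p r (subtree u t) \<partial>count_space (words n))"
proof -
  have "mass p (n + r) t = (\<integral>\<^sup>+w. ennreal (weight (take n w @ drop n w) t ^ p) \<partial>count_space (words (n + r)))"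
    unfolding mass_def by simp
  also have "\<dots> = (\<integral>\<^sup>+u. \<integral>\<^sup>+v. ennreal (weight (u @ v) t ^ p) \<partial>count_space (words r) \<partial>count_space (words n))"
    by (rule nn_integral_words_append)
  also have "\<dots> = (\<integral>\<^sup>+u. ennreal (weight u t ^ p) * mass p r (subtree u t) \<partial>count_space (words n))"
    by (simp add: weight_append power_mult_distrib ennreal_mult mass_def nn_integral_cmult)
  finally show ?thesis .
qed

lemma mass_cut: "mass p n (cut n t) = mass p n t"
  unfolding mass_def by (intro nn_integral_cong) (simp add: weight_cut)

text \<open>\<open>subtree_split\<close> is the branching property: the subtree at \<open>u\<close>
  has the law of the whole tree and is independent of all marks outside it. The arguments on trees
  use the independence of the marks only in this form.\<close>

locale random_tree = prob_space P for P :: "tree measure" +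
  assumes sets_P [simp, measurable_cong]: "sets P = sets tree_space"
    and subtree_split: "\<And>u. distr P (tree_space \<Otimes>\<^sub>M tree_space) (\<lambda>t. (prune u t, subtree u t)) =
      distr P tree_space (prune u) \<Otimes>\<^sub>M P"
begin

lemma space_P [simp]: "space P = UNIV"
  using sets_eq_imp_space_eq[OF sets_P] by simp

lemma measurable_P: "measurable P = measurable tree_space"
  by (intro ext measurable_cong_sets) auto

text \<open>Conditioning on everything outside the subtree at \<open>u\<close>, written as Fubini's
  theorem: invariance of \<open>F\<close> under \<open>prune u\<close> says that its first argument
  ignores that subtree, which can then be replaced by an independent copy.\<close>

lemma nn_integral_subtree:
  assumes [measurable]: "case_prod F \<in> borel_measurable (tree_space \<Otimes>\<^sub>M tree_space)"
    and F: "\<And>t s. F (prune u t) s = F t s"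
  shows "(\<integral>\<^sup>+t. F t (subtree u t) \<partial>P) = (\<integral>\<^sup>+t. \<integral>\<^sup>+s. F t s \<partial>P \<partial>P)"
proof -
  have F': "F (prune u t) = F t" for t by (rule ext) (rule F)
  have "(\<integral>\<^sup>+t. F t (subtree u t) \<partial>P) = (\<integral>\<^sup>+t. case_prod F (prune u t, subtree u t) \<partial>P)"
    by (simp add: F)
  also have "\<dots> = (\<integral>\<^sup>+q. case_prod F q \<partial>distr P (tree_space \<Otimes>\<^sub>M tree_space) (\<lambda>t. (prune u t, subtree u t)))"
    by (subst nn_integral_distr) auto
  also have "\<dots> = (\<integral>\<^sup>+t. \<integral>\<^sup>+s. F t s \<partial>P \<partial>distr P tree_space (prune u))"
    unfolding subtree_split by (subst nn_integral_fst[symmetric]) auto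
  also have "\<dots> = (\<integral>\<^sup>+t. \<integral>\<^sup>+s. F t s \<partial>P \<partial>P)"
    by (subst nn_integral_distr) (auto simp: F')
  finally show ?thesis .
qed

lemma integral_subtree:
  fixes F :: "tree \<Rightarrow> tree \<Rightarrow> complex"
  assumes [measurable]: "case_prod F \<in> borel_measurable (tree_space \<Otimes>\<^sub>M tree_space)"
    and F: "\<And>t s. F (prune u t) s = F t s" and bound: "\<And>t s. norm (F t s) \<le> B"
  shows "(\<integral>t. F t (subtree u t) \<partial>P) = (\<integral>t. \<integral>s. F t s \<partial>P \<partial>P)"
proof -
  have F': "F (prune u t) = F t" for t by (rule ext) (rule F)
  interpret R: prob_space "distr P tree_space (prune u)" by (rule prob_space_distr) simp
  interpret Q: pair_prob_space "distr P tree_space (prune u)" P ..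
  have "(\<integral>t. F t (subtree u t) \<partial>P) = (\<integral>t. case_prod F (prune u t, subtree u t) \<partial>P)"
    by (simp add: F)
  also have "\<dots> = (\<integral>q. case_prod F q \<partial>distr P (tree_space \<Otimes>\<^sub>M tree_space) (\<lambda>t. (prune u t, subtree u t)))"
    by (subst integral_distr) auto
  also have "\<dots> = (\<integral>t. \<integral>s. F t s \<partial>P \<partial>distr P tree_space (prune u))"
    unfolding subtree_split
    by (subst Q.integral_fst'[symmetric]) (auto intro!: Q.P.integrable_const_bound[where B=B] simp: bound)
  also have "\<dots> = (\<integral>t. \<integral>s. F t s \<partial>P \<partial>P)"
    by (subst integral_distr) (auto simp: F')
  finally show ?thesis .
qed

lemma distr_subtree: "distr P tree_space (subtree u) = P"
proof (rule measure_eqI)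
  fix A assume "A \<in> sets (distr P tree_space (subtree u))"
  then have [measurable]: "A \<in> sets tree_space" by simp
  have "emeasure (distr P tree_space (subtree u)) A = (\<integral>\<^sup>+t. indicator A t \<partial>distr P tree_space (subtree u))"
    by simp
  also have "\<dots> = (\<integral>\<^sup>+t. indicator A (subtree u t) \<partial>P)"
    by (rule nn_integral_distr) auto
  also have "\<dots> = (\<integral>\<^sup>+t. \<integral>\<^sup>+s. indicator A s \<partial>P \<partial>P)"
    by (rule nn_integral_subtree) auto
  finally show "emeasure (distr P tree_space (subtree u)) A = emeasure P A"
    by (simp add: emeasure_space_1[simplified])
qed simp

lemma AE_subtree:
  assumes "AE t in P. Q t"
  shows "AE t in P. Q (subtree u t)"
proof (rule AE_distrD[where M'=tree_space])
  show "AE t in distr P tree_space (subtree u). Q t"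
    unfolding distr_subtree by (rule assms)
qed simp

text \<open>The martingale property tested against a multiplier \<open>H\<close> that the first n
  generations decide. Pruning at a word of length n does not affect such an \<open>H\<close>, so
  each subtree can be integrated out separately.\<close>

lemma nn_integral_mass_add:
  assumes [measurable]: "H \<in> borel_measurable tree_space" and H: "\<And>t. H (cut n t) = H t"
  shows "(\<integral>\<^sup>+t. H t * mass p (n + r) t \<partial>P) = (\<integral>\<^sup>+t. H t * mass p n t \<partial>P) * (\<integral>\<^sup>+t. mass p r t \<partial>P)"
proof -
  have "(\<integral>\<^sup>+t. H t * mass p (n + r) t \<partial>P) =
    (\<integral>\<^sup>+t. \<integral>\<^sup>+u. H t * (ennreal (weight u t ^ p) * mass p r (subtree u t)) \<partial>count_space (words n) \<partial>P)"
    unfolding mass_add by (simp add: nn_integral_cmult)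
  also have "\<dots> = (\<integral>\<^sup>+u. \<integral>\<^sup>+t. H t * (ennreal (weight u t ^ p) * mass p r (subtree u t)) \<partial>P \<partial>count_space (words n))"
    by (rule nn_integral_count_space_swap) auto
  also have "\<dots> = (\<integral>\<^sup>+u. (\<integral>\<^sup>+t. H t * ennreal (weight u t ^ p) \<partial>P) * (\<integral>\<^sup>+t. mass p r t \<partial>P) \<partial>count_space (words n))"
  proof (rule nn_integral_cong)
    fix u assume "u \<in> space (count_space (words n))"
    then have u: "length u = n" by simp
    have "H (prune u t) = H t" for t
      using H[of "prune u t"] H[of t] cut_prune[of u t] u by simp
    then have "(\<integral>\<^sup>+t. H t * (ennreal (weight u t ^ p) * mass p r (subtree u t)) \<partial>P) =
       (\<integral>\<^sup>+t. \<integral>\<^sup>+s. H t * (ennreal (weight u t ^ p) * mass p r s) \<partial>P \<partial>P)"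
      by (intro nn_integral_subtree) (auto simp: weight_prune)
    also have "\<dots> = (\<integral>\<^sup>+t. H t * ennreal (weight u t ^ p) \<partial>P) * (\<integral>\<^sup>+t. mass p r t \<partial>P)"
      by (simp add: nn_integral_cmult mult.assoc[symmetric] nn_integral_multc)
    finally show "(\<integral>\<^sup>+t. H t * (ennreal (weight u t ^ p) * mass p r (subtree u t)) \<partial>P) =
       (\<integral>\<^sup>+t. H t * ennreal (weight u t ^ p) \<partial>P) * (\<integral>\<^sup>+t. mass p r t \<partial>P)" .
  qed
  also have "\<dots> = (\<integral>\<^sup>+u. \<integral>\<^sup>+t. H t * ennreal (weight u t ^ p) \<partial>P \<partial>count_space (words n)) * (\<integral>\<^sup>+t. mass p r t \<partial>P)"
    by (rule nn_integral_multc) simp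
  also have "(\<integral>\<^sup>+u. \<integral>\<^sup>+t. H t * ennreal (weight u t ^ p) \<partial>P \<partial>count_space (words n)) =
      (\<integral>\<^sup>+t. \<integral>\<^sup>+u. H t * ennreal (weight u t ^ p) \<partial>count_space (words n) \<partial>P)"
    by (rule nn_integral_count_space_swap[symmetric]) auto
  also have "\<dots> = (\<integral>\<^sup>+t. H t * mass p n t \<partial>P)"
    by (simp add: nn_integral_cmult mass_def)
  finally show ?thesis .
qed

lemma nn_integral_mass: "(\<integral>\<^sup>+t. mass p n t \<partial>P) = (\<integral>\<^sup>+t. mass p 1 t \<partial>P) ^ n"
proof (induction n)
  case (Suc n)
  show ?case
    using nn_integral_mass_add[of "\<lambda>_. 1" 1 p n] Suc by simp
qed (simp add: emeasure_space_1[simplified])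

text \<open>The square expands into a sum over pairs of words of length n. Distinct words carry
  independent subtrees of mean 1; equal words contribute the second moment of one subtree, and these
  diagonal terms add up to the mass with exponent 2. That mass stands on both sides to avoid
  subtraction in \<open>ennreal\<close>.\<close>

lemma nn_integral_mass_square:
  assumes "(\<integral>\<^sup>+t. mass 1 1 t \<partial>P) = 1"
  shows "(\<integral>\<^sup>+t. (mass 1 (n + r) t)\<^sup>2 \<partial>P) + (\<integral>\<^sup>+t. mass 2 n t \<partial>P) =
    (\<integral>\<^sup>+t. (mass 1 n t)\<^sup>2 \<partial>P) + (\<integral>\<^sup>+t. mass 2 n t \<partial>P) * (\<integral>\<^sup>+t. (mass 1 r t)\<^sup>2 \<partial>P)"
proof -
  note One_nat_def [simp del]
  let ?C = "count_space (words n)"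
  define E where "E u v = (\<integral>\<^sup>+t. ennreal (weight u t) * ennreal (weight v t) \<partial>P)" for u v
  define q where "q = (\<integral>\<^sup>+t. (mass 1 r t)\<^sup>2 \<partial>P)"
  have one: "(\<integral>\<^sup>+t. mass 1 r t \<partial>P) = 1"
    using nn_integral_mass[of 1 r] assms by simp
  have square: "(\<integral>\<^sup>+t. (\<integral>\<^sup>+u. ennreal (weight u t) * f u t \<partial>?C)\<^sup>2 \<partial>P) =
      (\<integral>\<^sup>+u. \<integral>\<^sup>+v. \<integral>\<^sup>+t. ennreal (weight u t) * f u t * (ennreal (weight v t) * f v t) \<partial>P \<partial>?C \<partial>?C)"
    if [measurable]: "\<And>u. f u \<in> borel_measurable tree_space" for f
  proof -
    let ?h = "\<lambda>u v t. ennreal (weight u t) * f u t * (ennreal (weight v t) * f v t)"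
    have "(\<integral>\<^sup>+t. (\<integral>\<^sup>+u. ennreal (weight u t) * f u t \<partial>?C)\<^sup>2 \<partial>P) =
      (\<integral>\<^sup>+t. \<integral>\<^sup>+u. \<integral>\<^sup>+v. ?h u v t \<partial>?C \<partial>?C \<partial>P)"
      by (simp add: power2_eq_square nn_integral_cmult nn_integral_multc)
    also have "\<dots> = (\<integral>\<^sup>+u. \<integral>\<^sup>+t. \<integral>\<^sup>+v. ?h u v t \<partial>?C \<partial>P \<partial>?C)"
      by (rule nn_integral_count_space_swap) (auto simp: measurable_P intro!: borel_measurable_nn_integral_count_space)
    also have "\<dots> = (\<integral>\<^sup>+u. \<integral>\<^sup>+v. \<integral>\<^sup>+t. ?h u v t \<partial>P \<partial>?C \<partial>?C)"
      by (intro nn_integral_cong nn_integral_count_space_swap) auto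
    finally show ?thesis .
  qed
  let ?p = "\<lambda>u v t. ennreal (weight u t) * mass 1 r (subtree u t) * (ennreal (weight v t) * mass 1 r (subtree v t))"
  have pair: "(\<integral>\<^sup>+t. ?p u v t \<partial>P) =
      E u v * (if u = v then q else 1)" if "length u = n" "length v = n" for u v
  proof (cases "u = v")
    case True
    have "(\<integral>\<^sup>+t. ?p u v t \<partial>P) =
       (\<integral>\<^sup>+t. ennreal (weight u t) * ennreal (weight v t) * (mass 1 r (subtree u t))\<^sup>2 \<partial>P)"
      using True by (simp add: power2_eq_square mult_ac)
    also have "\<dots> = (\<integral>\<^sup>+t. \<integral>\<^sup>+s. ennreal (weight u t) * ennreal (weight v t) * (mass 1 r s)\<^sup>2 \<partial>P \<partial>P)"
      using that by (intro nn_integral_subtree) (auto simp: weight_prune)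
    also have "\<dots> = E u v * q"
      by (simp add: nn_integral_cmult nn_integral_multc E_def q_def)
    finally show ?thesis using True by simp
  next
    \<comment> \<open>The two subtrees are integrated out one after the other: pruning at
      \<open>v\<close> leaves the subtree at \<open>u\<close> intact, since the words are distinct
      and of equal length.\<close>
    case False
    have "(\<integral>\<^sup>+t. ?p u v t \<partial>P) =
       (\<integral>\<^sup>+t. \<integral>\<^sup>+s. ennreal (weight u t) * mass 1 r (subtree u t) * (ennreal (weight v t) * mass 1 r s) \<partial>P \<partial>P)"
      using that False by (intro nn_integral_subtree) (auto simp: weight_prune subtree_prune)
    also have "\<dots> = (\<integral>\<^sup>+t. ennreal (weight u t) * ennreal (weight v t) * mass 1 r (subtree u t) \<partial>P)"
      by (simp add: nn_integral_cmult one) (simp add: mult_ac)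
    also have "\<dots> = (\<integral>\<^sup>+t. \<integral>\<^sup>+s. ennreal (weight u t) * ennreal (weight v t) * mass 1 r s \<partial>P \<partial>P)"
      using that by (intro nn_integral_subtree) (auto simp: weight_prune)
    also have "\<dots> = E u v"
      by (simp add: nn_integral_cmult one E_def)
    finally show ?thesis using False by simp
  qed
  have m2: "(\<integral>\<^sup>+t. mass 2 n t \<partial>P) = (\<integral>\<^sup>+u. E u u \<partial>?C)"
    unfolding mass_def E_def
    by (subst nn_integral_count_space_swap) (auto simp: power2_eq_square ennreal_mult)
  have diag: "(\<integral>\<^sup>+v. E u v * (if u = v then c else 0) \<partial>?C) = E u u * c" if "length u = n" for u c
  proof -
    have "(\<integral>\<^sup>+v. E u v * (if u = v then c else 0) \<partial>?C) = (\<Sum>v\<in>{u}. E u v * (if u = v then c else 0))"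
      using that by (intro nn_integral_count_space') auto
    then show ?thesis by simp
  qed
  have "(\<integral>\<^sup>+t. (mass 1 (n + r) t)\<^sup>2 \<partial>P) = (\<integral>\<^sup>+u. \<integral>\<^sup>+v. E u v * (if u = v then q else 1) \<partial>?C \<partial>?C)"
    unfolding mass_add power_one_right by (subst square) (auto intro!: nn_integral_cong simp: pair)
  moreover have "(\<integral>\<^sup>+t. mass 2 n t \<partial>P) = (\<integral>\<^sup>+u. \<integral>\<^sup>+v. E u v * (if u = v then 1 else 0) \<partial>?C \<partial>?C)"
    unfolding m2 by (intro nn_integral_cong) (simp add: diag)
  moreover have "(\<integral>\<^sup>+t. mass 2 n t \<partial>P) * q = (\<integral>\<^sup>+u. \<integral>\<^sup>+v. E u v * (if u = v then q else 0) \<partial>?C \<partial>?C)"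
    unfolding m2 by (subst nn_integral_multc[symmetric]) (auto intro!: nn_integral_cong simp: diag)
  moreover have "(\<integral>\<^sup>+t. (mass 1 n t)\<^sup>2 \<partial>P) = (\<integral>\<^sup>+u. \<integral>\<^sup>+v. E u v \<partial>?C \<partial>?C)"
    using square[of "\<lambda>_ _. 1"] by (simp add: mass_def E_def)
  moreover have "(\<integral>\<^sup>+u. \<integral>\<^sup>+v. E u v * (if u = v then q else 1) \<partial>?C \<partial>?C) + (\<integral>\<^sup>+u. \<integral>\<^sup>+v. E u v * (if u = v then 1 else 0) \<partial>?C \<partial>?C) =
     (\<integral>\<^sup>+u. \<integral>\<^sup>+v. E u v \<partial>?C \<partial>?C) + (\<integral>\<^sup>+u. \<integral>\<^sup>+v. E u v * (if u = v then q else 0) \<partial>?C \<partial>?C)"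
    by (subst (1 2) nn_integral_add[symmetric], simp, simp, simp, simp)
       (subst (1 2) nn_integral_add[symmetric], auto intro!: nn_integral_cong)
  ultimately show ?thesis by (simp add: q_def)
qed

end

section \<open>The additive martingale\<close>

context random_tree begin

lemma nn_integral_mass_ennreal:
  assumes "0 \<le> c" "(\<integral>\<^sup>+t. mass p 1 t \<partial>P) = ennreal c"
  shows "(\<integral>\<^sup>+t. mass p n t \<partial>P) = ennreal (c ^ n)"
  using nn_integral_mass[of p n] assms by (simp add: ennreal_power)

lemma AE_mass_finite:
  assumes "0 \<le> c" "(\<integral>\<^sup>+t. mass p 1 t \<partial>P) = ennreal c"
  shows "AE t in P. mass p n t < \<infinity>"
proof -
  have "AE t in P. mass p n t \<noteq> \<infinity>"
    using nn_integral_mass_ennreal[OF assms, of n] by (intro nn_integral_PInf_AE) auto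
  then show ?thesis by (simp add: less_top)
qed

lemma AE_ennreal_normalized_mass:
  assumes "0 < c" "(\<integral>\<^sup>+t. mass p 1 t \<partial>P) = ennreal c"
  shows "AE t in P. ennreal (enn2real (mass p n t) / c ^ n) = mass p n t * ennreal (1 / c ^ n)"
  using AE_mass_finite[OF less_imp_le[OF assms(1)] assms(2), of n]
proof eventually_elim
  case (elim t)
  then show ?case
    using assms(1) by (subst divide_inverse, subst ennreal_mult) (auto simp: less_top inverse_eq_divide)
qed

lemma AE_convergent_mass:
  assumes c: "0 < c" "(\<integral>\<^sup>+t. mass p 1 t \<partial>P) = ennreal c"
  shows "AE t in P. convergent (\<lambda>n. enn2real (mass p n t) / c ^ n)"
proof -
  \<comment> \<open>The \<sigma>-algebra generated by the marks of the words of length below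
    n.\<close>
  define F where "F n = vimage_algebra UNIV (cut n) tree_space" for n
  define W where "W n t = enn2real (mass p n t) / c ^ n" for n t
  have spaceF: "space (F n) = UNIV" for n by (simp add: F_def)
  have setsF: "sets (F n) = {cut n -` A | A. A \<in> sets tree_space}" for n
    unfolding F_def by (subst sets_vimage_algebra2) auto
  have cutF: "cut n \<in> measurable (F n) tree_space" for n
    unfolding F_def by (rule measurable_vimage_algebra1) simp
  have WF: "W n \<in> borel_measurable (F n)" for n
  proof -
    have "W n = (\<lambda>t. W n (cut n t))" by (simp add: W_def mass_cut fun_eq_iff)
    moreover have "(\<lambda>t. W n (cut n t)) \<in> borel_measurable (F n)"
      by (rule measurable_compose[OF cutF]) (simp add: W_def)
    ultimately show ?thesis by simp
  qed
  have W0: "0 \<le> W n t" for n t using c by (simp add: W_def)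
  have eW: "AE t in P. ennreal (W n t) = mass p n t * ennreal (1 / c ^ n)" for n
    unfolding W_def by (rule AE_ennreal_normalized_mass[OF c])
  have WM [measurable]: "W n \<in> borel_measurable tree_space" for n unfolding W_def by measurable
  show ?thesis
    unfolding W_def[symmetric]
  proof (rule nonneg_martingale_AE_convergent[where F=F and W=W, OF prob_space_axioms])
    show "subalgebra P (F n)" for n
      unfolding subalgebra_def setsF using measurable_sets[OF measurable_cut] by (auto simp: spaceF)
    show "sets (F m) \<subseteq> sets (F n)" if "m \<le> n" for m n
    proof -
      have "cut m t = cut m (cut n t)" for t using that by (auto simp: cut_def fun_eq_iff)
      then have "cut m \<in> measurable (F n) tree_space"
        using measurable_compose[OF cutF[of n] measurable_cut[of m]] by simp
      from measurable_sets[OF this] show ?thesis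
        unfolding setsF[of m] by (auto simp: spaceF)
    qed
    show "integrable P (W n)" for n
    proof (rule integrableI_nonneg)
      have "(\<integral>\<^sup>+t. ennreal (W n t) \<partial>P) = (\<integral>\<^sup>+t. mass p n t * ennreal (1 / c ^ n) \<partial>P)"
        by (rule nn_integral_cong_AE[OF eW])
      also have "\<dots> < \<infinity>"
        using nn_integral_mass_ennreal[OF less_imp_le[OF c(1)] c(2), of n]
        by (simp add: nn_integral_multc ennreal_mult_less_top)
      finally show "(\<integral>\<^sup>+t. ennreal (W n t) \<partial>P) < \<infinity>" .
    qed (auto simp: W0)
    fix n h assume h: "h \<in> borel_measurable (F n)" "\<And>x. 0 \<le> h x" "\<And>x. h x \<le> (1::real)"
    \<comment> \<open>Each level set of \<open>h\<close> is a preimage under \<open>cut n\<close>,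
      and \<open>cut n\<close> is idempotent, so \<open>t\<close> and \<open>cut n t\<close> lie in
      the same level set.\<close>
    have hcut: "h (cut n t) = h t" for t
    proof -
      have "h -` {h t} \<inter> space (F n) \<in> sets (F n)" using h(1) by (rule measurable_sets) auto
      then obtain B where "h -` {h t} = cut n -` B"
        by (auto simp: spaceF setsF)
      moreover have "cut n (cut n t) = cut n t" by (auto simp: cut_def fun_eq_iff)
      ultimately show ?thesis by auto
    qed
    have hM [measurable]: "h \<in> borel_measurable tree_space"
    proof -
      have "(\<lambda>t. t) \<in> measurable tree_space (F n)"
        unfolding F_def by (rule measurable_vimage_algebra2) auto
      from measurable_compose[OF this h(1)] show ?thesis .
    qed
    have int: "(\<integral>x. h x * W k x \<partial>P) = enn2real ((\<integral>\<^sup>+t. ennreal (h t) * mass p k t \<partial>P) * ennreal (1 / c ^ k))" for k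
    proof -
      have "(\<integral>x. h x * W k x \<partial>P) = enn2real (\<integral>\<^sup>+t. ennreal (h t * W k t) \<partial>P)"
        using h(2) W0 by (intro integral_eq_nn_integral) auto
      also have "(\<integral>\<^sup>+t. ennreal (h t * W k t) \<partial>P) = (\<integral>\<^sup>+t. ennreal (h t) * mass p k t * ennreal (1 / c ^ k) \<partial>P)"
        using eW[of k] h(2) by (intro nn_integral_cong_AE) (auto simp: ennreal_mult'' W0 mult.assoc elim!: eventually_mono)
      finally show ?thesis by (simp add: nn_integral_multc)
    qed
    have "(\<integral>\<^sup>+t. ennreal (h t) * mass p (n + 1) t \<partial>P) = (\<integral>\<^sup>+t. ennreal (h t) * mass p n t \<partial>P) * ennreal c"
      using nn_integral_mass_add[of "\<lambda>t. ennreal (h t)" n p 1] hcut unfolding c(2) by simp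
    moreover have "ennreal c * ennreal (1 / c ^ Suc n) = ennreal (1 / c ^ n)"
      using c(1) by (simp add: ennreal_mult[symmetric])
    ultimately show "(\<integral>x. h x * W (Suc n) x \<partial>P) = (\<integral>x. h x * W n x \<partial>P)"
      unfolding int by (simp add: mult.assoc)
  qed (use WF W0 in auto)
qed

end

text \<open>Continuity of the L2 norm through Young's inequality a^2 \<le> (1 + d) b^2 + (1 + 1/d)
  (a - b)^2, used in both directions; first k tends to infinity, then d to 0.\<close>

lemma second_moment_limit:
  fixes X :: "'a \<Rightarrow> real"
  assumes "integrable M (\<lambda>x. (X x)\<^sup>2)" "\<And>k. integrable M (\<lambda>x. (Y k x)\<^sup>2)" "\<And>k. integrable M (\<lambda>x. (X x - Y k x)\<^sup>2)"
    and e: "(\<lambda>k. \<integral>x. (X x - Y k x)\<^sup>2 \<partial>M) \<longlonglongrightarrow> 0" and l: "(\<lambda>k. \<integral>x. (Y k x)\<^sup>2 \<partial>M) \<longlonglongrightarrow> l"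
  shows "(\<integral>x. (X x)\<^sup>2 \<partial>M) = l"
proof -
  have young: "a\<^sup>2 \<le> (1 + d) * b\<^sup>2 + (1 + 1 / d) * (a - b)\<^sup>2" if "d > 0" for a b d :: real
  proof -
    have "0 \<le> (d * b - (a - b))\<^sup>2 / d" using that by simp
    also have "\<dots> = (1 + d) * b\<^sup>2 + (1 + 1 / d) * (a - b)\<^sup>2 - a\<^sup>2"
      using that by (simp add: field_simps power2_eq_square)
    finally show ?thesis by simp
  qed
  let ?x = "\<integral>x. (X x)\<^sup>2 \<partial>M"
  have 1: "?x \<le> (1 + d) * l" and 2: "l \<le> (1 + d) * ?x" if "d > 0" for d
  proof -
    have "?x \<le> (1 + d) * (\<integral>x. (Y k x)\<^sup>2 \<partial>M) + (1 + 1 / d) * (\<integral>x. (X x - Y k x)\<^sup>2 \<partial>M)" for k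
    proof -
      have "?x \<le> (\<integral>x. (1 + d) * (Y k x)\<^sup>2 + (1 + 1 / d) * (X x - Y k x)\<^sup>2 \<partial>M)"
        using assms(1-3) young[OF that] by (intro integral_mono) auto
      then show ?thesis using assms(1-3) by simp
    qed
    moreover have "(\<lambda>k. (1 + d) * (\<integral>x. (Y k x)\<^sup>2 \<partial>M) + (1 + 1 / d) * (\<integral>x. (X x - Y k x)\<^sup>2 \<partial>M)) \<longlonglongrightarrow> (1 + d) * l + (1 + 1 / d) * 0"
      by (intro tendsto_intros e l)
    ultimately show "?x \<le> (1 + d) * l" by (intro LIMSEQ_le_const) auto
    have "(\<integral>x. (Y k x)\<^sup>2 \<partial>M) \<le> (1 + d) * ?x + (1 + 1 / d) * (\<integral>x. (X x - Y k x)\<^sup>2 \<partial>M)" for k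
    proof -
      have "(\<integral>x. (Y k x)\<^sup>2 \<partial>M) \<le> (\<integral>x. (1 + d) * (X x)\<^sup>2 + (1 + 1 / d) * (X x - Y k x)\<^sup>2 \<partial>M)"
      proof (intro integral_mono)
        show "(Y k x)\<^sup>2 \<le> (1 + d) * (X x)\<^sup>2 + (1 + 1 / d) * (X x - Y k x)\<^sup>2" for x
          using young[OF that, of "Y k x" "X x"] by (simp add: power2_commute[of "X x" "Y k x"])
      qed (use assms(1-3) in auto)
      then show ?thesis using assms(1-3) by simp
    qed
    moreover have "(\<lambda>k. (1 + d) * ?x + (1 + 1 / d) * (\<integral>x. (X x - Y k x)\<^sup>2 \<partial>M)) \<longlonglongrightarrow> (1 + d) * ?x + (1 + 1 / d) * 0"
      by (intro tendsto_intros e)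
    ultimately show "l \<le> (1 + d) * ?x" using l by (intro LIMSEQ_le[OF l]) auto
  qed
  have lim: "((\<lambda>d. (1 + d) * c) \<longlongrightarrow> (1 + 0) * c) (at_right 0)" for c :: real
    by (intro tendsto_intros)
  have "?x \<le> (1 + 0) * l"
    by (rule tendsto_lowerbound[OF lim]) (auto simp: eventually_at_filter intro!: always_eventually 1)
  moreover have "l \<le> (1 + 0) * ?x"
    by (rule tendsto_lowerbound[OF lim]) (auto simp: eventually_at_filter intro!: always_eventually 2)
  ultimately show ?thesis by simp
qed

section \<open>Second moments and limits of the additive martingales\<close>

locale biggins_tree = random_tree +
  fixes m2 \<sigma>2 :: real
  assumes m2: "0 < m2" "m2 < 1" and \<sigma>2: "0 \<le> \<sigma>2"
    and mass1: "(\<integral>\<^sup>+t. mass 1 1 t \<partial>P) = 1" and mass2: "(\<integral>\<^sup>+t. mass 2 1 t \<partial>P) = ennreal m2"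
    and mass1_square: "(\<integral>\<^sup>+t. (mass 1 1 t)\<^sup>2 \<partial>P) = ennreal (1 + \<sigma>2)"
begin

declare One_nat_def [simp del]

text \<open>The geometric series of the variances of the orthogonal increments: passing from
  generation n to n + 1 contributes \<open>\<sigma>2 * m2 ^ n\<close>.\<close>

definition v2 :: real where "v2 = \<sigma>2 / (1 - m2)"

definition W :: "nat \<Rightarrow> tree \<Rightarrow> real" where "W n t = enn2real (mass 1 n t)"

definition Winf :: "tree \<Rightarrow> real" where "Winf t = lim (\<lambda>n. W n t)"

definition D :: "nat \<Rightarrow> tree \<Rightarrow> real" where "D n t = enn2real (mass 2 n t) / m2 ^ n"

definition Dinf :: "tree \<Rightarrow> real" where "Dinf t = lim (\<lambda>n. D n t)"

lemma v2_nonneg: "0 \<le> v2"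
  using m2 \<sigma>2 by (simp add: v2_def)

lemma m2_power_le_1: "m2 ^ n \<le> 1"
  using m2 by (simp add: power_le_one)

lemma mass1': "(\<integral>\<^sup>+t. mass 1 1 t \<partial>P) = ennreal 1"
  using mass1 by simp

lemma W_nonneg [simp]: "0 \<le> W n t" and D_nonneg [simp]: "0 \<le> D n t"
  using m2 by (simp_all add: W_def D_def)

lemma measurable_W [measurable]: "W n \<in> borel_measurable tree_space"
  and measurable_D [measurable]: "D n \<in> borel_measurable tree_space"
  unfolding W_def D_def by measurable

lemma measurable_Winf [measurable]: "Winf \<in> borel_measurable tree_space"
  and measurable_Dinf [measurable]: "Dinf \<in> borel_measurable tree_space"
  unfolding Winf_def Dinf_def by (intro borel_measurable_lim_metric; simp)+

lemma W_0 [simp]: "W 0 t = 1"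
  by (simp add: W_def)

lemma AE_ennreal_W: "AE t in P. ennreal (W n t) = mass 1 n t"
  using AE_ennreal_normalized_mass[OF _ mass1', of n] by (simp add: W_def)

lemma AE_ennreal_W_all: "AE t in P. \<forall>n. ennreal (W n t) = mass 1 n t"
  by (auto simp: AE_all_countable AE_ennreal_W)

lemma AE_W_tendsto: "AE t in P. (\<lambda>n. W n t) \<longlonglongrightarrow> Winf t"
  using AE_convergent_mass[OF _ mass1'] by (simp add: W_def Winf_def convergent_LIMSEQ_iff)

lemma AE_D_tendsto: "AE t in P. (\<lambda>n. D n t) \<longlonglongrightarrow> Dinf t"
  using AE_convergent_mass[OF m2(1) mass2] by (simp add: D_def Dinf_def convergent_LIMSEQ_iff)

lemma AE_Winf_nonneg: "AE t in P. 0 \<le> Winf t"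
  using AE_W_tendsto by eventually_elim (auto intro: LIMSEQ_le_const)

lemma AE_Dinf_nonneg: "AE t in P. 0 \<le> Dinf t"
  using AE_D_tendsto by eventually_elim (auto intro: LIMSEQ_le_const)

text \<open>Splitting at the first generation gives the affine recursion E W_{n+1}^2 = 1 + \<sigma>2
  - m2 + m2 * E W_n^2, whose fixed point is 1 + v2.\<close>

lemma nn_integral_W_square: "(\<integral>\<^sup>+t. (mass 1 n t)\<^sup>2 \<partial>P) = ennreal (1 + v2 * (1 - m2 ^ n))"
proof (induction n)
  case 0
  then show ?case by (simp add: emeasure_space_1[simplified])
next
  case (Suc n)
  have pn: "0 \<le> v2 * (1 - m2 ^ n)" "0 \<le> v2 * (1 - m2 ^ Suc n)"
    using v2_nonneg m2_power_le_1 by (auto intro!: mult_nonneg_nonneg simp del: power_Suc)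
  have s: "\<sigma>2 = v2 * (1 - m2)" using m2 by (simp add: v2_def)
  have "(\<integral>\<^sup>+t. (mass 1 (1 + n) t)\<^sup>2 \<partial>P) + ennreal m2 = ennreal (1 + \<sigma>2) + ennreal m2 * ennreal (1 + v2 * (1 - m2 ^ n))"
    using nn_integral_mass_square[OF mass1, of 1 n] by (simp add: mass2 mass1_square Suc)
  also have "\<dots> = ennreal (1 + \<sigma>2 + m2 * (1 + v2 * (1 - m2 ^ n)))"
    using m2 \<sigma>2 pn by (simp add: ennreal_mult[symmetric] ennreal_plus[symmetric] del: ennreal_plus)
  also have "1 + \<sigma>2 + m2 * (1 + v2 * (1 - m2 ^ n)) = 1 + v2 * (1 - m2) + m2 * (1 + v2 * (1 - m2 ^ n))"
    using s by linarith
  also have "\<dots> = (1 + v2 * (1 - m2 ^ Suc n)) + m2"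
    by (simp add: algebra_simps)
  also have "ennreal \<dots> = ennreal (1 + v2 * (1 - m2 ^ Suc n)) + ennreal m2"
    using pn m2 by (intro ennreal_plus) auto
  finally show ?case by (simp del: power_Suc add: plus_1_eq_Suc)
qed

text \<open>Orthogonality of the increments: \<open>mass 1 n\<close> is decided by the first n
  generations and thus serves as the multiplier, so the later factor may be replaced by the earlier
  one.\<close>

lemma nn_integral_W_mult: "(\<integral>\<^sup>+t. mass 1 n t * mass 1 (n + k) t \<partial>P) = ennreal (1 + v2 * (1 - m2 ^ n))"
  using nn_integral_mass_add[of "mass 1 n" n 1 k] nn_integral_mass_ennreal[OF _ mass1', of k] nn_integral_W_square[of n]
  by (simp add: mass_cut power2_eq_square)

lemma second_moment_nonneg: "0 \<le> 1 + v2 * (1 - m2 ^ n)"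
  using v2_nonneg m2_power_le_1 by (auto intro!: add_nonneg_nonneg mult_nonneg_nonneg)

lemma W_mult: "integrable P (\<lambda>t. W n t * W (n + k) t)" "(\<integral>t. W n t * W (n + k) t \<partial>P) = 1 + v2 * (1 - m2 ^ n)"
proof -
  have nn: "(\<integral>\<^sup>+t. ennreal (W n t * W (n + k) t) \<partial>P) = ennreal (1 + v2 * (1 - m2 ^ n))"
    unfolding nn_integral_W_mult[of n k, symmetric]
    using AE_ennreal_W[of n] AE_ennreal_W[of "n + k"]
    by (intro nn_integral_cong_AE) (auto simp: ennreal_mult)
  then show "integrable P (\<lambda>t. W n t * W (n + k) t)"
    by (intro integrableI_nonneg) auto
  show "(\<integral>t. W n t * W (n + k) t \<partial>P) = 1 + v2 * (1 - m2 ^ n)"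
    using nn second_moment_nonneg[of n] by (subst integral_eq_nn_integral) auto
qed

lemma W_square: "integrable P (\<lambda>t. (W n t)\<^sup>2)" "(\<integral>t. (W n t)\<^sup>2 \<partial>P) = 1 + v2 * (1 - m2 ^ n)"
  using W_mult[of n 0] by (simp_all add: power2_eq_square)

lemma integrable_W: "integrable P (W n)"
  by (rule square_integrable_imp_integrable) (auto simp: W_square)

lemma expectation_W: "(\<integral>t. W n t \<partial>P) = 1"
  using W_mult(2)[of 0 n] by simp

lemma W_diff_square:
  "integrable P (\<lambda>t. (W (n + k) t - W n t)\<^sup>2)" "(\<integral>t. (W (n + k) t - W n t)\<^sup>2 \<partial>P) = v2 * (m2 ^ n - m2 ^ (n + k))"
proof -
  have eq: "(W (n + k) t - W n t)\<^sup>2 = (W (n + k) t)\<^sup>2 + (W n t)\<^sup>2 - 2 * (W n t * W (n + k) t)" for t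
    by (simp add: power2_eq_square algebra_simps)
  show "integrable P (\<lambda>t. (W (n + k) t - W n t)\<^sup>2)" "(\<integral>t. (W (n + k) t - W n t)\<^sup>2 \<partial>P) = v2 * (m2 ^ n - m2 ^ (n + k))"
    unfolding eq by (simp_all add: W_square W_mult) (simp add: algebra_simps)
qed

text \<open>Fatou's lemma along W_{n+k} - W_n. Integrability and this upper bound already give
  convergence in L2, from which the exact value follows next.\<close>

lemma Winf_diff_square_le:
  "integrable P (\<lambda>t. (Winf t - W n t)\<^sup>2) \<and> (\<integral>t. (Winf t - W n t)\<^sup>2 \<partial>P) \<le> v2 * m2 ^ n"
proof -
  have "(\<integral>\<^sup>+t. ennreal ((Winf t - W n t)\<^sup>2) \<partial>P) = (\<integral>\<^sup>+t. liminf (\<lambda>k. ennreal ((W (n + k) t - W n t)\<^sup>2)) \<partial>P)"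
  proof (intro nn_integral_cong_AE)
    show "AE t in P. ennreal ((Winf t - W n t)\<^sup>2) = liminf (\<lambda>k. ennreal ((W (n + k) t - W n t)\<^sup>2))"
      using AE_W_tendsto
    proof eventually_elim
      case (elim t)
      then have "(\<lambda>k. W (k + n) t) \<longlonglongrightarrow> Winf t" by (rule LIMSEQ_ignore_initial_segment)
      then have "(\<lambda>k. ennreal ((W (n + k) t - W n t)\<^sup>2)) \<longlonglongrightarrow> ennreal ((Winf t - W n t)\<^sup>2)"
        by (intro tendsto_intros) (simp add: add.commute)
      then show ?case using lim_imp_Liminf by (metis trivial_limit_sequentially)
    qed
  qed
  also have "\<dots> \<le> liminf (\<lambda>k. \<integral>\<^sup>+t. ennreal ((W (n + k) t - W n t)\<^sup>2) \<partial>P)"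
    by (rule nn_integral_liminf) auto
  also have "\<dots> \<le> liminf (\<lambda>k. ennreal (v2 * m2 ^ n))"
  proof (rule Liminf_mono, rule always_eventually, rule allI)
    fix k
    have "(\<integral>\<^sup>+t. ennreal ((W (n + k) t - W n t)\<^sup>2) \<partial>P) = ennreal (v2 * (m2 ^ n - m2 ^ (n + k)))"
      using W_diff_square[of n k] by (subst nn_integral_eq_integral) auto
    also have "\<dots> \<le> ennreal (v2 * m2 ^ n)"
      using v2_nonneg m2 by (intro ennreal_leI mult_left_mono) auto
    finally show "(\<integral>\<^sup>+t. ennreal ((W (n + k) t - W n t)\<^sup>2) \<partial>P) \<le> ennreal (v2 * m2 ^ n)" .
  qed
  finally have le: "(\<integral>\<^sup>+t. ennreal ((Winf t - W n t)\<^sup>2) \<partial>P) \<le> ennreal (v2 * m2 ^ n)"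
    by (simp add: Liminf_const)
  then have int: "integrable P (\<lambda>t. (Winf t - W n t)\<^sup>2)"
    by (intro integrableI_nonneg) (auto intro: le_less_trans)
  then show ?thesis
    using le v2_nonneg m2 by (simp add: nn_integral_eq_integral)
qed

lemma m2_power_tendsto_0: "(\<lambda>n. m2 ^ n) \<longlonglongrightarrow> 0"
  using m2 by (intro LIMSEQ_power_zero) auto

lemma Winf_diff_square:
  "integrable P (\<lambda>t. (Winf t - W n t)\<^sup>2)" "(\<integral>t. (Winf t - W n t)\<^sup>2 \<partial>P) = v2 * m2 ^ n"
proof -
  show "integrable P (\<lambda>t. (Winf t - W n t)\<^sup>2)" using Winf_diff_square_le by blast
  show "(\<integral>t. (Winf t - W n t)\<^sup>2 \<partial>P) = v2 * m2 ^ n"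
  proof (rule second_moment_limit[where Y="\<lambda>k t. W (n + k) t - W n t"])
    have "(\<lambda>k. m2 ^ n * m2 ^ k) \<longlonglongrightarrow> m2 ^ n * 0" by (intro tendsto_intros m2_power_tendsto_0)
    then have p: "(\<lambda>k. m2 ^ (n + k)) \<longlonglongrightarrow> 0" by (simp only: power_add mult_zero_right)
    have "(\<lambda>k. v2 * m2 ^ (n + k)) \<longlonglongrightarrow> v2 * 0" by (intro tendsto_intros p)
    then have p': "(\<lambda>k. v2 * m2 ^ (n + k)) \<longlonglongrightarrow> 0" by (simp only: mult_zero_right)
    show "(\<lambda>k. \<integral>t. (Winf t - W n t - (W (n + k) t - W n t))\<^sup>2 \<partial>P) \<longlonglongrightarrow> 0"
      by (rule tendsto_sandwich[OF _ _ tendsto_const p']) (auto intro!: always_eventually simp: Winf_diff_square_le)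
    have "(\<lambda>k. v2 * (m2 ^ n - m2 ^ (n + k))) \<longlonglongrightarrow> v2 * (m2 ^ n - 0)" by (intro tendsto_intros p)
    then show "(\<lambda>k. \<integral>t. (W (n + k) t - W n t)\<^sup>2 \<partial>P) \<longlonglongrightarrow> v2 * m2 ^ n"
      by (simp only: W_diff_square diff_zero)
  qed (use Winf_diff_square_le W_diff_square in auto)
qed

lemma integrable_Winf_diff: "integrable P (\<lambda>t. Winf t - W n t)"
  by (rule square_integrable_imp_integrable) (auto simp: Winf_diff_square)

lemma integrable_Winf: "integrable P Winf"
  using Bochner_Integration.integrable_add[OF integrable_Winf_diff[of 0] integrable_W[of 0]] by simp

text \<open>Convergence in L2 carries the constant mean of the W_n over to the limit.\<close>

lemma expectation_Winf: "(\<integral>t. Winf t \<partial>P) = 1"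
proof -
  have "((\<integral>t. Winf t \<partial>P) - 1)\<^sup>2 \<le> v2 * m2 ^ n" for n
  proof -
    have "(\<integral>t. Winf t \<partial>P) - 1 = (\<integral>t. Winf t - W n t \<partial>P)"
      using integrable_Winf integrable_W by (simp add: expectation_W)
    moreover have "(\<integral>t. Winf t - W n t \<partial>P)\<^sup>2 \<le> (\<integral>t. (Winf t - W n t)\<^sup>2 \<partial>P)"
      using variance_positive[of "\<lambda>t. Winf t - W n t"]
      by (subst (asm) variance_eq) (auto simp: Winf_diff_square integrable_Winf_diff)
    ultimately show ?thesis by (simp add: Winf_diff_square)
  qed
  moreover have "(\<lambda>n. v2 * m2 ^ n) \<longlonglongrightarrow> v2 * 0" by (intro tendsto_intros m2_power_tendsto_0)
  ultimately have "((\<integral>t. Winf t \<partial>P) - 1)\<^sup>2 \<le> 0" by (intro LIMSEQ_le_const[of _ 0]) auto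
  then show ?thesis by simp
qed

lemma integrable_Winf_square: "integrable P (\<lambda>t. (Winf t)\<^sup>2)"
proof -
  have "(Winf t)\<^sup>2 = (Winf t - W 0 t)\<^sup>2 + 2 * Winf t - 1" for t by (simp add: power2_diff)
  then show ?thesis using Winf_diff_square(1)[of 0] integrable_Winf by simp
qed

lemma variance_Winf: "variance Winf = v2"
  using Winf_diff_square(2)[of 0] by (simp add: expectation_Winf)

text \<open>Polarization: the product is half of the sum of the two squares minus the square of W_s
  - W_r, and v2 * (m2^r + m2^s - (m2^r - m2^s)) / 2 = v2 * m2^s.\<close>

lemma covariance_Winf_diff:
  assumes "r \<le> s"
  shows "integrable P (\<lambda>t. (Winf t - W r t) * (Winf t - W s t))"
    "(\<integral>t. (Winf t - W r t) * (Winf t - W s t) \<partial>P) = v2 * m2 ^ s"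
proof -
  have eq: "(Winf t - W r t) * (Winf t - W s t) =
     ((Winf t - W r t)\<^sup>2 + (Winf t - W s t)\<^sup>2 - (W s t - W r t)\<^sup>2) / 2" for t
    by (simp add: power2_eq_square algebra_simps)
  have d: "integrable P (\<lambda>t. (W s t - W r t)\<^sup>2)" "(\<integral>t. (W s t - W r t)\<^sup>2 \<partial>P) = v2 * (m2 ^ r - m2 ^ s)"
    using W_diff_square[of r "s - r"] assms by simp_all
  show "integrable P (\<lambda>t. (Winf t - W r t) * (Winf t - W s t))"
    unfolding eq by (simp add: Winf_diff_square d)
  show "(\<integral>t. (Winf t - W r t) * (Winf t - W s t) \<partial>P) = v2 * m2 ^ s"
    unfolding eq by (simp add: Winf_diff_square d) (simp add: algebra_simps)
qed

section \<open>Decomposition along the individuals of a generation\<close>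

lemma nn_integral_words_subtree:
  assumes [measurable]: "f \<in> borel_measurable tree_space"
  shows "(\<integral>\<^sup>+t. \<integral>\<^sup>+u. ennreal (weight u t ^ p) * f (subtree u t) \<partial>count_space (words n) \<partial>P) =
    (\<integral>\<^sup>+t. mass p n t \<partial>P) * (\<integral>\<^sup>+t. f t \<partial>P)"
proof -
  have "(\<integral>\<^sup>+t. \<integral>\<^sup>+u. ennreal (weight u t ^ p) * f (subtree u t) \<partial>count_space (words n) \<partial>P) =
    (\<integral>\<^sup>+u. \<integral>\<^sup>+t. ennreal (weight u t ^ p) * f (subtree u t) \<partial>P \<partial>count_space (words n))"
    by (rule nn_integral_count_space_swap) auto
  also have "\<dots> = (\<integral>\<^sup>+u. \<integral>\<^sup>+t. ennreal (weight u t ^ p) * (\<integral>\<^sup>+t. f t \<partial>P) \<partial>P \<partial>count_space (words n))"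
  proof (rule nn_integral_cong)
    fix u assume "u \<in> space (count_space (words n))"
    show "(\<integral>\<^sup>+t. ennreal (weight u t ^ p) * f (subtree u t) \<partial>P) = (\<integral>\<^sup>+t. ennreal (weight u t ^ p) * (\<integral>\<^sup>+t. f t \<partial>P) \<partial>P)"
      by (subst nn_integral_subtree[of "\<lambda>t s. ennreal (weight u t ^ p) * f s" u]) (auto simp: weight_prune nn_integral_cmult)
  qed
  also have "\<dots> = (\<integral>\<^sup>+t. \<integral>\<^sup>+u. ennreal (weight u t ^ p) * (\<integral>\<^sup>+t. f t \<partial>P) \<partial>count_space (words n) \<partial>P)"
    by (rule nn_integral_count_space_swap[symmetric]) auto
  finally show ?thesis by (simp add: nn_integral_multc mass_def[symmetric])
qed

text \<open>Fatou's lemma gives one inequality, and both sides have expectation \<open>1\<close>.\<close>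

lemma AE_Winf_branching_ennreal:
  "AE t in P. (\<integral>\<^sup>+u. ennreal (weight u t) * ennreal (Winf (subtree u t)) \<partial>count_space (words n)) = ennreal (Winf t)"
proof -
  define S where "S t = (\<integral>\<^sup>+u. ennreal (weight u t) * ennreal (Winf (subtree u t)) \<partial>count_space (words n))" for t
  have [measurable]: "S \<in> borel_measurable tree_space"
    unfolding S_def by (rule borel_measurable_nn_integral_count_space) auto
  have good: "AE t in P. \<forall>u\<in>words n. (\<lambda>k. W k (subtree u t)) \<longlonglongrightarrow> Winf (subtree u t) \<and>
      (\<forall>k. ennreal (W k (subtree u t)) = mass 1 k (subtree u t))"
  proof (subst AE_ball_countable)
    have "AE t in P. (\<lambda>k. W k t) \<longlonglongrightarrow> Winf t \<and> (\<forall>k. ennreal (W k t) = mass 1 k t)"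
      using AE_W_tendsto AE_ennreal_W by (auto simp: AE_all_countable)
    then show "\<forall>u\<in>words n. AE t in P. (\<lambda>k. W k (subtree u t)) \<longlonglongrightarrow> Winf (subtree u t) \<and>
      (\<forall>k. ennreal (W k (subtree u t)) = mass 1 k (subtree u t))"
      by (intro ballI AE_subtree)
  qed auto
  have le: "AE t in P. S t \<le> ennreal (Winf t)"
    using good AE_W_tendsto AE_ennreal_W_all
  proof eventually_elim
    case (elim t)
    have "S t = (\<integral>\<^sup>+u. liminf (\<lambda>k. ennreal (weight u t) * mass 1 k (subtree u t)) \<partial>count_space (words n))"
      unfolding S_def
    proof (intro nn_integral_cong)
      fix u assume "u \<in> space (count_space (words n))"
      then have u: "u \<in> words n" by simp
      have "(\<lambda>k. ennreal (weight u t * W k (subtree u t))) \<longlonglongrightarrow> ennreal (weight u t * Winf (subtree u t))"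
        using elim(1) u by (intro tendsto_intros) auto
      then have "(\<lambda>k. ennreal (weight u t) * mass 1 k (subtree u t)) \<longlonglongrightarrow> ennreal (weight u t) * ennreal (Winf (subtree u t))"
        using elim(1) u by (simp add: ennreal_mult')
      then show "ennreal (weight u t) * ennreal (Winf (subtree u t)) = liminf (\<lambda>k. ennreal (weight u t) * mass 1 k (subtree u t))"
        by (simp add: lim_imp_Liminf)
    qed
    also have "\<dots> \<le> liminf (\<lambda>k. \<integral>\<^sup>+u. ennreal (weight u t) * mass 1 k (subtree u t) \<partial>count_space (words n))"
      by (rule nn_integral_liminf) simp
    also have "\<dots> = liminf (\<lambda>k. ennreal (W (n + k) t))"
      using elim(3) mass_add[of 1 n _ t] by simp
    also have "\<dots> = ennreal (Winf t)"
    proof (rule lim_imp_Liminf)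
      have "(\<lambda>k. W (k + n) t) \<longlonglongrightarrow> Winf t" using elim(2) by (rule LIMSEQ_ignore_initial_segment)
      then show "(\<lambda>k. ennreal (W (n + k) t)) \<longlonglongrightarrow> ennreal (Winf t)"
        by (intro tendsto_intros) (simp add: add.commute)
    qed simp
    finally show ?case .
  qed
  have EW: "(\<integral>\<^sup>+t. ennreal (Winf t) \<partial>P) = 1"
    using nn_integral_eq_integral[OF integrable_Winf AE_Winf_nonneg] expectation_Winf by simp
  have ES: "(\<integral>\<^sup>+t. S t \<partial>P) = 1"
    using nn_integral_words_subtree[of "\<lambda>t. ennreal (Winf t)" n 1] nn_integral_mass_ennreal[OF _ mass1', of n]
    by (simp add: S_def EW)
  have "(\<integral>\<^sup>+t. ennreal (Winf t) - S t \<partial>P) = 0"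
    using le EW ES by (subst nn_integral_diff) auto
  then have "AE t in P. ennreal (Winf t) - S t = 0"
    by (subst (asm) nn_integral_0_iff_AE) auto
  then show ?thesis
    unfolding S_def[symmetric] using le by eventually_elim (auto intro!: antisym simp: diff_eq_0_iff_ennreal)
qed

text \<open>The identity is restated as a limit of finite sums, because the characteristic function
  is factorized over finitely many words at a time.\<close>

lemma AE_Winf_branching:
  "AE t in P. (\<lambda>N. \<Sum>u\<in>words_below N n. weight u t * Winf (subtree u t)) \<longlonglongrightarrow> Winf t"
proof -
  have "AE t in P. \<forall>u\<in>words n. 0 \<le> Winf (subtree u t)"
    by (subst AE_ball_countable) (auto intro!: AE_subtree AE_Winf_nonneg)
  with AE_Winf_nonneg AE_Winf_branching_ennreal[of n] show ?thesis
  proof eventually_elim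
    case (elim t)
    have n: "0 \<le> weight u t * Winf (subtree u t)" if "u \<in> words_below N n" for u N
      using elim(3) that words_below_subset by (intro mult_nonneg_nonneg) auto
    have "(\<lambda>N. ennreal (\<Sum>u\<in>words_below N n. weight u t * Winf (subtree u t))) \<longlonglongrightarrow> ennreal (Winf t)"
      using sum_words_below_tendsto[of "\<lambda>u. ennreal (weight u t) * ennreal (Winf (subtree u t))" n] elim(2) n
      by (simp add: ennreal_mult'[symmetric])
    then show ?case
      using elim(1) n by (subst (asm) tendsto_ennreal_iff) (auto intro!: sum_nonneg always_eventually)
  qed
qed

lemma AE_W_branching:
  "AE t in P. (\<lambda>N. \<Sum>u\<in>words_below N n. weight u t * W r (subtree u t)) \<longlonglongrightarrow> W (n + r) t"
proof -
  have "AE t in P. \<forall>u\<in>words n. ennreal (W r (subtree u t)) = mass 1 r (subtree u t)"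
    by (subst AE_ball_countable) (auto intro!: AE_subtree AE_ennreal_W)
  with AE_ennreal_W[of "n + r"] show ?thesis
  proof eventually_elim
    case (elim t)
    have "(\<Sum>u\<in>words_below N n. ennreal (weight u t) * mass 1 r (subtree u t)) =
       ennreal (\<Sum>u\<in>words_below N n. weight u t * W r (subtree u t))" for N
    proof -
      have "(\<Sum>u\<in>words_below N n. ennreal (weight u t) * mass 1 r (subtree u t)) =
         (\<Sum>u\<in>words_below N n. ennreal (weight u t * W r (subtree u t)))"
        using elim(2) words_below_subset[of N n] by (intro sum.cong) (auto simp: ennreal_mult)
      then show ?thesis by simp
    qed
    then have "(\<lambda>N. ennreal (\<Sum>u\<in>words_below N n. weight u t * W r (subtree u t))) \<longlonglongrightarrow> ennreal (W (n + r) t)"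
      using sum_words_below_tendsto[of "\<lambda>u. ennreal (weight u t) * mass 1 r (subtree u t)" n] mass_add[of 1 n r t] elim(1)
      by simp
    then show ?case
      by (subst (asm) tendsto_ennreal_iff) (auto intro!: sum_nonneg always_eventually)
  qed
qed

lemma AE_D_sum: "AE t in P. (\<lambda>N. \<Sum>u\<in>words_below N n. (weight u t)\<^sup>2 / m2 ^ n) \<longlonglongrightarrow> D n t"
  using AE_mass_finite[OF less_imp_le[OF m2(1)] mass2, of n]
proof eventually_elim
  case (elim t)
  have "(\<lambda>N. ennreal (\<Sum>u\<in>words_below N n. (weight u t)\<^sup>2)) \<longlonglongrightarrow> ennreal (enn2real (mass 2 n t))"
    using sum_words_below_tendsto[of "\<lambda>u. ennreal (weight u t ^ 2)" n] elim by (simp add: mass_def[symmetric] less_top)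
  then have "(\<lambda>N. \<Sum>u\<in>words_below N n. (weight u t)\<^sup>2) \<longlonglongrightarrow> enn2real (mass 2 n t)"
    by (subst (asm) tendsto_ennreal_iff) (auto intro!: sum_nonneg always_eventually)
  then show ?case
    unfolding D_def sum_divide_distrib[symmetric] by (intro tendsto_intros) (use m2 in auto)
qed

lemma D_moments: "integrable P (D n)" "(\<integral>t. D n t \<partial>P) = 1"
proof -
  have "(\<integral>\<^sup>+t. ennreal (D n t) \<partial>P) = (\<integral>\<^sup>+t. mass 2 n t * ennreal (1 / m2 ^ n) \<partial>P)"
    unfolding D_def by (rule nn_integral_cong_AE[OF AE_ennreal_normalized_mass[OF m2(1) mass2]])
  also have "\<dots> = 1"
    using m2 nn_integral_mass_ennreal[OF less_imp_le[OF m2(1)] mass2, of n]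
    by (simp add: nn_integral_multc ennreal_mult[symmetric])
  finally have nn: "(\<integral>\<^sup>+t. ennreal (D n t) \<partial>P) = 1" .
  then show "integrable P (D n)" by (intro integrableI_nonneg) auto
  show "(\<integral>t. D n t \<partial>P) = 1" using nn by (subst integral_eq_nn_integral) auto
qed

text \<open>Fatou's lemma gives only an inequality, since mass may be lost in the limit. It is
  enough to bound the second moments of the limit law.\<close>

lemma Dinf_moments: "integrable P Dinf" "(\<integral>t. Dinf t \<partial>P) \<le> 1"
proof -
  have "(\<integral>\<^sup>+t. ennreal (Dinf t) \<partial>P) = (\<integral>\<^sup>+t. liminf (\<lambda>n. ennreal (D n t)) \<partial>P)"
  proof (intro nn_integral_cong_AE)
    show "AE t in P. ennreal (Dinf t) = liminf (\<lambda>n. ennreal (D n t))"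
      using AE_D_tendsto by eventually_elim (auto intro!: lim_imp_Liminf[symmetric] tendsto_intros)
  qed
  also have "\<dots> \<le> liminf (\<lambda>n. \<integral>\<^sup>+t. ennreal (D n t) \<partial>P)"
    by (rule nn_integral_liminf) auto
  also have "\<dots> = 1"
    by (simp add: nn_integral_eq_integral D_moments Liminf_const)
  finally have le: "(\<integral>\<^sup>+t. ennreal (Dinf t) \<partial>P) \<le> 1" .
  then show int: "integrable P Dinf"
    using AE_Dinf_nonneg by (intro integrableI_nonneg) (auto intro: le_less_trans)
  show "(\<integral>t. Dinf t \<partial>P) \<le> 1"
    using le AE_Dinf_nonneg by (simp add: nn_integral_eq_integral[OF int])
qed

end

section \<open>Negligibility of individual weights\<close>

lemma tendsto_0_if_norm_le_add:
  assumes "\<And>d :: real. 0 < d \<Longrightarrow> \<exists>b. b \<longlonglongrightarrow> 0 \<and> (\<forall>n. norm (a n) \<le> d + b n)"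
  shows "a \<longlonglongrightarrow> 0"
proof (rule LIMSEQ_I)
  fix e :: real assume "0 < e"
  then obtain b where b: "b \<longlonglongrightarrow> 0" "\<And>n. norm (a n) \<le> e / 2 + b n"
    using assms[of "e / 2"] by auto
  then obtain N where N: "\<And>n. n \<ge> N \<Longrightarrow> b n < e / 2"
    using order_tendstoD(2)[OF b(1), of "e / 2"] \<open>0 < e\<close> unfolding eventually_sequentially by auto
  have "norm (a n - 0) < e" if "n \<ge> N" for n
    using b(2)[of n] N[OF that] by simp
  then show "\<exists>N. \<forall>n\<ge>N. norm (a n - 0) < e" by blast
qed

context biggins_tree begin

text \<open>Almost surely these sum to \<open>D n\<close> over the words of length n. Their total
  expectation is 1, so they are a probability density for picking a tree together with a
  word.\<close>

definition nweight :: "nat list \<Rightarrow> tree \<Rightarrow> real" where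
  "nweight u t = (weight u t)\<^sup>2 / m2 ^ length u"

lemma nweight_nonneg [simp]: "0 \<le> nweight u t"
  using m2 by (simp add: nweight_def)

lemma measurable_nweight [measurable]: "nweight u \<in> borel_measurable tree_space"
  unfolding nweight_def by measurable

lemma nweight_Nil [simp]: "nweight [] t = 1"
  by (simp add: nweight_def)

lemma nweight_append: "nweight (u @ v) t = nweight u t * nweight v (subtree u t)"
  by (simp add: nweight_def weight_append power_add power_mult_distrib)

lemma nweight_prune: "length u \<le> length v \<Longrightarrow> nweight u (prune v t) = nweight u t"
  by (simp add: nweight_def weight_prune)

lemma nn_integral_nweight: "(\<integral>\<^sup>+t. \<integral>\<^sup>+u. ennreal (nweight u t) \<partial>count_space (words n) \<partial>P) = 1"
proof -
  have "(\<integral>\<^sup>+u. ennreal (nweight u t) \<partial>count_space (words n)) = mass 2 n t * ennreal (1 / m2 ^ n)" for t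
    unfolding mass_def using m2
    by (subst nn_integral_multc[symmetric]) (auto intro!: nn_integral_cong simp: nweight_def ennreal_mult[symmetric])
  then show ?thesis
    using m2 nn_integral_mass_ennreal[OF less_imp_le[OF m2(1)] mass2, of n]
    by (simp add: nn_integral_multc ennreal_mult[symmetric])
qed

text \<open>The law of the logarithm of the weight of a word that is picked with probability
  proportional to its weight; by branching it is that of a random walk.\<close>

definition spine :: "nat \<Rightarrow> real measure" where
  "spine n = distr (density (P \<Otimes>\<^sub>M count_space (words n)) (\<lambda>(t, u). ennreal (nweight u t))) borel (\<lambda>(t, u). ln (nweight u t))"

lemma measurable_pair_words:
  assumes "\<And>u. f u \<in> measurable tree_space K"
  shows "(\<lambda>(t, u). f u t) \<in> measurable (P \<Otimes>\<^sub>M count_space (words n)) K"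
proof -
  have "(\<lambda>(u, t). f u t) \<in> measurable (count_space (words n) \<Otimes>\<^sub>M P) K"
    by (rule measurable_pair_measure_countable1) (use assms in \<open>auto simp: measurable_P\<close>)
  then show ?thesis
    by (subst measurable_pair_swap_iff) (simp add: case_prod_beta)
qed

lemma nn_integral_spine:
  assumes [measurable]: "g \<in> borel_measurable borel"
  shows "(\<integral>\<^sup>+x. g x \<partial>spine n) = (\<integral>\<^sup>+t. \<integral>\<^sup>+u. ennreal (nweight u t) * g (ln (nweight u t)) \<partial>count_space (words n) \<partial>P)"
proof -
  interpret C: sigma_finite_measure "count_space (words n)"
    by (rule sigma_finite_measure_count_space_countable) auto
  have [measurable]: "(\<lambda>(t, u). ln (nweight u t)) \<in> borel_measurable (P \<Otimes>\<^sub>M count_space (words n))"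
    by (rule measurable_pair_words[of "\<lambda>u t. ln (nweight u t)"]) simp
  have [measurable]: "(\<lambda>(t, u). ennreal (nweight u t)) \<in> borel_measurable (P \<Otimes>\<^sub>M count_space (words n))"
    by (rule measurable_pair_words[of "\<lambda>u t. ennreal (nweight u t)"]) simp
  have m: "(\<lambda>(t, u). ennreal (nweight u t) * g (ln (nweight u t))) \<in> borel_measurable (P \<Otimes>\<^sub>M count_space (words n))"
    by (rule measurable_pair_words[of "\<lambda>u t. ennreal (nweight u t) * g (ln (nweight u t))"]) simp
  have "(\<integral>\<^sup>+x. g x \<partial>spine n) = (\<integral>\<^sup>+q. (case q of (t, u) \<Rightarrow> ennreal (nweight u t) * g (ln (nweight u t))) \<partial>(P \<Otimes>\<^sub>M count_space (words n)))"
    unfolding spine_def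
    by (subst nn_integral_distr, simp, simp, subst nn_integral_density) (auto simp: case_prod_beta intro!: nn_integral_cong)
  also have "\<dots> = (\<integral>\<^sup>+t. \<integral>\<^sup>+u. ennreal (nweight u t) * g (ln (nweight u t)) \<partial>count_space (words n) \<partial>P)"
    using C.nn_integral_fst[OF m] by simp
  finally show ?thesis .
qed

lemma sets_spine [simp, measurable_cong]: "sets (spine n) = sets borel"
  and space_spine [simp]: "space (spine n) = UNIV"
  by (simp_all add: spine_def)

lemma real_distribution_spine: "real_distribution (spine n)"
proof -
  have "emeasure (spine n) (space (spine n)) = 1"
    using nn_integral_spine[of "\<lambda>_. 1" n] by (simp add: nn_integral_nweight)
  then show ?thesis
    by (intro real_distribution.intro prob_spaceI real_distribution_axioms.intro) auto
qed

text \<open>Many-to-one formula: the first letter of the picked word contributes a step with law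
  \<open>spine 1\<close>; the rest lives in the subtree at that letter, which is independent of the
  step. \<Phi> integrates over the rest with the step frozen.\<close>

lemma spine_Suc: "spine (Suc n) = (spine 1 \<star> spine n)"
proof (rule measure_eqI)
  fix A assume "A \<in> sets (spine (Suc n))"
  then have A [measurable]: "A \<in> sets borel" by simp
  interpret S1: real_distribution "spine 1" by (rule real_distribution_spine)
  interpret Sn: real_distribution "spine n" by (rule real_distribution_spine)
  define g :: "real \<Rightarrow> ennreal" where "g = indicator A"
  have [measurable]: "g \<in> borel_measurable borel" by (simp add: g_def)
  define \<Phi> where "\<Phi> x s = (\<integral>\<^sup>+v. ennreal (nweight v s) * g (x + ln (nweight v s)) \<partial>count_space (words n))" for x s
  have \<Phi>_meas [measurable]: "case_prod \<Phi> \<in> borel_measurable (borel \<Otimes>\<^sub>M tree_space)"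
    unfolding \<Phi>_def case_prod_beta by (rule borel_measurable_nn_integral_count_space) auto
  have \<Phi>_int: "(\<integral>\<^sup>+s. \<Phi> x s \<partial>P) = (\<integral>\<^sup>+y. g (x + y) \<partial>spine n)" for x
    unfolding \<Phi>_def by (subst nn_integral_spine) auto
  \<comment> \<open>The logarithm of a product splits only for positive factors; if one factor
    vanishes, both sides are 0, whatever the value of \<open>ln\<close> at 0.\<close>
  have term_eq: "ennreal (nweight (u @ v) t) * g (ln (nweight (u @ v) t)) =
     ennreal (nweight u t) * (ennreal (nweight v (subtree u t)) * g (ln (nweight u t) + ln (nweight v (subtree u t))))" for u v t
  proof (cases "nweight u t = 0 \<or> nweight v (subtree u t) = 0")
    case False
    then have "0 < nweight u t" "0 < nweight v (subtree u t)"
      using nweight_nonneg by (auto simp: less_le)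
    then show ?thesis by (simp add: nweight_append ln_mult ennreal_mult mult.assoc)
  qed (auto simp: nweight_append)
  have "(\<integral>\<^sup>+x. g x \<partial>spine (1 + n)) =
     (\<integral>\<^sup>+t. \<integral>\<^sup>+w. ennreal (nweight (take 1 w @ drop 1 w) t) * g (ln (nweight (take 1 w @ drop 1 w) t)) \<partial>count_space (words (1 + n)) \<partial>P)"
    by (simp add: nn_integral_spine)
  also have "\<dots> = (\<integral>\<^sup>+t. \<integral>\<^sup>+u. \<integral>\<^sup>+v. ennreal (nweight (u @ v) t) * g (ln (nweight (u @ v) t)) \<partial>count_space (words n) \<partial>count_space (words 1) \<partial>P)"
    by (intro nn_integral_cong nn_integral_words_append)
  also have "\<dots> = (\<integral>\<^sup>+t. \<integral>\<^sup>+u. ennreal (nweight u t) * \<Phi> (ln (nweight u t)) (subtree u t) \<partial>count_space (words 1) \<partial>P)"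
    unfolding term_eq \<Phi>_def by (simp add: nn_integral_cmult)
  also have "\<dots> = (\<integral>\<^sup>+u. \<integral>\<^sup>+t. ennreal (nweight u t) * \<Phi> (ln (nweight u t)) (subtree u t) \<partial>P \<partial>count_space (words 1))"
    by (rule nn_integral_count_space_swap) auto
  also have "\<dots> = (\<integral>\<^sup>+u. \<integral>\<^sup>+t. ennreal (nweight u t) * (\<integral>\<^sup>+y. g (ln (nweight u t) + y) \<partial>spine n) \<partial>P \<partial>count_space (words 1))"
  proof (rule nn_integral_cong)
    fix u :: "nat list"
    show "(\<integral>\<^sup>+t. ennreal (nweight u t) * \<Phi> (ln (nweight u t)) (subtree u t) \<partial>P) =
       (\<integral>\<^sup>+t. ennreal (nweight u t) * (\<integral>\<^sup>+y. g (ln (nweight u t) + y) \<partial>spine n) \<partial>P)"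
      by (subst nn_integral_subtree[of "\<lambda>t s. ennreal (nweight u t) * \<Phi> (ln (nweight u t)) s" u])
         (auto simp: nweight_prune nn_integral_cmult \<Phi>_int)
  qed
  also have "\<dots> = (\<integral>\<^sup>+t. \<integral>\<^sup>+u. ennreal (nweight u t) * (\<integral>\<^sup>+y. g (ln (nweight u t) + y) \<partial>spine n) \<partial>count_space (words 1) \<partial>P)"
    by (rule nn_integral_count_space_swap[symmetric]) auto
  also have "\<dots> = (\<integral>\<^sup>+x. \<integral>\<^sup>+y. g (x + y) \<partial>spine n \<partial>spine 1)"
    by (subst nn_integral_spine) auto
  also have "\<dots> = (\<integral>\<^sup>+x. g x \<partial>(spine 1 \<star> spine n))"
    by (rule nn_integral_convolution[symmetric]) (auto intro: S1.finite_measure Sn.finite_measure)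
  finally show "emeasure (spine (Suc n)) A = emeasure (spine 1 \<star> spine n) A"
    by (simp add: g_def plus_1_eq_Suc)
qed simp

lemma spine_eq_conv_power: "spine n = conv_power (spine 1) n"
proof (induction n)
  case 0
  have w: "words 0 = {[]}" by auto
  show ?case
  proof (rule measure_eqI)
    fix A assume "A \<in> sets (spine 0)"
    then have [measurable]: "A \<in> sets borel" by simp
    have "emeasure (spine 0) A = (\<integral>\<^sup>+x. indicator A x \<partial>spine 0)" by simp
    also have "\<dots> = indicator A 0"
      by (subst nn_integral_spine) (auto simp: w nn_integral_count_space_finite emeasure_space_1[simplified])
    finally show "emeasure (spine 0) A = emeasure (conv_power (spine 1) 0) A" by simp
  qed simp
qed (simp add: spine_Suc)

lemma sets_large_nweight: "{t. \<exists>u\<in>words n. e < nweight u t} \<in> sets P"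
proof -
  have "{t. e < nweight u t} \<in> sets P" for u
    using borel_measurable_less[of "\<lambda>_. e" P "nweight u"] by simp
  then have "(\<Union>u\<in>words n. {t. e < nweight u t}) \<in> sets P"
    by (intro sets.countable_UN') auto
  moreover have "{t. \<exists>u\<in>words n. e < nweight u t} = (\<Union>u\<in>words n. {t. e < nweight u t})" by auto
  ultimately show ?thesis by simp
qed

text \<open>If the step vanished, every nonzero weight of the first generation would equal sqrt m2.
  The sum of the squares would then be sqrt m2 times the sum of the weights, and expectations would
  give m2 = sqrt m2, impossible for 0 < m2 < 1.\<close>

lemma spine_not_AE_0: "\<not> (AE x in spine 1. x = 0)"
proof
  have [measurable]: "- {0::real} \<in> sets borel" by (intro borel_open) auto
  assume "AE x in spine 1. x = 0"
  then have "(\<integral>\<^sup>+x. indicator (- {0}) x \<partial>spine 1) = 0"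
    by (subst nn_integral_0_iff_AE) (auto intro!: borel_measurable_indicator)
  then have "(\<integral>\<^sup>+t. \<integral>\<^sup>+u. ennreal (nweight u t) * indicator (- {0}) (ln (nweight u t)) \<partial>count_space (words 1) \<partial>P) = 0"
    by (subst (asm) nn_integral_spine) auto
  then have "AE t in P. (\<integral>\<^sup>+u. ennreal (nweight u t) * indicator (- {0}) (ln (nweight u t)) \<partial>count_space (words 1)) = 0"
    by (subst (asm) nn_integral_0_iff_AE) (auto simp: measurable_P intro!: borel_measurable_nn_integral_count_space)
  then have "AE t in P. mass 2 1 t = ennreal (sqrt m2) * mass 1 1 t"
  proof eventually_elim
    case (elim t)
    then have z: "ennreal (nweight u t) * indicator (- {0}) (ln (nweight u t)) = 0" if "u \<in> words 1" for u
      using that by (subst (asm) nn_integral_0_iff_AE) (auto simp: AE_count_space)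
    have "(weight u t)\<^sup>2 = sqrt m2 * weight u t" if u: "u \<in> words 1" for u
    proof (cases "weight u t = 0")
      case False
      then have pos: "0 < nweight u t" using m2 by (simp add: nweight_def)
      then have "nweight u t = 1" using z[OF u] by (auto simp: indicator_def split: if_splits)
      then have "(weight u t)\<^sup>2 = m2" using u m2 by (simp add: nweight_def)
      then have "weight u t = sqrt m2" by (metis real_sqrt_unique weight_nonneg)
      then show ?thesis by (simp add: power2_eq_square)
    qed simp
    then have "mass 2 1 t = (\<integral>\<^sup>+u. ennreal (sqrt m2) * ennreal (weight u t) \<partial>count_space (words 1))"
      unfolding mass_def using m2 by (intro nn_integral_cong) (simp add: ennreal_mult[symmetric])
    then show ?case by (simp add: nn_integral_cmult mass_def)
  qed
  then have "(\<integral>\<^sup>+t. mass 2 1 t \<partial>P) = (\<integral>\<^sup>+t. ennreal (sqrt m2) * mass 1 1 t \<partial>P)"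
    by (rule nn_integral_cong_AE)
  then have "m2 = sqrt m2"
    using m2 by (simp add: nn_integral_cmult mass1 mass2)
  then have "m2 * m2 = m2" using m2 by (metis less_imp_le real_sqrt_mult_self abs_of_nonneg)
  then show False using m2 by simp
qed

text \<open>Weights above \<open>exp K\<close> are rare by Markov's inequality; those between \<open>e\<close> and \<open>exp K\<close> are counted
  by the mass that \<open>spine n\<close> gives to \<open>{- K..K}\<close>.\<close>

theorem max_nweight_tendsto_0:
  assumes e: "0 < e"
  shows "(\<lambda>n. prob {t. \<exists>u\<in>words n. e < nweight u t}) \<longlonglongrightarrow> 0"
proof (rule tendsto_0_if_norm_le_add)
  fix d :: real assume d: "0 < d"
  \<comment> \<open>Large enough that a weight above \<open>e\<close> has logarithm at least - K,
    and that the Markov term exp (- K) is at most d.\<close>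
  define K where "K = max \<bar>ln e\<bar> (- ln d)"
  have K: "exp (- K) \<le> d"
  proof -
    have "exp (- K) \<le> exp (ln d)" by (auto simp: K_def)
    then show ?thesis using d by simp
  qed
  have bound: "prob {t. \<exists>u\<in>words n. e < nweight u t} \<le> exp (- K) + 1 / e * measure (spine n) {- K..K}" for n
  proof -
    let ?A = "{t. \<exists>u\<in>words n. e < nweight u t}"
    interpret S: real_distribution "spine n" by (rule real_distribution_spine)
    have A: "?A \<in> sets P" by (rule sets_large_nweight)
    \<comment> \<open>Bounds on counting made linear in the weight: above exp K the count 1 is at
      most exp (- K) * x, and between e and exp K it is at most x / e.\<close>
    have pt: "indicator {e<..} x \<le> ennreal (exp (- K)) * ennreal x + ennreal (1 / e) * (ennreal x * indicator {- K..K} (ln x))"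
      if "0 \<le> x" for x
    proof (cases "e < x")
      case ex: True
      then have x: "0 < x" using e by simp
      have ind: "indicator {e<..} x = (1::ennreal)" using ex by simp
      show ?thesis
      proof (cases "ln x \<le> K")
        case True
        have "ln e \<le> ln x" using \<open>e < x\<close> e x by simp
        then have in_K: "ln x \<in> {- K..K}" using True by (auto simp: K_def)
        have "1 \<le> 1 / e * x" using \<open>e < x\<close> e by (simp add: field_simps)
        then have "1 \<le> ennreal (1 / e) * ennreal x" using e x by (simp add: ennreal_mult[symmetric])
        then show ?thesis unfolding ind using in_K by (intro add_increasing) auto
      next
        case False
        then have "exp K < x" using x by (metis exp_ln exp_less_mono not_le)
        then have "1 \<le> exp (- K) * x" by (simp add: exp_minus field_simps)
        then have "1 \<le> ennreal (exp (- K)) * ennreal x" using x by (simp add: ennreal_mult[symmetric])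
        then show ?thesis unfolding ind by (intro add_increasing2) auto
      qed
    qed auto
    have "emeasure P ?A = (\<integral>\<^sup>+t. indicator ?A t \<partial>P)" using A by simp
    also have "\<dots> \<le> (\<integral>\<^sup>+t. \<integral>\<^sup>+u. indicator {e<..} (nweight u t) \<partial>count_space (words n) \<partial>P)"
    proof (rule nn_integral_mono)
      fix t
      show "indicator ?A t \<le> (\<integral>\<^sup>+u. indicator {e<..} (nweight u t) \<partial>count_space (words n) :: ennreal)"
      proof (cases "t \<in> ?A")
        case True
        then obtain u where "u \<in> words n" "e < nweight u t" by auto
        then show ?thesis
          using nn_integral_ge_point[of u "words n" "\<lambda>u. indicator {e<..} (nweight u t)"] True by simp
      qed simp
    qed
    also have "\<dots> \<le> (\<integral>\<^sup>+t. \<integral>\<^sup>+u. ennreal (exp (- K)) * ennreal (nweight u t) +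
        ennreal (1 / e) * (ennreal (nweight u t) * indicator {- K..K} (ln (nweight u t))) \<partial>count_space (words n) \<partial>P)"
      by (intro nn_integral_mono pt) simp
    also have "\<dots> = (\<integral>\<^sup>+t. ennreal (exp (- K)) * (\<integral>\<^sup>+u. ennreal (nweight u t) \<partial>count_space (words n)) +
        ennreal (1 / e) * (\<integral>\<^sup>+u. ennreal (nweight u t) * indicator {- K..K} (ln (nweight u t)) \<partial>count_space (words n)) \<partial>P)"
      by (simp add: nn_integral_add nn_integral_cmult)
    also have "\<dots> = ennreal (exp (- K)) + ennreal (1 / e) * emeasure (spine n) {- K..K}"
    proof -
      have [measurable]: "(\<lambda>t. \<integral>\<^sup>+u. ennreal (nweight u t) \<partial>count_space (words n)) \<in> borel_measurable P"
        "(\<lambda>t. \<integral>\<^sup>+u. ennreal (nweight u t) * indicator {- K..K} (ln (nweight u t)) \<partial>count_space (words n)) \<in> borel_measurable P"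
        by (auto simp: measurable_P intro!: borel_measurable_nn_integral_count_space)
      have "emeasure (spine n) {- K..K} = (\<integral>\<^sup>+x. indicator {- K..K} x \<partial>spine n)" by simp
      also have "\<dots> = (\<integral>\<^sup>+t. \<integral>\<^sup>+u. ennreal (nweight u t) * indicator {- K..K} (ln (nweight u t)) \<partial>count_space (words n) \<partial>P)"
        by (rule nn_integral_spine) simp
      finally show ?thesis
        by (simp add: nn_integral_add nn_integral_cmult nn_integral_nweight)
    qed
    finally have "ennreal (prob ?A) \<le> ennreal (exp (- K)) + ennreal (1 / e) * ennreal (measure (spine n) {- K..K})"
      by (simp add: emeasure_eq_measure S.emeasure_eq_measure)
    also have "\<dots> = ennreal (exp (- K) + 1 / e * measure (spine n) {- K..K})"
      using e by (simp add: ennreal_mult[symmetric] ennreal_plus[symmetric] del: ennreal_plus)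
    finally show ?thesis
      using e by (subst (asm) ennreal_le_iff) auto
  qed
  have "(\<lambda>n. measure (spine n) {- K..K}) \<longlonglongrightarrow> 0"
    using conv_power_compact_tendsto_0[OF real_distribution_spine spine_not_AE_0, of K]
    by (simp only: spine_eq_conv_power[symmetric])
  then have "(\<lambda>n. 1 / e * measure (spine n) {- K..K}) \<longlonglongrightarrow> 1 / e * 0"
    by (intro tendsto_intros)
  then have "(\<lambda>n. 1 / e * measure (spine n) {- K..K}) \<longlonglongrightarrow> 0"
    unfolding mult_zero_right .
  moreover have "norm (prob {t. \<exists>u\<in>words n. e < nweight u t}) \<le> d + 1 / e * measure (spine n) {- K..K}" for n
    unfolding real_norm_def abs_of_nonneg[OF measure_nonneg] using bound[of n] K by linarith
  ultimately show "\<exists>b. b \<longlonglongrightarrow> 0 \<and> (\<forall>n. norm (prob {t. \<exists>u\<in>words n. e < nweight u t}) \<le> d + b n)"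
    by blast
qed

end

section \<open>A stationary Gaussian sequence\<close>

text \<open>The coefficient of the j-th noise variable in the autoregression U_0 = \<xi>_0, U_{r+1}
  = \<rho> U_r + sqrt (1 - \<rho>^2) \<xi>_{r+1}, solved explicitly. The innovation is scaled so
  that the variance stays equal to 1.\<close>

definition ar1_coeff :: "real \<Rightarrow> nat \<Rightarrow> nat \<Rightarrow> real" where
  "ar1_coeff \<rho> r j = (if j = 0 then \<rho> ^ r else if j \<le> r then sqrt (1 - \<rho>\<^sup>2) * \<rho> ^ (r - j) else 0)"

lemma ar1_coeff_add: "j \<le> r \<Longrightarrow> ar1_coeff \<rho> (r + d) j = \<rho> ^ d * ar1_coeff \<rho> r j"
  by (auto simp: ar1_coeff_def power_add[symmetric] add.commute)

lemma ar1_coeff_eq_0: "r < j \<Longrightarrow> ar1_coeff \<rho> r j = 0"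
  by (simp add: ar1_coeff_def)

lemma sum_ar1_coeff_square:
  assumes "\<bar>\<rho>\<bar> \<le> 1"
  shows "(\<Sum>j\<le>r. (ar1_coeff \<rho> r j)\<^sup>2) = 1"
proof (induction r)
  case (Suc r)
  have "(\<Sum>j\<le>Suc r. (ar1_coeff \<rho> (Suc r) j)\<^sup>2) = (\<Sum>j\<le>r. \<rho>\<^sup>2 * (ar1_coeff \<rho> r j)\<^sup>2) + (ar1_coeff \<rho> (Suc r) (Suc r))\<^sup>2"
    using ar1_coeff_add[of _ r \<rho> 1] by (simp add: power_mult_distrib)
  also have "(ar1_coeff \<rho> (Suc r) (Suc r))\<^sup>2 = 1 - \<rho>\<^sup>2"
    using assms by (simp add: ar1_coeff_def abs_square_le_1)
  also have "(\<Sum>j\<le>r. \<rho>\<^sup>2 * (ar1_coeff \<rho> r j)\<^sup>2) = \<rho>\<^sup>2"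
    by (simp add: sum_distrib_left[symmetric] Suc)
  finally show ?case by simp
qed (simp add: ar1_coeff_def)

text \<open>On the noise variables up to time r, the coefficients at time s are \<rho>^(s-r) times
  those at time r, and the latter have unit square sum; the later noise does not enter U_r.\<close>

lemma sum_ar1_coeff_mult:
  assumes "\<bar>\<rho>\<bar> \<le> 1" "r \<le> s" "s < m"
  shows "(\<Sum>j<m. ar1_coeff \<rho> r j * ar1_coeff \<rho> s j) = \<rho> ^ (s - r)"
proof -
  have "(\<Sum>j<m. ar1_coeff \<rho> r j * ar1_coeff \<rho> s j) = (\<Sum>j\<le>r. ar1_coeff \<rho> r j * ar1_coeff \<rho> s j)"
    using assms by (intro sum.mono_neutral_right) (auto simp: ar1_coeff_eq_0)
  also have "\<dots> = (\<Sum>j\<le>r. \<rho> ^ (s - r) * (ar1_coeff \<rho> r j)\<^sup>2)"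
    using ar1_coeff_add[of _ r \<rho> "s - r"] assms(2) by (intro sum.cong) (auto simp: power2_eq_square)
  also have "\<dots> = \<rho> ^ (s - r)"
    by (simp add: sum_distrib_left[symmetric] sum_ar1_coeff_square[OF assms(1)])
  finally show ?thesis .
qed

lemma powr_half_abs_diff:
  fixes m :: real
  assumes "0 < m" "r \<le> s"
  shows "m powr (\<bar>real r - real s\<bar> / 2) = sqrt m ^ (s - r)" "m powr (\<bar>real s - real r\<bar> / 2) = sqrt m ^ (s - r)"
proof -
  have "\<bar>real r - real s\<bar> / 2 = (1/2) * real (s - r)" "\<bar>real s - real r\<bar> / 2 = (1/2) * real (s - r)"
    using assms(2) by auto
  then show "m powr (\<bar>real r - real s\<bar> / 2) = sqrt m ^ (s - r)" "m powr (\<bar>real s - real r\<bar> / 2) = sqrt m ^ (s - r)"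
    using assms(1) by (simp_all only: powr_powr[symmetric] powr_half_sqrt[OF less_imp_le] powr_realpow real_sqrt_gt_0_iff)
qed

lemma sum_ar1_coeff_cov:
  assumes "0 < m" "m \<le> 1" "r < k" "s < k"
  shows "(\<Sum>j<k. ar1_coeff (sqrt m) r j * ar1_coeff (sqrt m) s j) = m powr (\<bar>real r - real s\<bar> / 2)"
proof -
  have 1: "\<bar>sqrt m\<bar> \<le> 1" using assms by simp
  show ?thesis
  proof (cases "r \<le> s")
    case True
    then show ?thesis using sum_ar1_coeff_mult[OF 1 True assms(4)] powr_half_abs_diff[OF assms(1) True] by simp
  next
    case False
    then have "s \<le> r" by simp
    then show ?thesis using sum_ar1_coeff_mult[OF 1 \<open>s \<le> r\<close> assms(3)] powr_half_abs_diff[OF assms(1) \<open>s \<le> r\<close>]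
      by (simp add: mult.commute)
  qed
qed

section \<open>Gaussian laws obtained linearly from white noise\<close>

abbreviation white_noise :: "(nat \<Rightarrow> real) measure" where
  "white_noise \<equiv> (\<Pi>\<^sub>M j\<in>UNIV. std_normal_distribution)"

interpretation std_normal: real_distribution std_normal_distribution
  by (rule real_dist_normal_dist)

interpretation white_noise: product_prob_space "\<lambda>_ :: nat. std_normal_distribution" UNIV
  by unfold_locales

interpretation white_noise: prob_space white_noise
  by (rule prob_space_PiM) (rule std_normal.prob_space_axioms)

lemma distr_white_noise_coordinate: "distr white_noise borel (\<lambda>\<xi>. \<xi> j) = std_normal_distribution"
proof -
  have "distr white_noise borel (\<lambda>\<xi>. \<xi> j) = distr white_noise std_normal_distribution (\<lambda>\<xi>. \<xi> j)"
    by (intro distr_cong) auto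
  then show ?thesis by (simp add: white_noise.PiM_component)
qed

lemma measurable_white_noise_coordinate [measurable]: "(\<lambda>\<xi>. \<xi> j) \<in> borel_measurable white_noise"
  using measurable_component_singleton[of j UNIV "\<lambda>_. std_normal_distribution"] by simp

lemma indep_vars_white_noise: "white_noise.indep_vars (\<lambda>_. borel) (\<lambda>j \<xi>. \<xi> j) UNIV"
proof (subst white_noise.indep_vars_iff_distr_eq_PiM)
  have s: "sets (\<Pi>\<^sub>M j\<in>UNIV. borel) = sets white_noise" by (intro sets_PiM_cong) auto
  have "distr white_noise (\<Pi>\<^sub>M i\<in>UNIV. borel) (\<lambda>x. \<lambda>i\<in>UNIV. x i) = distr white_noise white_noise (\<lambda>x. x)"
    by (intro distr_cong s) auto
  then show "distr white_noise (\<Pi>\<^sub>M i\<in>UNIV. borel) (\<lambda>x. \<lambda>i\<in>UNIV. x i) =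
      (\<Pi>\<^sub>M i\<in>UNIV. distr white_noise borel (\<lambda>\<xi>. \<xi> i))"
    by (simp add: distr_white_noise_coordinate distr_id2)
qed auto

lemma indep_vars_white_noise_scaled: "white_noise.indep_vars (\<lambda>_. borel) (\<lambda>j \<xi>. b j * \<xi> j) I"
proof -
  have "white_noise.indep_vars (\<lambda>_. borel) (\<lambda>j \<xi>. b j * \<xi> j) UNIV"
    using white_noise.indep_vars_compose2[OF indep_vars_white_noise, of "\<lambda>j x. b j * x" "\<lambda>_. borel"] by simp
  then show ?thesis by (rule white_noise.indep_vars_subset) auto
qed

lemma white_noise_cis:
  "(\<integral>\<xi>. cis (\<Sum>j<k. b j * \<xi> j) \<partial>white_noise) = of_real (exp (- (\<Sum>j<k. (b j)\<^sup>2) / 2))"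
proof -
  have "(\<integral>\<xi>. cis (\<Sum>j<k. b j * \<xi> j) \<partial>white_noise) = char (distr white_noise borel (\<lambda>\<xi>. \<Sum>j<k. b j * \<xi> j)) 1"
    unfolding char_def by (subst integral_distr) (auto simp: cis_conv_exp)
  also have "\<dots> = (\<Prod>j<k. char (distr white_noise borel (\<lambda>\<xi>. b j * \<xi> j)) 1)"
    by (rule white_noise.char_distr_sum[OF indep_vars_white_noise_scaled])
  also have "\<dots> = (\<Prod>j<k. of_real (exp (- (b j)\<^sup>2 / 2)))"
  proof (rule prod.cong)
    fix j
    have "char (distr white_noise borel (\<lambda>\<xi>. b j * \<xi> j)) 1 = char (distr white_noise borel (\<lambda>\<xi>. \<xi> j)) (b j)"
      unfolding char_def by (subst (1 2) integral_distr) auto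
    then show "char (distr white_noise borel (\<lambda>\<xi>. b j * \<xi> j)) 1 = of_real (exp (- (b j)\<^sup>2 / 2))"
      by (simp add: distr_white_noise_coordinate char_std_normal_distribution)
  qed simp
  also have "\<dots> = of_real (exp (- (\<Sum>j<k. (b j)\<^sup>2) / 2))"
    by (simp add: exp_sum[symmetric] sum_negf sum_divide_distrib flip: of_real_prod)
  finally show ?thesis .
qed

lemma white_noise_gaussian: "gaussian_variable white_noise (\<lambda>\<xi>. \<Sum>j<k. b j * \<xi> j)"
proof (cases "\<exists>j<k. b j \<noteq> 0")
  case False
  then show ?thesis by (auto simp: gaussian_variable_def intro!: exI[of _ 0])
next
  case True
  \<comment> \<open>Only nonzero multiples of a normal variable have a normal density, so the zero
    coefficients are dropped before the independent variables are summed.\<close>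
  define I where "I = {j. j < k \<and> b j \<noteq> 0}"
  have I: "finite I" "I \<noteq> {}" using True by (auto simp: I_def)
  have eq: "(\<lambda>\<xi>. \<Sum>j<k. b j * \<xi> j) = (\<lambda>\<xi> :: nat \<Rightarrow> real. \<Sum>j\<in>I. b j * \<xi> j)"
    by (intro ext sum.mono_neutral_right) (auto simp: I_def)
  have "distributed white_noise lborel (\<lambda>\<xi>. \<xi> j) (normal_density 0 1)" for j
    unfolding distributed_def
  proof (intro conjI)
    have "distr white_noise lborel (\<lambda>\<xi>. \<xi> j) = distr white_noise borel (\<lambda>\<xi>. \<xi> j)"
      by (intro distr_cong) auto
    then show "distr white_noise lborel (\<lambda>\<xi>. \<xi> j) = density lborel (\<lambda>x. ennreal (normal_density 0 1 x))"
      by (simp add: distr_white_noise_coordinate)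
  qed auto
  then have "distributed white_noise lborel (\<lambda>\<xi>. b j * \<xi> j) (normal_density 0 \<bar>b j\<bar>)" if "j \<in> I" for j
    using white_noise.normal_density_affine[of "\<lambda>\<xi>. \<xi> j" 0 1 "b j" 0] that by (auto simp: I_def)
  then have "distributed white_noise lborel (\<lambda>\<xi>. \<Sum>j\<in>I. b j * \<xi> j)
      (normal_density (\<Sum>j\<in>I. 0) (sqrt (\<Sum>j\<in>I. \<bar>b j\<bar>\<^sup>2)))"
    by (intro white_noise.sum_indep_normal I indep_vars_white_noise_scaled) (auto simp: I_def)
  moreover have "sqrt (\<Sum>j\<in>I. \<bar>b j\<bar>\<^sup>2) > 0"
    using I by (auto intro!: sum_pos simp: I_def)
  ultimately show ?thesis unfolding gaussian_variable_def eq by auto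
qed

lemma white_noise_moments:
  "integrable white_noise (\<lambda>\<xi>. \<xi> j)" "(\<integral>\<xi>. \<xi> j \<partial>white_noise) = 0"
  "integrable white_noise (\<lambda>\<xi>. \<xi> i * \<xi> j)" "(\<integral>\<xi>. \<xi> i * \<xi> j \<partial>white_noise) = (if i = j then 1 else 0)"
proof -
  have m: "integrable white_noise (\<lambda>\<xi>. \<xi> j ^ k)" "(\<integral>\<xi>. \<xi> j ^ k \<partial>white_noise) = (\<integral>x. x ^ k \<partial>std_normal_distribution)" for j k
  proof -
    have "integrable (distr white_noise borel (\<lambda>\<xi>. \<xi> j)) (\<lambda>x. x ^ k)"
      unfolding distr_white_noise_coordinate by (rule integrable_std_normal_distribution_moment)
    then show "integrable white_noise (\<lambda>\<xi>. \<xi> j ^ k)" by (subst (asm) integrable_distr_eq) auto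
    show "(\<integral>\<xi>. \<xi> j ^ k \<partial>white_noise) = (\<integral>x. x ^ k \<partial>std_normal_distribution)"
      by (subst distr_white_noise_coordinate[of j, symmetric], subst integral_distr) auto
  qed
  have 1: "integrable white_noise (\<lambda>\<xi>. \<xi> j)" "(\<integral>\<xi>. \<xi> j \<partial>white_noise) = 0" for j
    using m[of j 1] integral_std_normal_distribution_moment_odd[of 1] by auto
  then show "integrable white_noise (\<lambda>\<xi>. \<xi> j)" "(\<integral>\<xi>. \<xi> j \<partial>white_noise) = 0"
    by blast+
  have "integrable white_noise (\<lambda>\<xi>. \<xi> i * \<xi> j) \<and> (\<integral>\<xi>. \<xi> i * \<xi> j \<partial>white_noise) = (if i = j then 1 else 0)"
  proof (cases "i = j")
    case True
    then show ?thesis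
      using m[of j 2] std_normal_distribution_even_moments(1)[of 1] by (simp add: power2_eq_square)
  next
    case False
    have ind: "white_noise.indep_vars (\<lambda>_. borel) (\<lambda>j \<xi>. \<xi> j) {i, j}"
      by (rule white_noise.indep_vars_subset[OF indep_vars_white_noise subset_UNIV])
    show ?thesis
      using white_noise.indep_vars_integrable[OF _ ind 1(1)] white_noise.indep_vars_lebesgue_integral[OF _ ind 1(1)] False
      by (simp add: 1(2))
  qed
  then show "integrable white_noise (\<lambda>\<xi>. \<xi> i * \<xi> j)" "(\<integral>\<xi>. \<xi> i * \<xi> j \<partial>white_noise) = (if i = j then 1 else 0)"
    by blast+
qed

definition ar1 :: "real \<Rightarrow> (nat \<Rightarrow> real) \<Rightarrow> nat \<Rightarrow> real" where
  "ar1 \<rho> \<xi> r = (\<Sum>j\<le>r. ar1_coeff \<rho> r j * \<xi> j)"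

lemma ar1_eq: "r < k \<Longrightarrow> ar1 \<rho> \<xi> r = (\<Sum>j<k. ar1_coeff \<rho> r j * \<xi> j)"
  unfolding ar1_def by (intro sum.mono_neutral_left) (auto simp: ar1_coeff_eq_0)

lemma ar1_combination: "(\<Sum>r<k. a r * ar1 \<rho> \<xi> r) = (\<Sum>j<k. (\<Sum>r<k. a r * ar1_coeff \<rho> r j) * \<xi> j)"
proof -
  have "(\<Sum>r<k. a r * ar1 \<rho> \<xi> r) = (\<Sum>r<k. \<Sum>j<k. a r * ar1_coeff \<rho> r j * \<xi> j)"
    by (intro sum.cong) (auto simp: ar1_eq[of _ k] sum_distrib_left mult.assoc)
  also have "\<dots> = (\<Sum>j<k. (\<Sum>r<k. a r * ar1_coeff \<rho> r j) * \<xi> j)"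
    by (subst sum.swap) (simp add: sum_distrib_right)
  finally show ?thesis .
qed

definition cov_form :: "real \<Rightarrow> nat \<Rightarrow> (nat \<Rightarrow> real) \<Rightarrow> real" where
  "cov_form m k a = (\<Sum>r<k. \<Sum>s<k. a r * a s * m powr (\<bar>real r - real s\<bar> / 2))"

lemma cov_form_eq_sum_squares:
  assumes "0 < m" "m \<le> 1"
  shows "(\<Sum>j<k. (\<Sum>r<k. a r * ar1_coeff (sqrt m) r j)\<^sup>2) = cov_form m k a"
proof -
  have "(\<Sum>j<k. (\<Sum>r<k. a r * ar1_coeff (sqrt m) r j)\<^sup>2) =
      (\<Sum>j<k. \<Sum>r<k. \<Sum>s<k. a r * a s * (ar1_coeff (sqrt m) r j * ar1_coeff (sqrt m) s j))"
    by (simp add: power2_eq_square sum_product mult_ac)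
  also have "\<dots> = (\<Sum>r<k. \<Sum>s<k. \<Sum>j<k. a r * a s * (ar1_coeff (sqrt m) r j * ar1_coeff (sqrt m) s j))"
    by (rule trans[OF sum.swap], rule sum.cong[OF refl], rule sum.swap)
  also have "\<dots> = cov_form m k a"
    unfolding cov_form_def sum_distrib_left[symmetric]
    by (intro sum.cong refl) (simp add: sum_ar1_coeff_cov[OF assms])
  finally show ?thesis .
qed

text \<open>The autoregression parameter is sqrt m because the target covariance m^(|r-s|/2) is the
  |r-s|-th power of sqrt m.\<close>

definition ar1_law :: "real \<Rightarrow> (nat \<Rightarrow> real) measure" where
  "ar1_law m = distr white_noise borel (ar1 (sqrt m))"

lemma measurable_ar1 [measurable]: "ar1 \<rho> \<in> borel_measurable white_noise"
  by (rule measurable_coordinatewise_then_product) (simp add: ar1_def)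

lemma prob_space_ar1_law: "prob_space (ar1_law m)"
  unfolding ar1_law_def by (rule white_noise.prob_space_distr) simp

lemma sets_ar1_law [simp, measurable_cong]: "sets (ar1_law m) = sets borel"
  by (simp add: ar1_law_def)

lemma space_ar1_law [simp]: "space (ar1_law m) = UNIV"
  by (simp add: ar1_law_def)

lemma ar1_law_cis:
  assumes "0 < m" "m \<le> 1"
  shows "(\<integral>x. cis (\<Sum>r<k. a r * x r) \<partial>ar1_law m) = of_real (exp (- cov_form m k a / 2))"
proof -
  have "(\<integral>x. cis (\<Sum>r<k. a r * x r) \<partial>ar1_law m) = (\<integral>\<xi>. cis (\<Sum>r<k. a r * ar1 (sqrt m) \<xi> r) \<partial>white_noise)"
    unfolding ar1_law_def by (subst integral_distr) (auto simp: cis_conv_exp)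
  then show ?thesis
    unfolding ar1_combination white_noise_cis cov_form_eq_sum_squares[OF assms] .
qed

lemma gaussian_variable_distr:
  assumes [measurable]: "g \<in> measurable M N" and f: "f \<in> borel_measurable N"
    and "gaussian_variable M (\<lambda>x. f (g x))"
  shows "gaussian_variable (distr M N g) f"
proof -
  have [measurable]: "f \<in> borel_measurable N" by fact
  have 1: "distributed M lborel (\<lambda>x. f (g x)) h \<Longrightarrow> distributed (distr M N g) lborel f h" for h :: "real \<Rightarrow> ennreal"
    by (auto simp: distributed_def distr_distr o_def)
  have 2: "AE x in M. f (g x) = c \<Longrightarrow> AE x in distr M N g. f x = c" for c
    by (subst AE_distr_iff) auto
  show ?thesis
    using assms(3) unfolding gaussian_variable_def measurable_distr_eq1 by (blast intro: 1 2 f)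
qed

lemma gaussian_sequence_ar1_law: "gaussian_variable (ar1_law m) (\<lambda>x. \<Sum>r<k. a r * x r)"
  unfolding ar1_law_def by (rule gaussian_variable_distr) (auto simp: ar1_combination white_noise_gaussian)

lemma ar1_law_moments:
  assumes "0 < m" "m \<le> 1"
  shows "integrable (ar1_law m) (\<lambda>x. x r)" "(\<integral>x. x r \<partial>ar1_law m) = 0"
    "integrable (ar1_law m) (\<lambda>x. x r * x s)" "(\<integral>x. x r * x s \<partial>ar1_law m) = m powr (\<bar>real r - real s\<bar> / 2)"
proof -
  define k where "k = Suc (max r s)"
  have k: "r < k" "s < k" by (auto simp: k_def)
  let ?b = "ar1_coeff (sqrt m)"
  show "integrable (ar1_law m) (\<lambda>x. x r)" "(\<integral>x. x r \<partial>ar1_law m) = 0"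
    unfolding ar1_law_def
    by (auto simp: integrable_distr_eq integral_distr ar1_def white_noise_moments)
  have eq: "ar1 (sqrt m) \<xi> r * ar1 (sqrt m) \<xi> s = (\<Sum>i<k. \<Sum>j<k. ?b r i * ?b s j * (\<xi> i * \<xi> j))" for \<xi>
    unfolding ar1_eq[OF k(1)] ar1_eq[OF k(2)] sum_product by (simp add: mult_ac)
  show "integrable (ar1_law m) (\<lambda>x. x r * x s)"
    unfolding ar1_law_def by (subst integrable_distr_eq) (auto simp: eq white_noise_moments)
  have "(\<integral>x. x r * x s \<partial>ar1_law m) = (\<integral>\<xi>. (\<Sum>i<k. \<Sum>j<k. ?b r i * ?b s j * (\<xi> i * \<xi> j)) \<partial>white_noise)"
    unfolding ar1_law_def by (subst integral_distr) (auto simp: eq)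
  also have "\<dots> = (\<Sum>i<k. ?b r i * ?b s i)"
    by (simp add: white_noise_moments if_distrib[of "\<lambda>z. _ * z"] cong: if_cong)
  also have "\<dots> = m powr (\<bar>real r - real s\<bar> / 2)"
    by (rule sum_ar1_coeff_cov[OF assms k])
  finally show "(\<integral>x. x r * x s \<partial>ar1_law m) = m powr (\<bar>real r - real s\<bar> / 2)" .
qed

lemma measurable_shift: "(\<lambda>x r. x (r + h)) \<in> borel_measurable (borel :: (nat \<Rightarrow> real) measure)"
  by (rule measurable_coordinatewise_then_product) simp

text \<open>Uniqueness of a law with given characteristic functions comes from the weak convergence
  criterion, applied to a constant sequence: the shifted law converges weakly to the original one,
  so both integrate bounded continuous functions equally. The characteristic functions agree because
  the covariance depends on r - s only.\<close>

lemma ar1_law_stationary: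
  assumes "0 < m" "m \<le> 1"
  shows "distr (ar1_law m) borel (\<lambda>x r. x (r + h)) = ar1_law m"
proof -
  note measurable_shift [measurable]
  let ?S = "distr (ar1_law m) borel (\<lambda>x r. x (r + h))"
  interpret prob_space "ar1_law m" by (rule prob_space_ar1_law)
  have p: "prob_space ?S" by (rule prob_space_distr) simp
  have cis: "(\<integral>x. cis (\<Sum>r<k. a r * x r) \<partial>?S) = of_real (exp (- cov_form m k a / 2))" for k a
  proof -
    \<comment> \<open>A combination of the shifted coordinates is a combination of the original ones
      whose first h coefficients are 0.\<close>
    define b where "b r = (if r < h then 0 else a (r - h))" for r
    have shift: "(\<Sum>r<k. f (r + h)) = (\<Sum>r<k+h. if r < h then 0 else f r)" for f :: "nat \<Rightarrow> real"
    proof -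
      have "(\<Sum>r<k+h. if r < h then 0 else f r) = (\<Sum>r\<in>{h..<k+h}. f r)"
        by (intro sum.mono_neutral_cong_right) auto
      also have "\<dots> = (\<Sum>r<k. f (r + h))"
        using sum.shift_bounds_nat_ivl[of f 0 h k] by (simp add: atLeast0LessThan)
      finally show ?thesis ..
    qed
    have "(\<Sum>r<k. a r * x (r + h)) = (\<Sum>r<k+h. b r * x r)" for x
      using shift[of "\<lambda>r. b r * x r"] by (simp add: b_def if_distrib[of "\<lambda>z. z * _"] cong: if_cong)
    then have "(\<integral>x. cis (\<Sum>r<k. a r * x r) \<partial>?S) = (\<integral>x. cis (\<Sum>r<k+h. b r * x r) \<partial>ar1_law m)"
      by (subst integral_distr) (auto simp: cis_conv_exp simp del: of_real_sum)
    also have "\<dots> = of_real (exp (- cov_form m (k + h) b / 2))"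
      by (rule ar1_law_cis[OF assms])
    also have "cov_form m (k + h) b = cov_form m k a"
    proof -
      have "cov_form m (k + h) b = (\<Sum>r<k+h. if r < h then 0 else (\<Sum>s<k+h. if s < h then 0 else b r * b s * m powr (\<bar>real r - real s\<bar> / 2)))"
        unfolding cov_form_def by (intro sum.cong refl) (auto simp: b_def intro!: sum.cong)
      also have "\<dots> = (\<Sum>r<k. \<Sum>s<k. b (r + h) * b (s + h) * m powr (\<bar>real (r + h) - real (s + h)\<bar> / 2))"
        unfolding shift[symmetric] ..
      finally show ?thesis by (simp add: cov_form_def b_def)
    qed
    finally show ?thesis .
  qed
  show ?thesis
  proof (rule measure_eqI_bounded_continuous[OF p prob_space_ar1_law])
    fix f :: "(nat \<Rightarrow> real) \<Rightarrow> real" assume f: "continuous_on UNIV f" "bounded (range f)"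
    have "weakly_converges (\<lambda>_. ?S) (ar1_law m)"
    proof (rule weakly_converges_sequences_second_momentI[where C=1])
      show "integrable ?S (\<lambda>x. (x r)\<^sup>2)" for r
        by (subst integrable_distr_eq) (simp_all add: power2_eq_square ar1_law_moments[OF assms])
      show "(\<integral>x. (x r)\<^sup>2 \<partial>?S) \<le> 1" for r
        using assms(1) by (subst integral_distr) (simp_all add: power2_eq_square ar1_law_moments[OF assms])
      show "integrable (ar1_law m) (\<lambda>x. (x r)\<^sup>2)" "(\<integral>x. (x r)\<^sup>2 \<partial>ar1_law m) \<le> 1" for r
        using assms(1) by (simp_all add: power2_eq_square ar1_law_moments[OF assms])
    qed (simp_all add: p prob_space_ar1_law cis ar1_law_cis[OF assms])
    then show "integral\<^sup>L ?S f = integral\<^sup>L (ar1_law m) f"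
      using f unfolding weakly_converges_def by (simp add: LIMSEQ_const_iff)
  qed simp_all
qed

section \<open>Characteristic functions of the fluctuations\<close>

lemma abs_exp_minus_le: "0 \<le> y \<Longrightarrow> \<bar>exp (- y) - (1 - y)\<bar> \<le> y\<^sup>2" for y :: real
proof -
  assume y: "0 \<le> y"
  have 1: "1 - y \<le> exp (- y)" using exp_ge_add_one_self[of "- y"] by simp
  have "exp (- y) \<le> 1 / (1 + y)"
    using exp_ge_add_one_self[of y] y by (simp add: exp_minus field_simps)
  also have "\<dots> \<le> 1 - y + y\<^sup>2"
  proof -
    have "1 \<le> (1 - y + y\<^sup>2) * (1 + y)" using y by (simp add: algebra_simps power2_eq_square)
    then show ?thesis using y by (simp add: divide_le_eq)
  qed
  finally show ?thesis using 1 by simp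
qed

text \<open>With only two moments the Taylor remainder is at most t^2 / 6 times the expectation of
  min (6 X^2) (|t| |X|^3). The minimum is dominated by 6 X^2, so its expectation tends to 0 with t;
  the Gaussian side has an error of order t^4.\<close>

lemma (in prob_space) char_minus_gaussian_small:
  fixes X :: "'a \<Rightarrow> real"
  assumes [measurable]: "X \<in> borel_measurable M" and X: "integrable M X" "integrable M (\<lambda>x. (X x)\<^sup>2)" "expectation X = 0"
    and var: "expectation (\<lambda>x. (X x)\<^sup>2) = \<tau>" and d: "0 < d"
  obtains h where "0 < h" "\<And>t. \<bar>t\<bar> \<le> h \<Longrightarrow> norm (char (distr M borel X) t - of_real (exp (- \<tau> * t\<^sup>2 / 2))) \<le> d * t\<^sup>2"
proof -
  define E where "E h = expectation (\<lambda>x. min (6 * (X x)\<^sup>2) (h * \<bar>X x\<bar> ^ 3))" for h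
  have \<tau>: "0 \<le> \<tau>" by (subst var[symmetric]) simp
  have int: "integrable M (\<lambda>x. min (6 * (X x)\<^sup>2) (h * \<bar>X x\<bar> ^ 3))" if "0 \<le> h" for h
    by (rule Bochner_Integration.integrable_bound[of M "\<lambda>x. 6 * (X x)\<^sup>2"]) (use X that in auto)
  have "(\<lambda>n. E (1 / real (Suc n))) \<longlonglongrightarrow> expectation (\<lambda>x. 0)"
    unfolding E_def
  proof (rule integral_dominated_convergence[where w="\<lambda>x. 6 * (X x)\<^sup>2"])
    show "AE x in M. (\<lambda>n. min (6 * (X x)\<^sup>2) (1 / real (Suc n) * \<bar>X x\<bar> ^ 3)) \<longlonglongrightarrow> 0"
    proof (intro AE_I2)
      fix x
      have "(\<lambda>n. 1 / real (Suc n) * \<bar>X x\<bar> ^ 3) \<longlonglongrightarrow> 0 * \<bar>X x\<bar> ^ 3"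
        by (intro tendsto_intros LIMSEQ_Suc[OF lim_1_over_n])
      then have "(\<lambda>n. min (6 * (X x)\<^sup>2) (1 / real (Suc n) * \<bar>X x\<bar> ^ 3)) \<longlonglongrightarrow> min (6 * (X x)\<^sup>2) (0 * \<bar>X x\<bar> ^ 3)"
        by (rule tendsto_min[OF tendsto_const])
      then show "(\<lambda>n. min (6 * (X x)\<^sup>2) (1 / real (Suc n) * \<bar>X x\<bar> ^ 3)) \<longlonglongrightarrow> 0" by simp
    qed
  qed (use X in auto)
  then have "eventually (\<lambda>n. E (1 / real (Suc n)) < d) sequentially"
    using d by (intro order_tendstoD(2)) auto
  then obtain n where n: "E (1 / real (Suc n)) < d"
    unfolding eventually_sequentially by blast
  \<comment> \<open>The first bound makes the truncated third moment smaller than d; the second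
    makes (\<tau> t^2 / 2)^2 at most t^2 d / 4. Together the errors are at most (1/6 + 1/4) d
    t^2.\<close>
  define h where "h = min (1 / real (Suc n)) (sqrt (d / (\<tau>\<^sup>2 + 1)))"
  have h: "0 < h" "h \<le> 1 / real (Suc n)" "h \<le> sqrt (d / (\<tau>\<^sup>2 + 1))"
    using d by (auto simp: h_def add_nonneg_pos)
  show ?thesis
  proof (rule that[OF h(1)])
    fix t :: real assume t: "\<bar>t\<bar> \<le> h"
    have "norm (char (distr M borel X) t - of_real (1 - t\<^sup>2 * \<tau> / 2)) \<le> t\<^sup>2 / 6 * E \<bar>t\<bar>"
      unfolding E_def using char_approx3'[OF assms(1) X, of \<tau> "distr M borel X" t] var X(3) by simp
    also have "E \<bar>t\<bar> \<le> E (1 / real (Suc n))"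
      unfolding E_def using t h
      by (intro integral_mono int min.mono mult_right_mono order_refl) auto
    also have "t\<^sup>2 / 6 * E (1 / real (Suc n)) \<le> t\<^sup>2 / 6 * d"
      using n by (intro mult_left_mono) auto
    finally have 1: "norm (char (distr M borel X) t - of_real (1 - t\<^sup>2 * \<tau> / 2)) \<le> t\<^sup>2 / 6 * d"
      by (simp add: mult_left_mono)
    have "\<bar>exp (- (\<tau> * t\<^sup>2 / 2)) - (1 - \<tau> * t\<^sup>2 / 2)\<bar> \<le> (\<tau> * t\<^sup>2 / 2)\<^sup>2"
      using \<tau> by (intro abs_exp_minus_le) auto
    also have "\<dots> = t\<^sup>2 / 4 * (\<tau>\<^sup>2 * t\<^sup>2)" by (simp add: power2_eq_square field_simps)
    also have "\<dots> \<le> t\<^sup>2 / 4 * d"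
    proof (intro mult_left_mono)
      have nn: "0 \<le> d / (\<tau>\<^sup>2 + 1)" using d by (simp add: add_nonneg_nonneg)
      have "\<bar>t\<bar>\<^sup>2 \<le> (sqrt (d / (\<tau>\<^sup>2 + 1)))\<^sup>2"
        using t h(3) by (intro power_mono) linarith+
      then have "t\<^sup>2 \<le> d / (\<tau>\<^sup>2 + 1)" unfolding real_sqrt_pow2[OF nn] by simp
      then have "t\<^sup>2 * (\<tau>\<^sup>2 + 1) \<le> d" by (simp add: pos_le_divide_eq add_nonneg_pos)
      then show "\<tau>\<^sup>2 * t\<^sup>2 \<le> d" using zero_le_power2[of t] by (simp only: distrib_left mult.commute)
    qed auto
    finally have "\<bar>exp (- (\<tau> * t\<^sup>2 / 2)) - (1 - \<tau> * t\<^sup>2 / 2)\<bar> \<le> t\<^sup>2 / 4 * d" .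
    then have 2: "norm (of_real (1 - t\<^sup>2 * \<tau> / 2) - of_real (exp (- \<tau> * t\<^sup>2 / 2)) :: complex) \<le> t\<^sup>2 / 4 * d"
      unfolding of_real_diff[symmetric] norm_of_real by (simp add: abs_minus_commute mult.commute)
    have "norm (char (distr M borel X) t - of_real (exp (- \<tau> * t\<^sup>2 / 2))) \<le> t\<^sup>2 / 6 * d + t\<^sup>2 / 4 * d"
      using norm_triangle_mono[OF 1 2] by simp
    also have "\<dots> \<le> d * t\<^sup>2" using d by (simp add: field_simps)
    finally show "norm (char (distr M borel X) t - of_real (exp (- \<tau> * t\<^sup>2 / 2))) \<le> d * t\<^sup>2" .
  qed
qed

section \<open>Comparison with the Gaussian law given a generation\<close>

context biggins_tree begin

definition scaled_weight :: "nat list \<Rightarrow> tree \<Rightarrow> real" where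
  "scaled_weight u t = weight u t / sqrt m2 ^ length u"

lemma scaled_weight_square: "(scaled_weight u t)\<^sup>2 = nweight u t"
  using m2 by (simp add: scaled_weight_def nweight_def power_divide power_mult[symmetric] mult.commute[of _ 2])
     (simp add: power_mult)

lemma scaled_weight_nonneg [simp]: "0 \<le> scaled_weight u t"
  using m2 by (simp add: scaled_weight_def)

lemma measurable_scaled_weight [measurable]: "scaled_weight u \<in> borel_measurable tree_space"
  unfolding scaled_weight_def by measurable

text \<open>The subtrees are integrated out one word at a time. The subtree at \<open>u\<close>
  leaves a characteristic function evaluated at \<open>scaled_weight u t\<close>; this is decided by
  the first n generations and is absorbed into \<open>H\<close>, which is why the induction carries
  such a factor.\<close>

lemma expectation_cis_sum_subtrees:
  fixes z :: "tree \<Rightarrow> real" and H :: "tree \<Rightarrow> complex"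
  assumes [measurable]: "z \<in> borel_measurable tree_space"
    and "finite V" "V \<subseteq> words n" and H: "H \<in> borel_measurable tree_space" "\<And>t. H (cut n t) = H t" "\<And>t. norm (H t) \<le> 1"
  shows "(\<integral>t. cis (\<Sum>u\<in>V. scaled_weight u t * z (subtree u t)) * H t \<partial>P) =
    (\<integral>t. (\<Prod>u\<in>V. char (distr P borel z) (scaled_weight u t)) * H t \<partial>P)"
  using assms(2,3) H
proof (induction V arbitrary: H rule: finite_induct)
  case (insert u V)
  note [measurable] = insert.prems(2)
  have u: "length u = n" and V: "V \<subseteq> words n" using insert.prems by auto
  define \<phi> where "\<phi> = char (distr P borel z)"
  have Z: "real_distribution (distr P borel z)" by (rule real_distribution_distr) (simp only: measurable_P assms(1))
  have [measurable]: "\<phi> \<in> borel_measurable borel"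
    unfolding \<phi>_def by (rule real_distribution.char_measurable[OF Z])
  have \<phi>1: "norm (\<phi> x) \<le> 1" for x
    unfolding \<phi>_def by (rule real_distribution.cmod_char_le_1[OF Z])
  have \<phi>_eq: "\<phi> x = (\<integral>s. cis (x * z s) \<partial>P)" for x
    unfolding \<phi>_def char_def by (subst integral_distr) (auto simp: cis_conv_exp)
  define F where "F t s = cis (scaled_weight u t * z s) * (cis (\<Sum>v\<in>V. scaled_weight v t * z (subtree v t)) * H t)" for t s
  have prune_H: "H (prune u t) = H t" for t
    using insert.prems(3)[of "prune u t"] insert.prems(3)[of t] cut_prune[of u t] u by simp
  have prune_V: "scaled_weight v (prune u t) = scaled_weight v t" "subtree v (prune u t) = subtree v t" if "v \<in> V" for v t
    using that V u insert.hyps by (auto simp: scaled_weight_def weight_prune intro!: subtree_prune)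
  have "(\<integral>t. cis (\<Sum>v\<in>insert u V. scaled_weight v t * z (subtree v t)) * H t \<partial>P) = (\<integral>t. F t (subtree u t) \<partial>P)"
    using insert.hyps by (simp add: F_def cis_mult mult.assoc[symmetric])
  also have "\<dots> = (\<integral>t. \<integral>s. F t s \<partial>P \<partial>P)"
  proof (rule integral_subtree[where B=1])
    show "case_prod F \<in> borel_measurable (tree_space \<Otimes>\<^sub>M tree_space)"
      unfolding F_def cis_conv_exp by measurable
    show "F (prune u t) s = F t s" for t s
    proof -
      have "(\<Sum>v\<in>V. scaled_weight v (prune u t) * z (subtree v (prune u t))) = (\<Sum>v\<in>V. scaled_weight v t * z (subtree v t))"
        by (intro sum.cong) (simp_all add: prune_V)
      moreover have "scaled_weight u (prune u t) = scaled_weight u t"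
        by (simp add: scaled_weight_def weight_prune)
      ultimately show ?thesis unfolding F_def by (simp only: prune_H)
    qed
    show "norm (F t s) \<le> 1" for t s
      using insert.prems(4) by (simp add: F_def norm_mult)
  qed
  also have "\<dots> = (\<integral>t. cis (\<Sum>v\<in>V. scaled_weight v t * z (subtree v t)) * (\<phi> (scaled_weight u t) * H t) \<partial>P)"
    by (simp add: F_def \<phi>_eq mult_ac)
  also have "\<dots> = (\<integral>t. (\<Prod>v\<in>V. \<phi> (scaled_weight v t)) * (\<phi> (scaled_weight u t) * H t) \<partial>P)"
    unfolding \<phi>_def
  proof (rule insert.IH[OF V])
    show "(\<lambda>t. char (distr P borel z) (scaled_weight u t) * H t) \<in> borel_measurable tree_space"
      unfolding \<phi>_def[symmetric] by measurable
    show "char (distr P borel z) (scaled_weight u (cut n t)) * H (cut n t) = char (distr P borel z) (scaled_weight u t) * H t" for t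
      using u insert.prems(3) by (simp add: scaled_weight_def weight_cut)
    show "norm (char (distr P borel z) (scaled_weight u t) * H t) \<le> 1" for t
      using \<phi>1 insert.prems(4) unfolding \<phi>_def by (simp add: norm_mult mult_le_one)
  qed
  finally show ?case
    using insert.hyps by (simp add: \<phi>_def mult_ac)
qed simp

lemma sum_nweight_le_D: "AE t in P. \<forall>N. (\<Sum>u\<in>words_below N n. nweight u t) \<le> D n t"
  using AE_D_sum[of n]
proof eventually_elim
  case (elim t)
  have eq: "(\<Sum>u\<in>words_below N n. nweight u t) = (\<Sum>u\<in>words_below N n. (weight u t)\<^sup>2 / m2 ^ n)" for N
    by (intro sum.cong) (auto simp: nweight_def words_below_def)
  have "incseq (\<lambda>N. \<Sum>u\<in>words_below N n. nweight u t)"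
    using words_below_mono by (auto simp: incseq_def intro!: sum_mono2)
  then show ?case using elim incseq_le unfolding eq by blast
qed

text \<open>Lindeberg's comparison: two products of factors of modulus at most 1 differ by at most
  the sum of the factorwise differences. If all coefficients are small this sum is at most d * D n,
  of mean at most d; otherwise the trivial bound 2 applies. The threshold depends only on
  \<open>z\<close> and \<open>d\<close>, not on n or N.\<close>

lemma expectation_cis_sum_words_close:
  fixes z :: "tree \<Rightarrow> real"
  assumes [measurable]: "z \<in> borel_measurable tree_space"
    and z: "integrable P z" "integrable P (\<lambda>t. (z t)\<^sup>2)" "(\<integral>t. z t \<partial>P) = 0" "(\<integral>t. (z t)\<^sup>2 \<partial>P) = \<tau>" and d: "0 < d"
  obtains h where "0 < h" "\<And>n N. norm ((\<integral>t. cis (\<Sum>u\<in>words_below N n. scaled_weight u t * z (subtree u t)) \<partial>P) -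
      (\<integral>t. of_real (exp (- \<tau> * (\<Sum>u\<in>words_below N n. nweight u t) / 2)) \<partial>P)) \<le> d + 2 * prob {t. \<exists>u\<in>words n. h < nweight u t}"
proof -
  define \<phi> where "\<phi> = char (distr P borel z)"
  obtain h where h: "0 < h" "\<And>x. \<bar>x\<bar> \<le> h \<Longrightarrow> norm (\<phi> x - of_real (exp (- \<tau> * x\<^sup>2 / 2))) \<le> d * x\<^sup>2"
    unfolding \<phi>_def by (rule char_minus_gaussian_small[of z \<tau> d]) (use z d in \<open>auto simp: measurable_P\<close>)
  have Z: "real_distribution (distr P borel z)" by (rule real_distribution_distr) (simp only: measurable_P assms(1))
  have [measurable]: "\<phi> \<in> borel_measurable borel"
    unfolding \<phi>_def by (rule real_distribution.char_measurable[OF Z])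
  have \<phi>1: "norm (\<phi> x) \<le> 1" for x
    unfolding \<phi>_def by (rule real_distribution.cmod_char_le_1[OF Z])
  have \<tau>: "0 \<le> \<tau>" by (subst z(4)[symmetric]) simp
  define g where "g x = exp (- \<tau> * x / 2)" for x
  have g: "0 \<le> g x" "0 \<le> x \<Longrightarrow> g x \<le> 1" for x
    using \<tau> by (auto simp: g_def)
  have g_sum: "g (\<Sum>u\<in>V. f u) = (\<Prod>u\<in>V. g (f u))" if "finite V" for V and f :: "nat list \<Rightarrow> real"
    using that unfolding g_def by (simp add: exp_sum[symmetric] sum_distrib_left sum_divide_distrib sum_negf)
  \<comment> \<open>The threshold is squared because the exceptional event is stated for
    \<open>nweight\<close>, the square of the coefficient \<open>scaled_weight\<close>.\<close>
  show ?thesis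
  proof (rule that[of "h\<^sup>2"])
    show "0 < h\<^sup>2" using h by simp
    fix n N
    let ?V = "words_below N n"
    let ?\<phi> = "\<lambda>t. \<Prod>u\<in>?V. \<phi> (scaled_weight u t)" and ?g = "\<lambda>t. \<Prod>u\<in>?V. complex_of_real (g (nweight u t))"
    let ?err = "norm ((\<integral>t. cis (\<Sum>u\<in>?V. scaled_weight u t * z (subtree u t)) \<partial>P) -
      (\<integral>t. of_real (exp (- \<tau> * (\<Sum>u\<in>?V. nweight u t) / 2)) \<partial>P))"
    define A where "A = {t. \<exists>u\<in>words n. h\<^sup>2 < nweight u t}"
    have A [measurable]: "A \<in> sets P" unfolding A_def by (rule sets_large_nweight)
    have V: "?V \<subseteq> words n" by (rule words_below_subset)
    have "(\<integral>t. cis (\<Sum>u\<in>?V. scaled_weight u t * z (subtree u t)) \<partial>P) = (\<integral>t. ?\<phi> t \<partial>P)"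
      using expectation_cis_sum_subtrees[OF assms(1) finite_words_below V, of "\<lambda>_. 1"] by (simp add: \<phi>_def)
    moreover have "(\<integral>t. of_real (exp (- \<tau> * (\<Sum>u\<in>?V. nweight u t) / 2)) \<partial>P) = (\<integral>t. ?g t \<partial>P)"
      unfolding g_def[symmetric] by (simp add: g_sum)
    moreover have i1: "integrable P ?\<phi>"
      by (rule integrable_const_bound[where B=1]) (auto simp: prod_norm[symmetric] intro!: prod_le_1 \<phi>1)
    moreover have i2: "integrable P ?g"
      by (rule integrable_const_bound[where B=1]) (auto simp: prod_norm[symmetric] g_def \<tau> intro!: prod_le_1)
    ultimately have "?err =
      norm (\<integral>t. ?\<phi> t - ?g t \<partial>P)"
      by simp
    also have "\<dots> \<le> (\<integral>t. norm (?\<phi> t - ?g t) \<partial>P)"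
      by (rule integral_norm_bound)
    also have "\<dots> \<le> (\<integral>t. d * D n t + 2 * indicator A t \<partial>P)"
    proof (rule integral_mono_AE)
      show "AE t in P. norm (?\<phi> t - ?g t) \<le> d * D n t + 2 * indicator A t"
        using sum_nweight_le_D[of n]
      proof eventually_elim
        case (elim t)
        show ?case
        proof (cases "t \<in> A")
          case True
          have "norm (?\<phi> t - ?g t) \<le> 1 + 1"
            by (intro order_trans[OF norm_triangle_ineq4] add_mono) (auto simp: prod_norm[symmetric] g intro!: prod_le_1 \<phi>1)
          then show ?thesis using True d by (simp add: add_increasing)
        next
          case False
          have "norm (?\<phi> t - ?g t) \<le>
             (\<Sum>u\<in>?V. norm (\<phi> (scaled_weight u t) - complex_of_real (g (nweight u t))))"
            by (rule norm_prod_diff) (auto simp: g \<phi>1)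
          also have "\<dots> \<le> (\<Sum>u\<in>?V. d * nweight u t)"
          proof (rule sum_mono)
            fix u assume "u \<in> ?V"
            then have "(scaled_weight u t)\<^sup>2 \<le> h\<^sup>2"
              using False V by (auto simp: A_def scaled_weight_square not_less)
            then have "\<bar>scaled_weight u t\<bar> \<le> h"
              using h(1) by (simp add: power2_le_iff_abs_le)
            then show "norm (\<phi> (scaled_weight u t) - complex_of_real (g (nweight u t))) \<le> d * nweight u t"
              using h(2) by (simp add: g_def scaled_weight_square[symmetric])
          qed
          also have "\<dots> \<le> d * D n t"
            using elim d by (simp add: sum_distrib_left[symmetric])
          finally show ?thesis using False by simp
        qed
      qed
      show "integrable P (\<lambda>t. d * D n t + 2 * indicator A t)"
        by (intro Bochner_Integration.integrable_add integrable_mult_right integrable_real_indicator D_moments A) (auto simp: emeasure_eq_measure)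
    qed (use i1 i2 in auto)
    also have "\<dots> = d + 2 * prob A"
      by (subst Bochner_Integration.integral_add)
         (auto simp: D_moments emeasure_eq_measure intro!: integrable_mult_right integrable_real_indicator A)
    finally show "?err \<le> d + 2 * prob {t. \<exists>u\<in>words n. h\<^sup>2 < nweight u t}"
      by (simp add: A_def)
  qed
qed

text \<open>At n = 0, combinations of these form the centred variable that each subtree carries; at
  general n they are the coordinates of the random sequence under study.\<close>

definition fluctuation :: "nat \<Rightarrow> nat \<Rightarrow> tree \<Rightarrow> real" where
  "fluctuation n r t = (Winf t - W (n + r) t) / m2 powr (real (n + r) / 2)"

lemma measurable_fluctuation [measurable]: "fluctuation n r \<in> borel_measurable tree_space"
  unfolding fluctuation_def by measurable

lemma powr_half: "m2 powr (real n / 2) = sqrt m2 ^ n"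
proof -
  have "m2 powr (real n / 2) = (m2 powr (1 / 2)) powr real n" by (simp add: powr_powr)
  then show ?thesis using m2 by (simp add: powr_half_sqrt powr_realpow)
qed

lemma fluctuation_0: "fluctuation 0 r t = (Winf t - W r t) / sqrt m2 ^ r"
  by (simp add: fluctuation_def powr_half)

text \<open>Dividing the covariance \<open>v2 * m2 ^ s\<close>, for r \<le> s, by sqrt m2^(r+s)
  leaves v2 * sqrt m2^(s-r): the normalization is what makes the covariance stationary.\<close>

lemma fluctuation_moments:
  "integrable P (fluctuation 0 r)" "(\<integral>t. fluctuation 0 r t \<partial>P) = 0"
  "integrable P (\<lambda>t. fluctuation 0 r t * fluctuation 0 s t)"
  "(\<integral>t. fluctuation 0 r t * fluctuation 0 s t \<partial>P) = v2 * m2 powr (\<bar>real r - real s\<bar> / 2)"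
proof -
  show "integrable P (fluctuation 0 r)" "(\<integral>t. fluctuation 0 r t \<partial>P) = 0"
    using integrable_Winf integrable_W[of r] by (simp_all add: fluctuation_0[abs_def] expectation_Winf expectation_W)
  have *: "integrable P (\<lambda>t. fluctuation 0 r t * fluctuation 0 s t) \<and>
    (\<integral>t. fluctuation 0 r t * fluctuation 0 s t \<partial>P) = v2 * m2 powr (\<bar>real r - real s\<bar> / 2)" if "r \<le> s" for r s
  proof -
    have eq: "fluctuation 0 r t * fluctuation 0 s t = (Winf t - W r t) * (Winf t - W s t) / sqrt m2 ^ (r + s)" for t
      by (simp add: fluctuation_0 power_add)
    have "m2 ^ s = sqrt m2 ^ (2 * s)" using m2 by (simp add: power_mult)
    also have "2 * s = (s - r) + (r + s)" using that by simp
    finally have "m2 ^ s = sqrt m2 ^ (s - r) * sqrt m2 ^ (r + s)" by (simp only: power_add)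
    then show ?thesis
      unfolding eq using covariance_Winf_diff[OF that] m2 powr_half_abs_diff[OF m2(1) that] by simp
  qed
  have "integrable P (\<lambda>t. fluctuation 0 r t * fluctuation 0 s t) \<and>
    (\<integral>t. fluctuation 0 r t * fluctuation 0 s t \<partial>P) = v2 * m2 powr (\<bar>real r - real s\<bar> / 2)"
    using *[of r s] *[of s r] by (cases "r \<le> s") (simp_all add: mult.commute abs_minus_commute)
  then show "integrable P (\<lambda>t. fluctuation 0 r t * fluctuation 0 s t)"
    "(\<integral>t. fluctuation 0 r t * fluctuation 0 s t \<partial>P) = v2 * m2 powr (\<bar>real r - real s\<bar> / 2)" by blast+
qed

lemma combination_square:
  "(\<Sum>r<k. a r * f r)\<^sup>2 = (\<Sum>r<k. \<Sum>s<k. a r * a s * (f r * f s))" for f :: "nat \<Rightarrow> real"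
  by (simp add: power2_eq_square sum_product mult_ac)

lemma fluctuation_combination_moments:
  fixes a :: "nat \<Rightarrow> real" and k :: nat
  defines "z \<equiv> \<lambda>t. \<Sum>r<k. a r * fluctuation 0 r t"
  shows "integrable P z" "(\<integral>t. z t \<partial>P) = 0" "integrable P (\<lambda>t. (z t)\<^sup>2)" "(\<integral>t. (z t)\<^sup>2 \<partial>P) = v2 * cov_form m2 k a"
proof -
  show "integrable P z" "(\<integral>t. z t \<partial>P) = 0"
    unfolding z_def by (simp_all add: fluctuation_moments)
  show "integrable P (\<lambda>t. (z t)\<^sup>2)"
    unfolding z_def combination_square by (simp add: fluctuation_moments)
  have "(\<integral>t. (z t)\<^sup>2 \<partial>P) = (\<Sum>r<k. \<Sum>s<k. a r * a s * (v2 * m2 powr (\<bar>real r - real s\<bar> / 2)))"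
    unfolding z_def combination_square by (simp add: fluctuation_moments)
  then show "(\<integral>t. (z t)\<^sup>2 \<partial>P) = v2 * cov_form m2 k a"
    by (simp add: cov_form_def sum_distrib_left mult_ac)
qed

text \<open>The branching identities for the limit and for W_{n+r} are subtracted; of the
  normalization sqrt m2^(n+r), the part sqrt m2^n goes into \<open>scaled_weight\<close> and the
  part sqrt m2^r into the fluctuation of the subtree.\<close>

lemma AE_fluctuation_branching:
  "AE t in P. (\<lambda>N. \<Sum>u\<in>words_below N n. scaled_weight u t * (\<Sum>r<k. a r * fluctuation 0 r (subtree u t)))
     \<longlonglongrightarrow> (\<Sum>r<k. a r * fluctuation n r t)"
proof -
  have "AE t in P. \<forall>r. (\<lambda>N. \<Sum>u\<in>words_below N n. weight u t * W r (subtree u t)) \<longlonglongrightarrow> W (n + r) t"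
    by (auto simp: AE_all_countable intro!: AE_W_branching)
  with AE_Winf_branching[of n] show ?thesis
  proof eventually_elim
    case (elim t)
    have eq: "(\<Sum>u\<in>words_below N n. scaled_weight u t * (\<Sum>r<k. a r * fluctuation 0 r (subtree u t))) =
       (\<Sum>r<k. a r * (((\<Sum>u\<in>words_below N n. weight u t * Winf (subtree u t)) -
         (\<Sum>u\<in>words_below N n. weight u t * W r (subtree u t))) / sqrt m2 ^ (n + r)))" for N
    proof -
      have "(\<Sum>u\<in>words_below N n. scaled_weight u t * (\<Sum>r<k. a r * fluctuation 0 r (subtree u t))) =
         (\<Sum>u\<in>words_below N n. \<Sum>r<k. a r * ((weight u t * Winf (subtree u t) - weight u t * W r (subtree u t)) / sqrt m2 ^ (n + r)))"
        unfolding sum_distrib_left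
        using m2 by (intro sum.cong refl) (auto simp: scaled_weight_def fluctuation_0 words_below_def power_add field_simps)
      also have "\<dots> = (\<Sum>r<k. a r * (((\<Sum>u\<in>words_below N n. weight u t * Winf (subtree u t)) -
         (\<Sum>u\<in>words_below N n. weight u t * W r (subtree u t))) / sqrt m2 ^ (n + r)))"
        by (subst sum.swap) (simp add: sum_distrib_left[symmetric] sum_divide_distrib[symmetric] sum_subtractf)
      finally show ?thesis .
    qed
    show ?case
      unfolding eq unfolding fluctuation_def powr_half using elim m2 by (intro tendsto_intros) auto
  qed
qed

text \<open>For fixed n the comparison survives the limit N to infinity because its error bound does
  not depend on N. Then n tends to infinity with d fixed, which removes the probability of a large
  weight, and d is arbitrary. The random variance converges almost surely, so bounded convergence
  handles the Gaussian side.\<close>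

theorem fluctuation_char_tendsto:
  "(\<lambda>n. \<integral>t. cis (\<Sum>r<k. a r * fluctuation n r t) \<partial>P) \<longlonglongrightarrow>
    (\<integral>t. of_real (exp (- (v2 * cov_form m2 k a) * Dinf t / 2)) \<partial>P)"
proof -
  define \<tau> where "\<tau> = v2 * cov_form m2 k a"
  define z where "z t = (\<Sum>r<k. a r * fluctuation 0 r t)" for t
  have [measurable]: "z \<in> borel_measurable tree_space" unfolding z_def by measurable
  note zm = fluctuation_combination_moments[where a=a and k=k, folded z_def \<tau>_def]
  have \<tau>: "0 \<le> \<tau>" by (subst zm(4)[symmetric]) simp
  define X where "X n = (\<integral>t. cis (\<Sum>r<k. a r * fluctuation n r t) \<partial>P)" for n
  define Y where "Y n = (\<integral>t. complex_of_real (exp (- \<tau> * D n t / 2)) \<partial>P)" for n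
  have Y: "Y \<longlonglongrightarrow> (\<integral>t. of_real (exp (- \<tau> * Dinf t / 2)) \<partial>P)"
    unfolding Y_def
  proof (rule integral_dominated_convergence[where w="\<lambda>_. 1"])
    show "AE t in P. (\<lambda>n. complex_of_real (exp (- \<tau> * D n t / 2))) \<longlonglongrightarrow> of_real (exp (- \<tau> * Dinf t / 2))"
      using AE_D_tendsto
    proof eventually_elim
      case (elim t)
      then show ?case
        by (intro tendsto_of_real tendsto_exp tendsto_divide tendsto_mult tendsto_const) simp_all
    qed
  qed (use \<tau> in auto)
  have close: "\<exists>h>0. \<forall>n. norm (X n - Y n) \<le> d + 2 * prob {t. \<exists>u\<in>words n. h < nweight u t}" if d: "0 < d" for d
  proof -
    obtain h where h: "0 < h" "\<And>n N. norm ((\<integral>t. cis (\<Sum>u\<in>words_below N n. scaled_weight u t * z (subtree u t)) \<partial>P) -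
      (\<integral>t. of_real (exp (- \<tau> * (\<Sum>u\<in>words_below N n. nweight u t) / 2)) \<partial>P)) \<le> d + 2 * prob {t. \<exists>u\<in>words n. h < nweight u t}"
      by (rule expectation_cis_sum_words_close[OF \<open>z \<in> _\<close> zm(1,3,2,4) d]) blast
    have "norm (X n - Y n) \<le> d + 2 * prob {t. \<exists>u\<in>words n. h < nweight u t}" for n
    proof -
      have 1: "(\<lambda>N. \<integral>t. cis (\<Sum>u\<in>words_below N n. scaled_weight u t * z (subtree u t)) \<partial>P) \<longlonglongrightarrow> X n"
        unfolding X_def
      proof (rule integral_dominated_convergence[where w="\<lambda>_. 1"])
        show "AE t in P. (\<lambda>N. cis (\<Sum>u\<in>words_below N n. scaled_weight u t * z (subtree u t))) \<longlonglongrightarrow> cis (\<Sum>r<k. a r * fluctuation n r t)"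
          using AE_fluctuation_branching[where n=n and k=k and a=a] unfolding z_def
        proof eventually_elim
          case (elim t)
          then show ?case unfolding cis_conv_exp by (intro tendsto_exp tendsto_mult tendsto_const tendsto_of_real)
        qed
      qed (auto simp: cis_conv_exp simp del: of_real_sum)
      have 2: "(\<lambda>N. \<integral>t. complex_of_real (exp (- \<tau> * (\<Sum>u\<in>words_below N n. nweight u t) / 2)) \<partial>P) \<longlonglongrightarrow> Y n"
        unfolding Y_def
      proof (rule integral_dominated_convergence[where w="\<lambda>_. 1"])
        show "AE t in P. (\<lambda>N. complex_of_real (exp (- \<tau> * (\<Sum>u\<in>words_below N n. nweight u t) / 2))) \<longlonglongrightarrow> of_real (exp (- \<tau> * D n t / 2))"
          using AE_D_sum[of n]
        proof eventually_elim
          case (elim t)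
          have "(\<Sum>u\<in>words_below N n. nweight u t) = (\<Sum>u\<in>words_below N n. (weight u t)\<^sup>2 / m2 ^ n)" for N
            by (intro sum.cong) (auto simp: nweight_def words_below_def)
          with elim show ?case
            by (intro tendsto_of_real tendsto_exp tendsto_divide tendsto_mult tendsto_const) simp_all
        qed
      qed (use \<tau> in \<open>auto intro!: mult_nonneg_nonneg sum_nonneg\<close>)
      show ?thesis
        by (rule LIMSEQ_le_const2[OF tendsto_norm[OF tendsto_diff[OF 1 2]]]) (use h(2) in blast)
    qed
    with h(1) show ?thesis by blast
  qed
  have "(\<lambda>n. X n - Y n) \<longlonglongrightarrow> 0"
  proof (rule tendsto_0_if_norm_le_add)
    fix d :: real assume "0 < d"
    then obtain h where h: "0 < h" "\<And>n. norm (X n - Y n) \<le> d + 2 * prob {t. \<exists>u\<in>words n. h < nweight u t}"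
      using close by blast
    have "(\<lambda>n. 2 * prob {t. \<exists>u\<in>words n. h < nweight u t}) \<longlonglongrightarrow> 2 * 0"
      by (intro tendsto_intros max_nweight_tendsto_0 h)
    then show "\<exists>b. b \<longlonglongrightarrow> 0 \<and> (\<forall>n. norm (X n - Y n) \<le> d + b n)"
      unfolding mult_zero_right using h(2) by blast
  qed
  from tendsto_add[OF this Y] show ?thesis by (simp add: X_def \<tau>_def)
qed

end

section \<open>Branching random walks as random trees\<close>

lemma infsum_words_eq_nn_integral:
  fixes f :: "nat list \<Rightarrow> ennreal"
  assumes "A \<subseteq> words n"
  shows "infsum f A = (\<integral>\<^sup>+u. f u * indicator A u \<partial>count_space (words n))"
proof (rule antisym)
  have S: "infsum f A = (SUP F\<in>{F. finite F \<and> F \<subseteq> A}. sum f F)"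
    by (rule nonneg_infsum_complete) simp
  show "infsum f A \<le> (\<integral>\<^sup>+u. f u * indicator A u \<partial>count_space (words n))"
    unfolding S
  proof (rule SUP_least)
    fix F assume "F \<in> {F. finite F \<and> F \<subseteq> A}"
    then have F: "finite F" "F \<subseteq> A" "F \<subseteq> words n" using assms by auto
    have "sum f F = (\<integral>\<^sup>+u. f u * indicator F u \<partial>count_space (words n))"
      using F by (subst nn_integral_count_space'[of F]) auto
    also have "\<dots> \<le> (\<integral>\<^sup>+u. f u * indicator A u \<partial>count_space (words n))"
      using F by (intro nn_integral_mono) (auto simp: indicator_def)
    finally show "sum f F \<le> (\<integral>\<^sup>+u. f u * indicator A u \<partial>count_space (words n))" .
  qed
  show "(\<integral>\<^sup>+u. f u * indicator A u \<partial>count_space (words n)) \<le> infsum f A"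
  proof (rule LIMSEQ_le_const2[OF sum_words_below_tendsto], intro exI allI impI)
    fix N
    have "(\<Sum>u\<in>words_below N n. f u * indicator A u) = sum f (words_below N n \<inter> A)"
      by (intro sum.mono_neutral_cong_right) (auto simp: indicator_def)
    also have "\<dots> \<le> infsum f A"
      unfolding S by (intro SUP_upper) auto
    finally show "(\<Sum>u\<in>words_below N n. f u * indicator A u) \<le> infsum f A" .
  qed
qed

lemma weight_eq_exp_position:
  assumes "u \<in> generation J n \<omega>"
  shows "weight u (\<lambda>v. mark J X v \<omega>) = exp (- position X u \<omega>)"
proof -
  have "weight u (\<lambda>v. mark J X v \<omega>) = (\<Prod>k<length u. exp (- X (take k u) (u ! k) \<omega>))"
    unfolding weight_def using assms by (intro prod.cong) (auto simp: factor_def mark_def generation_def)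
  then show ?thesis by (simp add: position_def exp_sum[symmetric] sum_negf)
qed

lemma weight_eq_0_outside_generation:
  assumes "u \<notin> generation J n \<omega>" "length u = n"
  shows "weight u (\<lambda>v. mark J X v \<omega>) = 0"
  using assms by (auto simp: weight_def factor_def mark_def generation_def)

text \<open>Words outside the generation have weight 0 and drop out of the right-hand side; p > 0
  guards against 0 ^ 0 = 1, which would count them.\<close>

lemma infsum_generation_eq_mass:
  assumes "0 < p"
  shows "(\<Sum>\<^sub>\<infinity>u\<in>generation J n \<omega>. ennreal (exp (- real p * position X u \<omega>))) = mass p n (\<lambda>v. mark J X v \<omega>)"
proof -
  have "(\<Sum>\<^sub>\<infinity>u\<in>generation J n \<omega>. ennreal (exp (- real p * position X u \<omega>))) =
    (\<integral>\<^sup>+u. ennreal (exp (- real p * position X u \<omega>)) * indicator (generation J n \<omega>) u \<partial>count_space (words n))"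
    by (rule infsum_words_eq_nn_integral) (auto simp: generation_def)
  also have "\<dots> = mass p n (\<lambda>v. mark J X v \<omega>)"
    unfolding mass_def
  proof (rule nn_integral_cong)
    fix u assume "u \<in> space (count_space (words n))"
    then have "length u = n" by simp
    then show "ennreal (exp (- real p * position X u \<omega>)) * indicator (generation J n \<omega>) u = ennreal (weight u (\<lambda>v. mark J X v \<omega>) ^ p)"
      using assms
      by (cases "u \<in> generation J n \<omega>")
         (simp_all add: weight_eq_exp_position weight_eq_0_outside_generation exp_of_nat_mult[symmetric])
  qed
  finally show ?thesis .
qed

context branching_random_walk begin

definition tree_of :: "'w \<Rightarrow> tree" where "tree_of \<omega> = (\<lambda>u. mark J X u \<omega>)"

definition tree_law :: "tree measure" where "tree_law = distr M tree_space tree_of"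

lemma measurable_mark [measurable]: "mark J X u \<in> measurable M mark_space"
  using marks_indep by (auto simp: indep_vars_def)

lemma measurable_tree_of [measurable]: "tree_of \<in> measurable M tree_space"
  unfolding tree_of_def by (rule measurable_PiM_single') auto

lemma tree_law_eq_PiM: "tree_law = (\<Pi>\<^sub>M v\<in>UNIV. distr M mark_space (mark J X []))"
proof -
  have "distr M tree_space (\<lambda>\<omega>. \<lambda>v\<in>UNIV. mark J X v \<omega>) = (\<Pi>\<^sub>M v\<in>UNIV. distr M mark_space (mark J X v))"
    using marks_indep by (subst (asm) indep_vars_iff_distr_eq_PiM) auto
  also have "\<dots> = (\<Pi>\<^sub>M v\<in>UNIV. distr M mark_space (mark J X []))"
    by (intro PiM_cong refl marks_identically_distributed)
  finally show ?thesis by (simp add: tree_law_def tree_of_def[abs_def] restrict_def)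
qed

lemma distr_subtree_eq_tree_law: "distr M tree_space (\<lambda>\<omega>. subtree u (tree_of \<omega>)) = tree_law"
proof -
  let ?\<mu> = "distr M mark_space (mark J X [])"
  have \<mu>: "prob_space ?\<mu>" by (rule prob_space_distr) simp
  have s: "sets (\<Pi>\<^sub>M v\<in>UNIV. ?\<mu>) = sets tree_space" by (intro sets_PiM_cong) auto
  have "distr M tree_space (\<lambda>\<omega>. subtree u (tree_of \<omega>)) = distr tree_law tree_space (subtree u)"
    unfolding tree_law_def by (subst distr_distr) (auto simp: comp_def)
  also have "\<dots> = distr (\<Pi>\<^sub>M v\<in>UNIV. ?\<mu>) (\<Pi>\<^sub>M v\<in>UNIV. ?\<mu>) (\<lambda>t. \<lambda>v\<in>UNIV. t (u @ v))"
    unfolding tree_law_eq_PiM using s by (intro distr_cong) (auto simp: subtree_def)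
  also have "\<dots> = (\<Pi>\<^sub>M v\<in>UNIV. ?\<mu>)"
    by (rule distr_PiM_reindex[where f="\<lambda>v. u @ v"]) (auto simp: \<mu> inj_on_def)
  finally show ?thesis by (simp add: tree_law_eq_PiM)
qed

text \<open>The words extending \<open>u\<close> and all other words form two disjoint blocks of an
  independent family. Pruning is a function of the marks of the second block, and the subtree at
  \<open>u\<close> a function of those of the first.\<close>

lemma random_tree_tree_law: "random_tree tree_law"
proof (intro random_tree.intro random_tree_axioms.intro)
  show "prob_space tree_law"
    unfolding tree_law_def by (rule prob_space_distr) simp
  show "sets tree_law = sets tree_space" by (simp add: tree_law_def)
  fix u :: "nat list"
  define A where "A = {v. take (length u) v \<noteq> u}"
  define B where "B = {v. take (length u) v = u}"
  define g where "g x v = (if v \<in> A then x v else (0, \<lambda>_. 0))" for x :: tree and v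
  define h where "h x v = x (u @ v)" for x :: tree and v
  have g [measurable]: "g \<in> measurable (PiM A (\<lambda>_. mark_space)) tree_space"
  proof (rule measurable_PiM_single')
    show "(\<lambda>x. g x v) \<in> measurable (PiM A (\<lambda>_. mark_space)) mark_space" for v
      by (cases "v \<in> A") (auto simp: g_def)
  qed (auto simp: g_def)
  have h [measurable]: "h \<in> measurable (PiM B (\<lambda>_. mark_space)) tree_space"
  proof (rule measurable_PiM_single')
    show "(\<lambda>x. h x v) \<in> measurable (PiM B (\<lambda>_. mark_space)) mark_space" for v
      unfolding h_def by (rule measurable_component_singleton) (simp add: B_def)
  qed auto
  have "indep_var (PiM A (\<lambda>_. mark_space)) (\<lambda>\<omega>. restrict (\<lambda>v. mark J X v \<omega>) A) (PiM B (\<lambda>_. mark_space)) (\<lambda>\<omega>. restrict (\<lambda>v. mark J X v \<omega>) B)"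
    by (rule indep_var_restrict[OF marks_indep]) (auto simp: A_def B_def)
  from indep_var_compose[OF this g h]
  have "indep_var tree_space (\<lambda>\<omega>. g (restrict (\<lambda>v. mark J X v \<omega>) A)) tree_space (\<lambda>\<omega>. h (restrict (\<lambda>v. mark J X v \<omega>) B))"
    by (simp add: comp_def)
  moreover have "g (restrict (\<lambda>v. mark J X v \<omega>) A) = prune u (tree_of \<omega>)" for \<omega>
    by (auto simp: g_def prune_def tree_of_def A_def fun_eq_iff)
  moreover have "h (restrict (\<lambda>v. mark J X v \<omega>) B) = subtree u (tree_of \<omega>)" for \<omega>
    by (auto simp: h_def subtree_def tree_of_def B_def fun_eq_iff)
  ultimately have "indep_var tree_space (\<lambda>\<omega>. prune u (tree_of \<omega>)) tree_space (\<lambda>\<omega>. subtree u (tree_of \<omega>))"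
    by simp
  then have "distr M tree_space (\<lambda>\<omega>. prune u (tree_of \<omega>)) \<Otimes>\<^sub>M tree_law =
    distr M (tree_space \<Otimes>\<^sub>M tree_space) (\<lambda>\<omega>. (prune u (tree_of \<omega>), subtree u (tree_of \<omega>)))"
    unfolding indep_var_distribution_eq distr_subtree_eq_tree_law by blast
  then show "distr tree_law (tree_space \<Otimes>\<^sub>M tree_space) (\<lambda>t. (prune u t, subtree u t)) =
      distr tree_law tree_space (prune u) \<Otimes>\<^sub>M tree_law"
    by (simp add: tree_law_def distr_distr comp_def)
qed

lemma brw_m_eq_mass:
  assumes "0 < p"
  shows "brw_m M J X (real p) = (\<integral>\<^sup>+t. mass p 1 t \<partial>tree_law)"
proof -
  have gen: "generation J 1 \<omega> = (\<lambda>i. [i]) ` {i. enat i < J [] \<omega>}" for \<omega>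
    using generation_Suc[of J 0 \<omega>] by (auto simp: generation_0)
  have "(\<Sum>\<^sub>\<infinity>i\<in>{i. enat i < J [] \<omega>}. ennreal (exp (- real p * X [] i \<omega>))) = mass p 1 (tree_of \<omega>)" for \<omega>
    unfolding tree_of_def infsum_generation_eq_mass[OF assms, symmetric] gen
    by (subst infsum_reindex) (auto simp: inj_on_def comp_def position_def)
  then show ?thesis
    unfolding brw_m_def tree_law_def by (subst nn_integral_distr) auto
qed

lemma biggins_eq_mass:
  "0 < p \<Longrightarrow> biggins M J X (real p) n \<omega> = enn2real (mass p n (tree_of \<omega>)) / enn2real (brw_m M J X (real p)) ^ n"
  unfolding biggins_def tree_of_def by (simp only: infsum_generation_eq_mass)

lemma integral_tree_law:
  fixes f :: "tree \<Rightarrow> 'b :: {banach, second_countable_topology}"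
  shows "f \<in> borel_measurable tree_space \<Longrightarrow> (\<integral>t. f t \<partial>tree_law) = (\<integral>\<omega>. f (tree_of \<omega>) \<partial>M)"
  unfolding tree_law_def by (rule integral_distr) auto

lemma integrable_tree_law:
  fixes f :: "tree \<Rightarrow> 'b :: {banach, second_countable_topology}"
  shows "f \<in> borel_measurable tree_space \<Longrightarrow> integrable tree_law f \<longleftrightarrow> integrable M (\<lambda>\<omega>. f (tree_of \<omega>))"
  unfolding tree_law_def by (rule integrable_distr_eq) auto

lemma AE_tree_law: "AE t in tree_law. Q t \<Longrightarrow> AE \<omega> in M. Q (tree_of \<omega>)"
  unfolding tree_law_def by (rule AE_distrD[OF measurable_tree_of])

lemma biggins_tree_tree_law:
  assumes m1: "brw_m M J X 1 = 1" and sq: "integrable M (\<lambda>\<omega>. (biggins M J X 1 1 \<omega>)\<^sup>2)" and m2: "brw_m M J X 2 < 1"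
  shows "biggins_tree tree_law (enn2real (brw_m M J X 2)) (variance (biggins M J X 1 1))"
proof -
  interpret T: random_tree tree_law by (rule random_tree_tree_law)
  let ?m2 = "enn2real (brw_m M J X 2)" and ?s = "variance (biggins M J X 1 1)"
  note One_nat_def [simp del]
  have mass1: "(\<integral>\<^sup>+t. mass 1 1 t \<partial>tree_law) = ennreal 1"
    using m1 brw_m_eq_mass[of 1] by simp
  have "brw_m M J X 2 < \<top>" using m2 less_trans ennreal_one_less_top by blast
  then have mass2: "(\<integral>\<^sup>+t. mass 2 1 t \<partial>tree_law) = ennreal ?m2"
    using brw_m_eq_mass[of 2] by simp
  have "?m2 < 1"
    using m2 \<open>brw_m M J X 2 < \<top>\<close> by (metis enn2real_1 enn2real_less_iff ennreal_1 ennreal_enn2real ennreal_less_one_iff)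
  \<comment> \<open>If m(2) were 0, almost surely every weight of the first generation would vanish,
    against m(1) = 1.\<close>
  have "?m2 \<noteq> 0"
  proof
    assume "?m2 = 0"
    then have "(\<integral>\<^sup>+t. mass 2 1 t \<partial>tree_law) = 0" using mass2 by simp
    then have "AE t in tree_law. mass 2 1 t = 0"
      by (subst (asm) nn_integral_0_iff_AE) (auto simp: T.measurable_P)
    then have "AE t in tree_law. mass 1 1 t = 0"
    proof eventually_elim
      case (elim t)
      then have "\<forall>u\<in>words 1. weight u t = 0"
        unfolding mass_def by (subst (asm) nn_integral_0_iff_AE) (auto simp: AE_count_space)
      then show ?case
        unfolding mass_def by (subst nn_integral_0_iff_AE) (auto simp: AE_count_space)
    qed
    then have "(\<integral>\<^sup>+t. mass 1 1 t \<partial>tree_law) = 0"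
      by (subst nn_integral_0_iff_AE) (auto simp: T.measurable_P)
    then show False using mass1 by simp
  qed
  then have "0 < ?m2" by (simp add: less_le)
  define V where "V t = enn2real (mass 1 1 t)" for t
  have [measurable]: "V \<in> borel_measurable tree_space" unfolding V_def by measurable
  have V0: "0 \<le> V t" for t by (simp add: V_def)
  have big: "biggins M J X 1 1 = (\<lambda>\<omega>. V (tree_of \<omega>))"
    using biggins_eq_mass[of 1 1] m1 by (auto simp: fun_eq_iff V_def)
  have Vsq: "integrable tree_law (\<lambda>t. (V t)\<^sup>2)"
    using sq unfolding big by (subst integrable_tree_law) auto
  have Vint: "integrable tree_law V"
    by (rule T.square_integrable_imp_integrable) (auto simp: Vsq)
  have AE_V: "AE t in tree_law. ennreal (V t) = mass 1 1 t"
    using T.AE_mass_finite[OF _ mass1, of 1] by (auto simp: V_def less_top)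
  have "(\<integral>\<^sup>+t. ennreal (V t) \<partial>tree_law) = ennreal 1"
    unfolding mass1[symmetric] by (rule nn_integral_cong_AE[OF AE_V])
  then have EV: "(\<integral>t. V t \<partial>tree_law) = 1"
    using V0 by (subst integral_eq_nn_integral) (auto simp: T.measurable_P)
  have "?s = (\<integral>\<omega>. (V (tree_of \<omega>) - (\<integral>\<omega>. V (tree_of \<omega>) \<partial>M))\<^sup>2 \<partial>M)"
    unfolding big ..
  also have "\<dots> = (\<integral>t. (V t - 1)\<^sup>2 \<partial>tree_law)"
    using EV by (simp add: integral_tree_law)
  also have "\<dots> = (\<integral>t. (V t)\<^sup>2 \<partial>tree_law) - 1"
    using T.variance_eq[OF Vint Vsq] by (simp add: EV)
  finally have s: "?s = (\<integral>t. (V t)\<^sup>2 \<partial>tree_law) - 1" .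
  have "(\<integral>\<^sup>+t. (mass 1 1 t)\<^sup>2 \<partial>tree_law) = (\<integral>\<^sup>+t. ennreal ((V t)\<^sup>2) \<partial>tree_law)"
    using AE_V by (intro nn_integral_cong_AE) (auto simp: ennreal_power[symmetric] V0)
  also have "\<dots> = ennreal (1 + ?s)"
    using Vsq by (simp add: nn_integral_eq_integral s)
  finally have "(\<integral>\<^sup>+t. (mass 1 1 t)\<^sup>2 \<partial>tree_law) = ennreal (1 + ?s)" .
  then show ?thesis
    using \<open>0 < ?m2\<close> \<open>?m2 < 1\<close> mass1 mass2 variance_positive[of "biggins M J X 1 1"]
    by unfold_locales auto
qed

end

section \<open>Realization of the limit law on a product space\<close>

lemma gaussian_variable_compose:
  assumes [measurable]: "g \<in> measurable M N" and "gaussian_variable (distr M N g) f"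
  shows "gaussian_variable M (\<lambda>x. f (g x))"
proof -
  have [measurable]: "f \<in> borel_measurable N"
    using assms(2) by (simp add: gaussian_variable_def)
  have 1: "distributed (distr M N g) lborel f h \<Longrightarrow> distributed M lborel (\<lambda>x. f (g x)) h" for h :: "real \<Rightarrow> ennreal"
    by (auto simp: distributed_def distr_distr comp_def)
  have 2: "AE x in distr M N g. f x = c \<Longrightarrow> AE x in M. f (g x) = c" for c
    by (rule AE_distrD[OF assms(1)])
  have "(\<lambda>x. f (g x)) \<in> borel_measurable M" by measurable
  then show ?thesis
    using assms(2) unfolding gaussian_variable_def by (blast intro: 1 2)
qed

lemma cov_form_scale: "cov_form m k (\<lambda>r. s * a r) = s\<^sup>2 * cov_form m k a"
  by (simp add: cov_form_def sum_distrib_left power2_eq_square mult_ac)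

text \<open>The limit needs a copy of W_inf(2) and a Gaussian sequence independent of it. The
  product of the two laws provides both as coordinates: \<delta> is later the law of
  W_inf(2).\<close>

locale mixture_space =
  fixes \<delta> :: "real measure" and m :: real
  assumes \<delta>: "real_distribution \<delta>" and m: "0 < m" "m \<le> 1"
begin

sublocale \<delta>: real_distribution \<delta> by (rule \<delta>)
sublocale \<gamma>: prob_space "ar1_law m" by (rule prob_space_ar1_law)
sublocale pair_prob_space \<delta> "ar1_law m" ..

abbreviation "N \<equiv> \<delta> \<Otimes>\<^sub>M ar1_law m"

lemma sets_\<delta> [measurable_cong]: "sets \<delta> = sets borel" by simp

lemma distr_fst: "distr N borel fst = \<delta>"
proof (rule measure_eqI)
  fix A assume "A \<in> sets (distr N borel fst)"
  then have A: "A \<in> sets borel" by simp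
  have "fst -` A \<inter> space N = A \<times> UNIV" by (auto simp: space_pair_measure)
  then show "emeasure (distr N borel fst) A = emeasure \<delta> A"
    using A \<gamma>.emeasure_space_1 by (simp add: emeasure_distr \<gamma>.emeasure_pair_measure_Times)
qed simp

lemma distr_snd: "distr N borel snd = ar1_law m"
proof (rule measure_eqI)
  fix A :: "(nat \<Rightarrow> real) set" assume "A \<in> sets (distr N borel snd)"
  then have A: "A \<in> sets borel" by simp
  have "snd -` A \<inter> space N = UNIV \<times> A" by (auto simp: space_pair_measure)
  then show "emeasure (distr N borel snd) A = emeasure (ar1_law m) A"
    using A \<delta>.emeasure_space_1 by (simp add: emeasure_distr \<gamma>.emeasure_pair_measure_Times)
qed simp

lemma integral_snd_eq: "f \<in> borel_measurable borel \<Longrightarrow> (\<integral>x. f (snd x) \<partial>N) = (\<integral>x. f x \<partial>ar1_law m)" for f :: "(nat \<Rightarrow> real) \<Rightarrow> real"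
  by (subst distr_snd[symmetric], subst integral_distr) auto

lemma gaussian: "gaussian_sequence N (\<lambda>r x. snd x r)"
  unfolding gaussian_sequence_def
proof (intro allI)
  fix a :: "nat \<Rightarrow> real" and k
  show "gaussian_variable N (\<lambda>x. \<Sum>r<k. a r * snd x r)"
    by (rule gaussian_variable_compose[where g=snd and N=borel]) (auto simp: distr_snd gaussian_sequence_ar1_law)
qed

lemma stationary: "stationary_sequence N (\<lambda>r x. snd x r)"
  unfolding stationary_sequence_def
proof (intro conjI allI)
  show "(\<lambda>x. snd x r) \<in> borel_measurable N" for r by measurable
  fix h
  note measurable_shift [measurable]
  have "distr N borel (\<lambda>x r. snd x (r + h)) = distr (distr N borel snd) borel (\<lambda>x r. x (r + h))"
    by (subst distr_distr) (auto simp: comp_def measurable_shift)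
  also have "\<dots> = distr N borel snd"
    unfolding distr_snd by (rule ar1_law_stationary[OF m])
  finally show "distr N borel (\<lambda>x r. snd x (r + h)) = distr N borel (\<lambda>x r. snd x r)" by simp
qed

lemma expectation_snd: "(\<integral>x. snd x r \<partial>N) = 0"
  using integral_snd_eq[of "\<lambda>x. x r"] by (simp add: ar1_law_moments[OF m])

lemma covariance_snd: "covariance N (\<lambda>x. snd x r) (\<lambda>x. snd x s) = m powr (\<bar>real r - real s\<bar> / 2)"
  using integral_snd_eq[of "\<lambda>x. x r * x s"] by (simp add: covariance_def expectation_snd ar1_law_moments[OF m])

lemma independent: "independent_variables N borel fst borel (\<lambda>x r. snd x r)"
  unfolding independent_variables_def
proof (intro conjI)
  show "indep_set {fst -` A \<inter> space N |A. A \<in> sets borel} {(\<lambda>x r. snd x r) -` B \<inter> space N |B. B \<in> sets borel}"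
  proof (rule indep_setI)
    have "fst -` A \<inter> space N \<in> sets N" if "A \<in> sets borel" for A
      by (rule measurable_sets[OF _ that]) simp
    then show "{fst -` A \<inter> space N |A. A \<in> sets borel} \<subseteq> sets N"
      by blast
    have "(\<lambda>x r. snd x r) -` B \<inter> space N \<in> sets N" if "B \<in> sets borel" for B
      by (rule measurable_sets[OF _ that]) simp
    then show "{(\<lambda>x r. snd x r) -` B \<inter> space N |B. B \<in> sets borel} \<subseteq> sets N"
      by blast
    fix a b assume "a \<in> {fst -` A \<inter> space N |A. A \<in> sets borel}" "b \<in> {(\<lambda>x r. snd x r) -` B \<inter> space N |B. B \<in> sets borel}"
    then obtain A B where *: "A \<in> sets borel" "B \<in> sets borel" "a = fst -` A \<inter> space N" "b = snd -` B \<inter> space N"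
      by auto
    then have AB: "A \<in> sets borel" "B \<in> sets borel" "a = A \<times> UNIV" "b = UNIV \<times> B"
      by (auto simp: space_pair_measure)
    have "a \<inter> b = A \<times> B" using AB by auto
    then show "prob (a \<inter> b) = prob a * prob b"
      using AB \<delta>.emeasure_space_1 \<gamma>.emeasure_space_1
      by (simp add: measure_def \<gamma>.emeasure_pair_measure_Times enn2real_mult)
  qed
qed auto

text \<open>For a fixed first coordinate d the factor sqrt (v * d) multiplies all coefficients, and
  \<open>cov_form\<close> is quadratic; nonnegativity of d and v is what lets the square undo the
  root.\<close>

lemma integral_cis:
  assumes "AE d in \<delta>. 0 \<le> d" "0 \<le> v"
  shows "(\<integral>x. cis (\<Sum>r<k. a r * (sqrt (v * fst x) * snd x r)) \<partial>N) =
    (\<integral>d. of_real (exp (- (v * cov_form m k a) * d / 2)) \<partial>\<delta>)"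
proof -
  have "(\<integral>x. cis (\<Sum>r<k. a r * (sqrt (v * fst x) * snd x r)) \<partial>N) =
     (\<integral>d. \<integral>x. cis (\<Sum>r<k. sqrt (v * d) * a r * x r) \<partial>ar1_law m \<partial>\<delta>)"
    by (subst integral_fst'[symmetric])
       (auto intro!: integrable_const_bound[where B=1] simp: cis_conv_exp mult_ac simp del: of_real_sum)
  also have "\<dots> = (\<integral>d. of_real (exp (- ((sqrt (v * d))\<^sup>2 * cov_form m k a) / 2)) \<partial>\<delta>)"
    by (simp only: ar1_law_cis[OF m] cov_form_scale)
  also have "\<dots> = (\<integral>d. of_real (exp (- (v * cov_form m k a) * d / 2)) \<partial>\<delta>)"
  proof (rule integral_cong_AE)
    show "AE d in \<delta>. complex_of_real (exp (- ((sqrt (v * d))\<^sup>2 * cov_form m k a) / 2)) = of_real (exp (- (v * cov_form m k a) * d / 2))"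
      using assms(1) by eventually_elim (use assms(2) in \<open>simp add: mult_ac\<close>)
  qed auto
  finally show ?thesis .
qed

lemma second_moment:
  assumes "integrable \<delta> (\<lambda>d. d)" "AE d in \<delta>. 0 \<le> d" "(\<integral>d. d \<partial>\<delta>) \<le> 1" "0 \<le> v"
  shows "integrable N (\<lambda>x. (sqrt (v * fst x) * snd x r)\<^sup>2)" "(\<integral>x. (sqrt (v * fst x) * snd x r)\<^sup>2 \<partial>N) \<le> v"
proof -
  have "(\<integral>\<^sup>+x. ennreal ((sqrt (v * fst x) * snd x r)\<^sup>2) \<partial>N) =
     (\<integral>\<^sup>+d. \<integral>\<^sup>+x. ennreal ((sqrt (v * d))\<^sup>2) * ennreal ((x r)\<^sup>2) \<partial>ar1_law m \<partial>\<delta>)"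
    by (subst \<gamma>.nn_integral_fst[symmetric]) (auto simp: power_mult_distrib ennreal_mult)
  also have "\<dots> = (\<integral>\<^sup>+d. ennreal ((sqrt (v * d))\<^sup>2) \<partial>\<delta>)"
  proof (rule nn_integral_cong)
    fix d
    have "(\<integral>\<^sup>+x. ennreal ((x r)\<^sup>2) \<partial>ar1_law m) = 1"
      using ar1_law_moments(3,4)[OF m, of r r] m by (subst nn_integral_eq_integral) (auto simp: power2_eq_square)
    then show "(\<integral>\<^sup>+x. ennreal ((sqrt (v * d))\<^sup>2) * ennreal ((x r)\<^sup>2) \<partial>ar1_law m) = ennreal ((sqrt (v * d))\<^sup>2)"
      by (simp add: nn_integral_cmult)
  qed
  also have "\<dots> = (\<integral>\<^sup>+d. ennreal (v * d) \<partial>\<delta>)"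
    using assms(2) by (intro nn_integral_cong_AE) (auto simp: assms(4) elim!: eventually_mono)
  also have "\<dots> = ennreal (\<integral>d. v * d \<partial>\<delta>)"
    using assms by (intro nn_integral_eq_integral) (auto elim!: eventually_mono)
  also have "\<dots> \<le> ennreal v"
    using assms by (intro ennreal_leI) (simp add: mult_left_le)
  finally have le: "(\<integral>\<^sup>+x. ennreal ((sqrt (v * fst x) * snd x r)\<^sup>2) \<partial>N) \<le> ennreal v" .
  then show int: "integrable N (\<lambda>x. (sqrt (v * fst x) * snd x r)\<^sup>2)"
    by (intro integrableI_nonneg) (auto intro: le_less_trans)
  show "(\<integral>x. (sqrt (v * fst x) * snd x r)\<^sup>2 \<partial>N) \<le> v"
    using le assms(4) by (subst (asm) nn_integral_eq_integral[OF int]) auto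
qed

end

theorem theorem1p1:
  fixes M :: "'w measure"
    and J :: "nat list \<Rightarrow> 'w \<Rightarrow> enat"
    and X :: "nat list \<Rightarrow> nat \<Rightarrow> 'w \<Rightarrow> real"
    and v2 \<sigma>2 m2 :: real
  assumes "branching_random_walk M J X"
    and "supercritical M J"
    and "brw_m M J X 1 = 1"
    and "integrable M (\<lambda>\<omega>. (biggins M J X 1 1 \<omega>)\<^sup>2)"
    and "brw_m M J X 2 < 1"
    and "m2 = enn2real (brw_m M J X 2)"
    and "\<sigma>2 = prob_space.variance M (biggins M J X 1 1)"
    and "v2 = prob_space.variance M (biggins_lim M J X 1)"
  shows "integrable M (\<lambda>\<omega>. (biggins_lim M J X 1 \<omega>)\<^sup>2) \<and> v2 = \<sigma>2 / (1 - m2) \<and>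
    (\<exists>(N :: (real \<times> (nat \<Rightarrow> real)) measure) Winf2 U.
      prob_space N \<and>
      Winf2 \<in> borel_measurable N \<and>
      distr N borel Winf2 = distr M borel (biggins_lim M J X 2) \<and>
      gaussian_sequence N U \<and>
      stationary_sequence N U \<and>
      (\<forall>r. prob_space.expectation N (U r) = 0) \<and>
      (\<forall>r s. covariance N (U r) (U s) = m2 powr (\<bar>real r - real s\<bar> / 2)) \<and>
      independent_variables N borel Winf2 borel (\<lambda>x r. U r x) \<and>
      converges_in_distribution
        M (\<lambda>n \<omega> r. (biggins_lim M J X 1 \<omega> - biggins M J X 1 (n + r) \<omega>) / m2 powr (real (n + r) / 2))
        N (\<lambda>x r. sqrt (v2 * Winf2 x) * U r x))"
proof -
  interpret branching_random_walk M J X by fact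
  interpret B: biggins_tree tree_law m2 \<sigma>2
    using biggins_tree_tree_law[OF assms(3,4,5)] unfolding assms(6,7) .
  have big1: "biggins M J X 1 n \<omega> = B.W n (tree_of \<omega>)" for n \<omega>
    using biggins_eq_mass[of 1 n \<omega>] assms(3) by (simp add: B.W_def)
  have lim1: "biggins_lim M J X 1 = (\<lambda>\<omega>. B.Winf (tree_of \<omega>))"
    by (simp add: fun_eq_iff biggins_lim_def B.Winf_def big1)
  have big2: "biggins M J X 2 n \<omega> = B.D n (tree_of \<omega>)" for n \<omega>
    using biggins_eq_mass[of 2 n \<omega>] by (simp add: B.D_def assms(6)[symmetric])
  have lim2: "biggins_lim M J X 2 = (\<lambda>\<omega>. B.Dinf (tree_of \<omega>))"
    by (simp add: fun_eq_iff biggins_lim_def B.Dinf_def big2)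
  have int: "integrable M (\<lambda>\<omega>. (biggins_lim M J X 1 \<omega>)\<^sup>2)"
    using B.integrable_Winf_square unfolding lim1 by (subst (asm) integrable_tree_law) auto
  have "v2 = (\<integral>t. (B.Winf t - 1)\<^sup>2 \<partial>tree_law)"
    unfolding assms(8) lim1 using B.expectation_Winf by (simp add: integral_tree_law)
  then have v2: "v2 = B.v2"
    using B.variance_Winf by (simp add: B.expectation_Winf)
  have v2_eq: "v2 = \<sigma>2 / (1 - m2)"
    unfolding v2 B.v2_def ..
  \<comment> \<open>The limit variables live on a new space, so only the law of W_inf(2) is carried
    over.\<close>
  define \<delta> where "\<delta> = distr M borel (biggins_lim M J X 2)"
  have [measurable]: "(\<lambda>\<omega>. B.Dinf (tree_of \<omega>)) \<in> borel_measurable M" by measurable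
  have \<delta>: "real_distribution \<delta>"
    unfolding \<delta>_def lim2 by (rule real_distribution_distr) simp
  interpret Q: mixture_space \<delta> m2
    by (rule mixture_space.intro[OF \<delta> B.m2(1) less_imp_le[OF B.m2(2)]])
  have \<delta>_nonneg: "AE d in \<delta>. 0 \<le> d"
    unfolding \<delta>_def lim2 using AE_tree_law[OF B.AE_Dinf_nonneg] by (subst AE_distr_iff) auto
  have \<delta>_int: "integrable \<delta> (\<lambda>d. d)" "(\<integral>d. d \<partial>\<delta>) \<le> 1"
    using B.Dinf_moments unfolding \<delta>_def lim2
    by (simp_all add: integrable_distr_eq integral_distr integrable_tree_law integral_tree_law)
  define Y where "Y n \<omega> r = (biggins_lim M J X 1 \<omega> - biggins M J X 1 (n + r) \<omega>) / m2 powr (real (n + r) / 2)" for n \<omega> r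
  have Y_eq: "Y n \<omega> r = B.fluctuation n r (tree_of \<omega>)" for n \<omega> r
    by (simp add: Y_def lim1 big1 B.fluctuation_def)
  define Z where "Z x r = sqrt (v2 * fst x) * snd x r" for x :: "real \<times> (nat \<Rightarrow> real)" and r
  have Y_meas [measurable]: "Y n \<in> borel_measurable M" for n
    by (rule measurable_coordinatewise_then_product) (simp add: Y_eq)
  have Z_meas [measurable]: "Z \<in> borel_measurable Q.N"
    by (rule measurable_coordinatewise_then_product) (simp add: Z_def)
  \<comment> \<open>\<open>v2\<close> bounds all second moments: each normalized difference has
    second moment exactly \<open>v2\<close>, and each coordinate of the limit at most
    \<open>v2\<close>, because the mean of W_inf(2) is at most 1.\<close>
  have "weakly_converges (\<lambda>n. distr M borel (Y n)) (distr Q.N borel Z)"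
  proof (rule weakly_converges_sequences_second_momentI[where C=v2])
    show "prob_space (distr M borel (Y n))" for n by (rule prob_space_distr) simp
    show "prob_space (distr Q.N borel Z)" by (rule Q.prob_space_distr) simp
    show "(\<lambda>n. \<integral>x. cis (\<Sum>r<k. a r * x r) \<partial>distr M borel (Y n)) \<longlonglongrightarrow> (\<integral>x. cis (\<Sum>r<k. a r * x r) \<partial>distr Q.N borel Z)" for k a
    proof -
      have "(\<integral>x. cis (\<Sum>r<k. a r * x r) \<partial>distr M borel (Y n)) = (\<integral>t. cis (\<Sum>r<k. a r * B.fluctuation n r t) \<partial>tree_law)" for n
        by (subst integral_distr) (auto simp: Y_eq integral_tree_law cis_conv_exp simp del: of_real_sum)
      moreover have "(\<integral>x. cis (\<Sum>r<k. a r * x r) \<partial>distr Q.N borel Z) =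
          (\<integral>t. of_real (exp (- (v2 * cov_form m2 k a) * B.Dinf t / 2)) \<partial>tree_law)"
      proof -
        have "(\<integral>x. cis (\<Sum>r<k. a r * x r) \<partial>distr Q.N borel Z) = (\<integral>x. cis (\<Sum>r<k. a r * (sqrt (v2 * fst x) * snd x r)) \<partial>Q.N)"
          by (subst integral_distr) (auto simp: Z_def cis_conv_exp simp del: of_real_sum)
        also have "\<dots> = (\<integral>d. of_real (exp (- (v2 * cov_form m2 k a) * d / 2)) \<partial>\<delta>)"
          using B.v2_nonneg by (intro Q.integral_cis \<delta>_nonneg) (simp add: v2)
        also have "\<dots> = (\<integral>t. of_real (exp (- (v2 * cov_form m2 k a) * B.Dinf t / 2)) \<partial>tree_law)"
          unfolding \<delta>_def lim2 by (subst integral_distr) (auto simp: integral_tree_law)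
        finally show ?thesis .
      qed
      ultimately show ?thesis
        using B.fluctuation_char_tendsto[where k=k and a=a] by (simp add: v2)
    qed
    show "integrable (distr M borel (Y n)) (\<lambda>x. (x r)\<^sup>2)" "(\<integral>x. (x r)\<^sup>2 \<partial>distr M borel (Y n)) \<le> v2" for n r
    proof -
      have eq: "(B.fluctuation n r t)\<^sup>2 = (B.Winf t - B.W (n + r) t)\<^sup>2 / m2 ^ (n + r)" for t
      proof -
        have "(sqrt m2 ^ (n + r))\<^sup>2 = m2 ^ (n + r)"
          using B.m2 by (simp add: power2_eq_square power_mult_distrib[symmetric])
        then show ?thesis
          unfolding B.fluctuation_def B.powr_half power_divide by simp
      qed
      have i: "integrable tree_law (\<lambda>t. (B.fluctuation n r t)\<^sup>2)" "(\<integral>t. (B.fluctuation n r t)\<^sup>2 \<partial>tree_law) = v2"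
        unfolding eq using B.m2 by (simp_all add: B.Winf_diff_square v2)
      show "integrable (distr M borel (Y n)) (\<lambda>x. (x r)\<^sup>2)"
        using i(1) by (subst integrable_distr_eq) (auto simp: Y_eq integrable_tree_law)
      show "(\<integral>x. (x r)\<^sup>2 \<partial>distr M borel (Y n)) \<le> v2"
        using i(2) by (subst integral_distr) (auto simp: Y_eq integral_tree_law)
    qed
    show "integrable (distr Q.N borel Z) (\<lambda>x. (x r)\<^sup>2)" "(\<integral>x. (x r)\<^sup>2 \<partial>distr Q.N borel Z) \<le> v2" for r
    proof -
      have "0 \<le> v2" using B.v2_nonneg by (simp add: v2)
      note sm = Q.second_moment[OF \<delta>_int(1) \<delta>_nonneg \<delta>_int(2) this, of r]
      show "integrable (distr Q.N borel Z) (\<lambda>x. (x r)\<^sup>2)"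
        using sm(1) by (subst integrable_distr_eq) (auto simp: Z_def)
      show "(\<integral>x. (x r)\<^sup>2 \<partial>distr Q.N borel Z) \<le> v2"
        using sm(2) by (subst integral_distr) (auto simp: Z_def)
    qed
  qed simp_all
  then have conv: "converges_in_distribution M Y Q.N Z"
    by (simp add: converges_in_distribution_def Y_meas Z_meas)
  show ?thesis
  proof (intro conjI exI allI)
    show "integrable M (\<lambda>\<omega>. (biggins_lim M J X 1 \<omega>)\<^sup>2)" "v2 = \<sigma>2 / (1 - m2)" by (fact int, fact v2_eq)
    show "prob_space Q.N" by (rule Q.prob_space_axioms)
    show "fst \<in> borel_measurable Q.N" by simp
    show "distr Q.N borel fst = distr M borel (biggins_lim M J X 2)"
      unfolding Q.distr_fst by (simp only: \<delta>_def)
    show "gaussian_sequence Q.N (\<lambda>r x. snd x r)" by (rule Q.gaussian)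
    show "stationary_sequence Q.N (\<lambda>r x. snd x r)" by (rule Q.stationary)
    show "Q.expectation (\<lambda>x. snd x r) = 0" for r by (rule Q.expectation_snd)
    show "covariance Q.N (\<lambda>x. snd x r) (\<lambda>x. snd x s) = m2 powr (\<bar>real r - real s\<bar> / 2)" for r s
      by (rule Q.covariance_snd)
    show "independent_variables Q.N borel fst borel (\<lambda>x r. snd x r)" by (rule Q.independent)
    show "converges_in_distribution
        M (\<lambda>n \<omega> r. (biggins_lim M J X 1 \<omega> - biggins M J X 1 (n + r) \<omega>) / m2 powr (real (n + r) / 2))
        Q.N (\<lambda>x r. sqrt (v2 * fst x) * snd x r)"
      using conv unfolding Y_def[abs_def] Z_def[abs_def] .
  qed
qed

end
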